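(* Assume that $(X_t)_{t\ge0}$, $(A_t)_{t\ge0}$, $(H_t)_{t\ge0}$, $(M_t)_{t\ge0}$ (and a function $\eta$) satisfy Assumption $\mathcal A_{no\sup}$ (or Assumption $\mathcal A_{\sup}$) on some filtered probability space $(\Omega,\mathcal F,\mathbb P,(\mathcal F_t)_{t\ge0})$. Denote by $A^c$ the continuous part of $A$, i.e. $A^c_t:=A_t-\sum_{s\le t}\Delta A_s$ for all $t\ge0$. Assume that $A^c$ is strictly increasing and $A^c_\infty=+\infty$. Then there exist a filtration $(\tilde{\mathcal F}_t)_{t\ge0}$ and processes $(\tilde X,\tilde A,\tilde H,\tilde M)$ satisfying Assumption $\mathcal A_{no\sup}$ (respectively $\mathcal A_{\sup}$), with the same $\eta$, on $(\Omega,\mathcal F,\mathbb P,(\tilde{\mathcal F}_t)_{t\ge0})$ such that: (a) $\tilde A_t=t$ for all $t\ge0$; (b) for all $t\ge0$: $\tilde X_{A_t}=X_t$, $\tilde M_{A_t}=M_t$, $\tilde H_{A_t}=H_t$, and $A_s$ is a $(\tilde{\mathcal F}_t)_{t\ge0}$ stopping time for every $s\ge0$; (c) if $H$ is predictable then $\tilde H$ is predictable (with respect to $(\tilde{\mathcal F}_t)_{t\ge 0}$); (d) if $M$ has no negative jumps then $\tilde M$ has no negative jumps; (e) $(\Omega,\mathcal F,\mathbb P,(\tilde{\mathcal F}_t)_{t\ge0})$ satisfies the usual conditions.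
   Context: Filtered probability spaces are assumed to satisfy the usual conditions (complete, right-continuous). $X_t^*:=\sup_{0\le s\le t}X_s$, $X^*_{t^-}:=\sup_{s<t}X_s$ for $t>0$, $X^*_{0^-}:=X_0$; $\Delta A_s:=A_s-A_{s^-}$. Assumption $\mathcal A_{\sup}$: $(X_t)_{t\ge0}$ is an adapted right-continuous process with $X\ge c_0$ for some constant $c_0\ge0$; $(A_t)_{t\ge0}$ is a predictable non-decreasing càdlàg process with $A_0=0$; $(H_t)_{t\ge0}$ is an adapted non-negative non-decreasing càdlàg process; $(M_t)_{t\ge0}$ is a càdlàg local martingale with $M_0=0$; $\eta:[c_0,\infty)\to[0,\infty)$ is a continuous non-decreasing function with $\eta(x)>0$ for $x>c_0$; and for all $t\ge0$ $$X_t\le\int_{(0,t]}\eta(X^*_{s^-})\,dA_s+M_t+H_t\qquad\mathbb P\text{-a.s.}$$ Assumption $\mathcal A_{no\sup}$: the same assumptions on the processes and $\eta$, in addition $X$ has left limits, and for all $t\ge0$ $$X_t\le\int_{(0,t]}\eta(X_{s^-})\,dA_s+M_t+H_t\qquad\mathbb P\text{-a.s.}$$ *)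

theory Defs
  imports "HOL-Probability.Probability"
begin

text \<open>
  Time is \<open>[0, \<infinity>)\<close>, represented by the type \<^typ>\<open>real\<close>: only the values of a process at times
  \<open>t \<ge> 0\<close> matter. Negative indices of a filtration carry no information, since every filtration on
  \<open>[0, \<infinity>)\<close> extends to all of \<^typ>\<open>real\<close> by \<open>F t = F 0\<close> for \<open>t < 0\<close>. Path properties are required for
  every \<open>\<omega>\<close> in the sample space, unless they are explicitly qualified by \<open>AE\<close>.
\<close>

section \<open>Filtered probability spaces and processes\<close>

definition filtered_prob_space :: "'a measure \<Rightarrow> (real \<Rightarrow> 'a measure) \<Rightarrow> bool" where
  "filtered_prob_space P F \<longleftrightarrow>
     prob_space P \<and> filtration (space P) F \<and> (\<forall>t\<ge>0. subalgebra P (F t))"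

definition usual_conditions :: "'a measure \<Rightarrow> (real \<Rightarrow> 'a measure) \<Rightarrow> bool" where
  "usual_conditions P F \<longleftrightarrow>
     complete_measure P \<and> null_sets P \<subseteq> sets (F 0) \<and>
     (\<forall>t\<ge>0. sets (F t) = (\<Inter>u\<in>{t<..}. sets (F u)))"

definition adapted :: "(real \<Rightarrow> 'a measure) \<Rightarrow> (real \<Rightarrow> 'a \<Rightarrow> real) \<Rightarrow> bool" where
  "adapted F X \<longleftrightarrow> (\<forall>t\<ge>0. X t \<in> borel_measurable (F t))"

definition predictable_sigma :: "(real \<Rightarrow> 'a measure) \<Rightarrow> (real \<times> 'a) measure" where
  "predictable_sigma F =
     sigma ({0..} \<times> space (F 0))
       ({{0} \<times> B | B. B \<in> sets (F 0)} \<union>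
        {{s<..t} \<times> B | s t B. 0 \<le> s \<and> s \<le> t \<and> B \<in> sets (F s)})"

definition predictable :: "(real \<Rightarrow> 'a measure) \<Rightarrow> (real \<Rightarrow> 'a \<Rightarrow> real) \<Rightarrow> bool" where
  "predictable F X \<longleftrightarrow> (\<lambda>(t, \<omega>). X t \<omega>) \<in> borel_measurable (predictable_sigma F)"

text \<open>The library's \<^const>\<open>stopping_time\<close> takes values in the time index type; localizing sequences
  are allowed to take the value \<open>\<infinity>\<close>.\<close>

definition ext_stopping_time :: "(real \<Rightarrow> 'a measure) \<Rightarrow> ('a \<Rightarrow> ennreal) \<Rightarrow> bool" where
  "ext_stopping_time F \<tau> \<longleftrightarrow> (\<forall>t\<ge>0. Measurable.pred (F t) (\<lambda>\<omega>. \<tau> \<omega> \<le> ennreal t))"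

definition stopped :: "(real \<Rightarrow> 'a \<Rightarrow> real) \<Rightarrow> ('a \<Rightarrow> ennreal) \<Rightarrow> real \<Rightarrow> 'a \<Rightarrow> real" where
  "stopped X \<tau> = (\<lambda>t \<omega>. X (enn2real (min (ennreal t) (\<tau> \<omega>))) \<omega>)"

definition martingale :: "'a measure \<Rightarrow> (real \<Rightarrow> 'a measure) \<Rightarrow> (real \<Rightarrow> 'a \<Rightarrow> real) \<Rightarrow> bool" where
  "martingale P F N \<longleftrightarrow>
     adapted F N \<and> (\<forall>t\<ge>0. integrable P (N t)) \<and>
     (\<forall>s t. 0 \<le> s \<and> s \<le> t \<longrightarrow> (AE \<omega> in P. real_cond_exp P (F s) (N t) \<omega> = N s \<omega>))"

text \<open>This notion is used only for processes starting at \<open>0\<close>, so no correction for a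
  non-integrable initial value is needed.\<close>

definition local_martingale ::
  "'a measure \<Rightarrow> (real \<Rightarrow> 'a measure) \<Rightarrow> (real \<Rightarrow> 'a \<Rightarrow> real) \<Rightarrow> bool" where
  "local_martingale P F N \<longleftrightarrow>
     adapted F N \<and>
     (\<exists>\<tau>::nat \<Rightarrow> 'a \<Rightarrow> ennreal.
        (\<forall>n. ext_stopping_time F (\<tau> n)) \<and>
        (AE \<omega> in P. incseq (\<lambda>n. \<tau> n \<omega>) \<and> (\<lambda>n. \<tau> n \<omega>) \<longlonglongrightarrow> \<infinity>) \<and>
        (\<forall>n. martingale P F (stopped N (\<tau> n))))"

section \<open>Paths\<close>

definition right_cont_path :: "(real \<Rightarrow> real) \<Rightarrow> bool" where
  "right_cont_path f \<longleftrightarrow> (\<forall>t\<ge>0. continuous (at_right t) f)"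

definition left_limits_path :: "(real \<Rightarrow> real) \<Rightarrow> bool" where
  "left_limits_path f \<longleftrightarrow> (\<forall>t>0. \<exists>l. (f \<longlongrightarrow> l) (at_left t))"

definition cadlag_path :: "(real \<Rightarrow> real) \<Rightarrow> bool" where
  "cadlag_path f \<longleftrightarrow> right_cont_path f \<and> left_limits_path f"

text \<open>\<open>f\<^bsub>t-\<^esub>\<close>, with the convention \<open>f\<^bsub>0-\<^esub> = f\<^bsub>0\<^esub>\<close>.\<close>

definition left_lim :: "(real \<Rightarrow> real) \<Rightarrow> real \<Rightarrow> real" where
  "left_lim f t = (if t = 0 then f 0 else Lim (at_left t) f)"

definition jump :: "(real \<Rightarrow> real) \<Rightarrow> real \<Rightarrow> real" where
  "jump f t = f t - left_lim f t"

definition continuous_part :: "(real \<Rightarrow> real) \<Rightarrow> real \<Rightarrow> real" where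
  "continuous_part f t = f t - (\<Sum>\<^sub>\<infinity>s\<in>{0..t}. jump f s)"

definition no_negative_jumps :: "(real \<Rightarrow> real) \<Rightarrow> bool" where
  "no_negative_jumps f \<longleftrightarrow> (\<forall>t\<ge>0. jump f t \<ge> 0)"

text \<open>\<open>f\<^sup>*\<^bsub>t-\<^esub>\<close>, the supremum of \<open>f\<close> over \<open>[0, t)\<close>. It is meaningful only if \<open>f\<close> is bounded above on
  \<open>[0, t)\<close>.\<close>

definition running_sup_left :: "(real \<Rightarrow> real) \<Rightarrow> real \<Rightarrow> real" where
  "running_sup_left f t = (if t = 0 then f 0 else (SUP s\<in>{0..<t}. f s))"

text \<open>The Lebesgue--Stieltjes measure of a non-decreasing right-continuous function on \<open>[0, \<infinity>)\<close>,
  extended constantly to the left of \<open>0\<close> because \<^const>\<open>interval_measure\<close> expects a function on the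
  whole line.\<close>

definition stieltjes :: "(real \<Rightarrow> real) \<Rightarrow> real measure" where
  "stieltjes a = interval_measure (\<lambda>s. a (max 0 s))"

section \<open>The two sets of assumptions\<close>

definition assumption_common ::
  "'a measure \<Rightarrow> (real \<Rightarrow> 'a measure) \<Rightarrow> real \<Rightarrow> (real \<Rightarrow> real) \<Rightarrow> (real \<Rightarrow> 'a \<Rightarrow> real) \<Rightarrow>
   (real \<Rightarrow> 'a \<Rightarrow> real) \<Rightarrow> (real \<Rightarrow> 'a \<Rightarrow> real) \<Rightarrow> (real \<Rightarrow> 'a \<Rightarrow> real) \<Rightarrow> bool" where
  "assumption_common P F c0 \<eta> X A H M \<longleftrightarrow>
     filtered_prob_space P F \<and>
     c0 \<ge> 0 \<and>
     adapted F X \<and>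
     (\<forall>\<omega>\<in>space P. right_cont_path (\<lambda>t. X t \<omega>) \<and> (\<forall>t\<ge>0. X t \<omega> \<ge> c0)) \<and>
     predictable F A \<and>
     (\<forall>\<omega>\<in>space P. cadlag_path (\<lambda>t. A t \<omega>) \<and> mono_on {0..} (\<lambda>t. A t \<omega>) \<and> A 0 \<omega> = 0) \<and>
     adapted F H \<and>
     (\<forall>\<omega>\<in>space P. cadlag_path (\<lambda>t. H t \<omega>) \<and> mono_on {0..} (\<lambda>t. H t \<omega>) \<and> (\<forall>t\<ge>0. H t \<omega> \<ge> 0)) \<and>
     local_martingale P F M \<and>
     (\<forall>\<omega>\<in>space P. cadlag_path (\<lambda>t. M t \<omega>) \<and> M 0 \<omega> = 0) \<and>
     continuous_on {c0..} \<eta> \<and> mono_on {c0..} \<eta> \<and> (\<forall>x\<ge>c0. \<eta> x \<ge> 0) \<and> (\<forall>x>c0. \<eta> x > 0)"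

text \<open>Since \<open>\<eta>\<close> is defined on \<open>[c0, \<infinity>)\<close> only, the integrand \<open>\<eta> (X\<^sup>*\<^bsub>s-\<^esub>)\<close> makes sense only if
  \<open>X\<^sup>*\<^bsub>s-\<^esub> < \<infinity>\<close>. This is not automatic for a process without left limits, hence the explicit
  boundedness condition; it holds iff the right-hand side of the inequality is almost surely finite.\<close>

definition assumption_sup ::
  "'a measure \<Rightarrow> (real \<Rightarrow> 'a measure) \<Rightarrow> real \<Rightarrow> (real \<Rightarrow> real) \<Rightarrow> (real \<Rightarrow> 'a \<Rightarrow> real) \<Rightarrow>
   (real \<Rightarrow> 'a \<Rightarrow> real) \<Rightarrow> (real \<Rightarrow> 'a \<Rightarrow> real) \<Rightarrow> (real \<Rightarrow> 'a \<Rightarrow> real) \<Rightarrow> bool" where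
  "assumption_sup P F c0 \<eta> X A H M \<longleftrightarrow>
     assumption_common P F c0 \<eta> X A H M \<and>
     (\<forall>t\<ge>0. AE \<omega> in P. bdd_above ((\<lambda>s. X s \<omega>) ` {0..<t})) \<and>
     (\<forall>t\<ge>0. AE \<omega> in P.
        X t \<omega> \<le> (LINT s:{0<..t}|stieltjes (\<lambda>s. A s \<omega>). \<eta> (running_sup_left (\<lambda>u. X u \<omega>) s))
                + M t \<omega> + H t \<omega>)"

definition assumption_nosup ::
  "'a measure \<Rightarrow> (real \<Rightarrow> 'a measure) \<Rightarrow> real \<Rightarrow> (real \<Rightarrow> real) \<Rightarrow> (real \<Rightarrow> 'a \<Rightarrow> real) \<Rightarrow>
   (real \<Rightarrow> 'a \<Rightarrow> real) \<Rightarrow> (real \<Rightarrow> 'a \<Rightarrow> real) \<Rightarrow> (real \<Rightarrow> 'a \<Rightarrow> real) \<Rightarrow> bool" where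
  "assumption_nosup P F c0 \<eta> X A H M \<longleftrightarrow>
     assumption_common P F c0 \<eta> X A H M \<and>
     (\<forall>\<omega>\<in>space P. left_limits_path (\<lambda>t. X t \<omega>)) \<and>
     (\<forall>t\<ge>0. AE \<omega> in P.
        X t \<omega> \<le> (LINT s:{0<..t}|stieltjes (\<lambda>s. A s \<omega>). \<eta> (left_lim (\<lambda>u. X u \<omega>) s))
                + M t \<omega> + H t \<omega>)"

end

theory Submission
  imports Defs
begin

text \<open>
  Write \<open>C\<^sub>u = inf {s. A\<^sub>s \<ge> u}\<close>. Since \<open>A\<close> is strictly increasing, \<open>C\<close> is continuous and \<open>C(A\<^sub>t) = t\<close>, and a
  process \<open>Y\<close> is rewritten on the new time scale by \<open>Y'\<^sub>u = Y(C\<^sub>u)\<close> whenever \<open>u\<close> is a value of \<open>A\<close>. A jump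
  of \<open>A\<close> at time \<open>t\<close> opens a gap \<open>[A\<^sub>t\<^sub>-, A\<^sub>t)\<close> on which \<open>C = t\<close>. On a gap the right value is \<open>Y\<^sub>t\<^sub>-\<close>, not
  \<open>Y\<^sub>t\<close>: the inequality for \<open>X'\<close> at \<open>u\<close> in the gap is then the limit \<open>s \<uparrow> t\<close> of the inequality for \<open>X\<close>,
  plus a non-negative contribution of the integral, whereas \<open>X\<^sub>t\<close> may already exceed what has been
  integrated so far. If \<open>X\<close> has no left limits, the limit superior along rationals takes their place; it
  obeys the same upper bounds, and the supremum of \<open>X'\<close> before \<open>u\<close> is that of \<open>X\<close> before \<open>C\<^sub>u\<close>. As
  \<open>dA\<close> is the image of Lebesgue measure under \<open>C\<close>, the integrals agree as well.

  With this choice a jump of \<open>M\<close> at time \<open>t\<close> is carried out at the end \<open>A\<^sub>t\<close> of the gap, so it must not be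
  foreseeable on the new scale before \<open>A\<^sub>t\<close>. Accordingly an event \<open>B \<in> F\<^sub>r\<close> is revealed at time \<open>A\<^sub>r\<close>: the events
  \<open>B \<inter> {A\<^sub>r \<le> w}\<close> with \<open>w \<le> v\<close> generate a \<open>\<sigma>\<close>-algebra \<open>G\<^sub>v\<close>, and \<open>F'\<close> is the right-continuous version
  of \<open>G\<close> (definitions \<open>revealed\<close>, \<open>G\<close>, \<open>changed_filtration\<close>). These generators are closed under
  intersection, so the martingale property has to be checked on a single one of them.

  The heart of the matter is that \<open>M'\<close> is a local martingale. After stopping this is a statement about a
  martingale \<open>N\<close> closed by a random variable \<open>\<xi>\<close>: replacing \<open>N(C\<^sub>v)\<close> by the left limit \<open>N(C\<^sub>v-)\<close> on the
  event that \<open>v\<close> lies in a gap does not change the expectation. On that event the graph of \<open>C\<^sub>v\<close> is a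
  predictable set, because \<open>A\<close> is predictable. By inner regularity (\<open>predictable_inner_regular\<close>) the
  graph is exhausted, up to null sets, by countable intersections of finite unions of sets
  \<open>[a, b] \<times> B\<close> with \<open>B\<close> known strictly before \<open>a\<close>. The debut of such a finite union is announced by stopping
  times with finitely many values, and compactness of the sections makes these converge to \<open>C\<^sub>v\<close> from the
  left. Optional stopping at times with finitely many values is elementary, and every limit is justified
  by one uniform integrability argument: the tails \<open>E(\<bar>Y\<bar> - R)\<^sup>+\<close> of all variables in question are bounded
  by those of \<open>\<xi>\<close> (\<open>tails_dominated\<close>). The steps are carried out in \<open>value_before_delta\<close>,
  \<open>value_before_predictable\<close> and \<open>changed_martingale\<close>.
\<close>

section \<open>Left limits superior and the time change of a path\<close>

text \<open>Only rational times enter: an almost sure bound at each fixed time then holds at all of them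
  simultaneously, and suprema over rational times are measurable.\<close>
definition left_limsup :: "(real \<Rightarrow> real) \<Rightarrow> real \<Rightarrow> ereal" where
  "left_limsup f t = Limsup (at t within {..<t} \<inter> \<rat>) (\<lambda>s. ereal (f s))"

text \<open>The default value \<open>f 0\<close> at an infinite limit superior keeps a lower bound of \<open>f\<close> intact and is known at
  time \<open>0\<close>, so that neither the bound nor the measurability of a time-changed process is lost on the
  exceptional event.\<close>
definition pre_value :: "(real \<Rightarrow> real) \<Rightarrow> real \<Rightarrow> real" where
  "pre_value f t = (if \<bar>left_limsup f t\<bar> = \<infinity> then f 0 else real_of_ereal (left_limsup f t))"

lemma rational_left_nontrivial: "at (t::real) within {..<t} \<inter> \<rat> \<noteq> bot"
proof -
  have "t islimpt ({..<t} \<inter> \<rat>)"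
    unfolding islimpt_approachable
  proof (intro allI impI)
    fix e :: real assume "e > 0"
    then obtain q where q: "q \<in> \<rat>" "t - e < q" "q < t"
      using Rats_dense_in_real[of "t - e" t] by auto
    then show "\<exists>x'\<in>{..<t} \<inter> \<rat>. x' \<noteq> t \<and> dist x' t < e"
      by (intro bexI[of _ q]) (auto simp: dist_real_def)
  qed
  then show ?thesis using trivial_limit_within by blast
qed

lemma eventually_rational_left:
  assumes "d < (t::real)" "\<And>s. d < s \<Longrightarrow> s < t \<Longrightarrow> s \<in> \<rat> \<Longrightarrow> Q s"
  shows "eventually Q (at t within {..<t} \<inter> \<rat>)"
  unfolding eventually_at
  by (rule exI[of _ "t - d"]) (use assms in \<open>auto simp: dist_real_def\<close>)

lemma left_limsup_le:
  assumes "d < t" "\<And>s. d < s \<Longrightarrow> s < t \<Longrightarrow> s \<in> \<rat> \<Longrightarrow> f s \<le> u"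
  shows "left_limsup f t \<le> ereal u"
  unfolding left_limsup_def
  by (rule Limsup_bounded[OF eventually_rational_left[OF assms(1)]]) (use assms(2) in auto)

lemma left_limsup_ge:
  assumes "d < t" "\<And>s. d < s \<Longrightarrow> s < t \<Longrightarrow> s \<in> \<rat> \<Longrightarrow> l \<le> f s"
  shows "ereal l \<le> left_limsup f t"
proof -
  have "ereal l \<le> Liminf (at t within {..<t} \<inter> \<rat>) (\<lambda>s. ereal (f s))"
    by (rule Liminf_bounded[OF eventually_rational_left[OF assms(1)]]) (use assms(2) in auto)
  also have "\<dots> \<le> left_limsup f t"
    unfolding left_limsup_def by (rule Liminf_le_Limsup[OF rational_left_nontrivial])
  finally show ?thesis .
qed

lemma pre_value_bounds:
  assumes "d < t" "\<And>s. d < s \<Longrightarrow> s < t \<Longrightarrow> s \<in> \<rat> \<Longrightarrow> l \<le> f s \<and> f s \<le> u"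
  shows "l \<le> pre_value f t" "pre_value f t \<le> u"
  using left_limsup_le[of d t f u] left_limsup_ge[of d t l f] assms
  unfolding pre_value_def by (cases "left_limsup f t"; force)+

lemma tendsto_left_imp_left_limsup:
  assumes "(f \<longlongrightarrow> l) (at_left t)"
  shows "left_limsup f t = ereal l"
  unfolding left_limsup_def
  by (rule lim_imp_Limsup[OF rational_left_nontrivial])
     (use tendsto_within_subset[OF assms, of "{..<t} \<inter> \<rat>"] in \<open>auto intro: tendsto_intros\<close>)

lemma tendsto_left_imp_pre_value:
  assumes "(f \<longlongrightarrow> l) (at_left t)"
  shows "pre_value f t = l"
  using tendsto_left_imp_left_limsup[OF assms] by (simp add: pre_value_def)

lemma tendsto_left_imp_left_lim:
  assumes "(f \<longlongrightarrow> l) (at_left t)" "t \<noteq> 0"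
  shows "left_lim f t = l"
  using tendsto_Lim[OF _ assms(1)] assms(2) by (simp add: left_lim_def)

lemma left_limits_tendsto:
  assumes "left_limits_path f" "t > 0"
  shows "(f \<longlongrightarrow> left_lim f t) (at_left t)" "(f \<longlongrightarrow> pre_value f t) (at_left t)"
proof -
  obtain l where "(f \<longlongrightarrow> l) (at_left t)" using assms by (auto simp: left_limits_path_def)
  then show "(f \<longlongrightarrow> left_lim f t) (at_left t)" "(f \<longlongrightarrow> pre_value f t) (at_left t)"
    using tendsto_left_imp_left_lim[of f l t] tendsto_left_imp_pre_value[of f l t] assms(2) by auto
qed

lemma right_cont_near:
  assumes f: "right_cont_path f" and t: "0 \<le> t" and e: "0 < e"
  obtains b where "t < b" "\<And>y. t < y \<Longrightarrow> y < b \<Longrightarrow> f t - e \<le> f y \<and> f y \<le> f t + e"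
proof -
  have "(f \<longlongrightarrow> f t) (at_right t)"
    using f t by (auto simp: right_cont_path_def continuous_within)
  then have "eventually (\<lambda>s. dist (f s) (f t) < e) (at_right t)" using e by (rule tendstoD)
  then obtain b where b: "t < b" "\<And>y. t < y \<Longrightarrow> y < b \<Longrightarrow> dist (f y) (f t) < e"
    by (auto simp: eventually_at_right[of t "t + 1"])
  have "f t - e \<le> f y \<and> f y \<le> f t + e" if "t < y" "y < b" for y
    using b(2)[OF that] by (simp add: dist_real_def abs_if split: if_splits)
  with b(1) show ?thesis by (rule that)
qed

lemma tendsto_left_near:
  fixes f :: "real \<Rightarrow> real"
  assumes f: "(f \<longlongrightarrow> l) (at_left t)" and e: "0 < e"
  obtains b where "b < t" "\<And>y. b < y \<Longrightarrow> y < t \<Longrightarrow> l - e \<le> f y \<and> f y \<le> l + e"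
proof -
  have "eventually (\<lambda>s. dist (f s) l < e) (at_left t)" using f e by (rule tendstoD)
  then obtain b where b: "b < t" "\<And>y. b < y \<Longrightarrow> y < t \<Longrightarrow> dist (f y) l < e"
    by (auto simp: eventually_at_left[of "t - 1" t])
  have "l - e \<le> f y \<and> f y \<le> l + e" if "b < y" "y < t" for y
    using b(2)[OF that] by (simp add: dist_real_def abs_if split: if_splits)
  with b(1) show ?thesis by (rule that)
qed

lemma pre_value_ge:
  assumes "t > 0" "\<And>s. s \<ge> 0 \<Longrightarrow> c \<le> f s"
  shows "c \<le> pre_value f t"
proof (cases "\<bar>left_limsup f t\<bar> = \<infinity>")
  case False
  have "ereal c \<le> left_limsup f t" by (rule left_limsup_ge[of 0]) (use assms in auto)
  with False show ?thesis by (auto simp: pre_value_def ereal_le_real_iff)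
qed (use assms in \<open>auto simp: pre_value_def\<close>)

definition clock_inv :: "(real \<Rightarrow> real) \<Rightarrow> real \<Rightarrow> real" where
  "clock_inv a u = Inf {s. 0 \<le> s \<and> u \<le> a s}"

text \<open>The first case says that \<open>u\<close> is a value of the clock; in the second, \<open>u\<close> lies in the gap opened by a
  jump of the clock.\<close>
definition time_change :: "(real \<Rightarrow> real) \<Rightarrow> (real \<Rightarrow> real) \<Rightarrow> real \<Rightarrow> real" where
  "time_change a f u =
     (if a (clock_inv a u) = u then f (clock_inv a u) else pre_value f (clock_inv a u))"

locale clock =
  fixes a :: "real \<Rightarrow> real"
  assumes strict: "strict_mono_on {0..} a"
    and right_cont: "right_cont_path a"
    and zero [simp]: "a 0 = 0"
    and unbounded: "\<And>x. \<exists>t\<ge>0. x \<le> a t"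
begin

abbreviation "C \<equiv> clock_inv a"

lemma less_iff: "0 \<le> s \<Longrightarrow> 0 \<le> t \<Longrightarrow> a s < a t \<longleftrightarrow> s < t"
  using strict_mono_on_less[OF strict, of s t] by auto

lemma le_iff: "0 \<le> s \<Longrightarrow> 0 \<le> t \<Longrightarrow> a s \<le> a t \<longleftrightarrow> s \<le> t"
  using less_iff[of t s] by (simp add: not_less[symmetric])

lemma clock_nonneg: "0 \<le> s \<Longrightarrow> 0 \<le> a s"
  using le_iff[of 0 s] by simp

lemma C_nonneg: "0 \<le> C u"
  unfolding clock_inv_def by (rule cInf_greatest) (use unbounded in auto)

text \<open>By right-continuity the infimum is attained.\<close>
lemma le_clock_C: "u \<le> a (C u)"
proof (rule ccontr)
  assume "\<not> u \<le> a (C u)"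
  then have lt: "a (C u) < u" by simp
  have "(a \<longlongrightarrow> a (C u)) (at_right (C u))"
    using right_cont C_nonneg by (auto simp: right_cont_path_def continuous_within)
  from order_tendstoD(2)[OF this lt]
  obtain b where b: "b > C u" "\<And>y. C u < y \<Longrightarrow> y < b \<Longrightarrow> a y < u"
    by (auto simp: eventually_at_right[of "C u" "C u + 1"])
  obtain s where s: "0 \<le> s" "u \<le> a s" "s < b"
    using cInf_lessD[of "{s. 0 \<le> s \<and> u \<le> a s}" b] unbounded[of u] b(1)
    unfolding clock_inv_def by auto
  have "C u \<le> s" unfolding clock_inv_def by (rule cInf_lower) (use s in \<open>auto intro: bdd_belowI\<close>)
  then show False using b(2)[of s] s lt by (cases "s = C u") auto
qed

lemma C_le_iff: "0 \<le> s \<Longrightarrow> C u \<le> s \<longleftrightarrow> u \<le> a s"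
proof
  assume "0 \<le> s" "C u \<le> s"
  then show "u \<le> a s" using le_clock_C[of u] le_iff[of "C u" s] C_nonneg[of u] by auto
next
  assume "0 \<le> s" "u \<le> a s"
  then show "C u \<le> s"
    unfolding clock_inv_def by (intro cInf_lower) (auto intro: bdd_belowI)
qed

lemma less_C_iff: "0 \<le> s \<Longrightarrow> s < C u \<longleftrightarrow> a s < u"
  using C_le_iff[of s u] by auto

lemma C_clock [simp]: "0 \<le> t \<Longrightarrow> C (a t) = t"
  using C_le_iff[of t "a t"] C_le_iff[OF C_nonneg, of "a t" "a t"] le_iff[of t "C (a t)"] C_nonneg
  by fastforce

lemma C_mono: "u \<le> v \<Longrightarrow> C u \<le> C v"
  using C_le_iff[OF C_nonneg, of u v] le_clock_C[of v] by simp

lemma C_pos: "0 < u \<Longrightarrow> 0 < C u"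
  using less_C_iff[of 0 u] by simp

lemma C_zero [simp]: "C 0 = 0" using C_clock[of 0] by simp

lemma C_nonpos: "u \<le> 0 \<Longrightarrow> C u = 0"
  using C_mono[of u 0] C_nonneg[of u] by simp

lemma mono_C: "mono C" by (rule monoI) (rule C_mono)

lemma pos_of_gap: "0 \<le> u \<Longrightarrow> a (C u) \<noteq> u \<Longrightarrow> 0 < C u \<and> 0 < u"
  using C_nonneg[of u] by (metis C_clock C_pos less_eq_real_def zero)

lemma time_change_clock [simp]: "0 \<le> t \<Longrightarrow> time_change a f (a t) = f t"
  by (simp add: time_change_def)

lemma time_change_zero: "time_change a f 0 = f 0"
  using time_change_clock[of 0 f] by simp

lemma time_change_ge:
  assumes "0 \<le> u" "\<And>s. s \<ge> 0 \<Longrightarrow> c \<le> f s"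
  shows "c \<le> time_change a f u"
  unfolding time_change_def using pre_value_ge[of "C u" c f] pos_of_gap[OF assms(1)] assms C_nonneg
  by auto

lemma time_change_bounds:
  assumes "d < C u" "\<And>s. d < s \<Longrightarrow> s \<le> C u \<Longrightarrow> l \<le> f s \<and> f s \<le> b"
  shows "l \<le> time_change a f u \<and> time_change a f u \<le> b"
  using pre_value_bounds[of d "C u" l f b] assms unfolding time_change_def by auto

lemma constant_in_gap:
  assumes "C u = C v" "a (C u) \<noteq> u" "a (C v) \<noteq> v"
  shows "time_change a f u = time_change a f v"
  using assms by (simp add: time_change_def)

text \<open>Inside a gap the path is locally constant to the right. At a value \<open>u\<close> of the clock, nearby gaps to the
  right carry limits superior of \<open>f\<close> taken at times shortly after \<open>C u\<close>, and these are close to \<open>f (C u)\<close>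
  although \<open>f\<close> may have no left limits: this is what makes the limit superior a right-continuous choice.\<close>
lemma right_cont_time_change:
  assumes f: "right_cont_path f"
  shows "right_cont_path (time_change a f)"
  unfolding right_cont_path_def
proof (intro allI impI)
  fix u :: real assume u: "0 \<le> u"
  show "continuous (at_right u) (time_change a f)"
  proof (cases "a (C u) = u")
    case False
    then have lt: "u < a (C u)" using le_clock_C[of u] by simp
    have "C v = C u \<and> a (C v) \<noteq> v" if "u < v" "v < a (C u)" for v
      using C_mono[of u v] C_le_iff[OF C_nonneg[of u], of v] that by auto
    then have "eventually (\<lambda>v. time_change a f v = time_change a f u) (at_right u)"
      using False lt unfolding eventually_at_right[OF lt]
      by (intro exI[of _ "a (C u)"]) (auto intro: constant_in_gap)
    then show ?thesis unfolding continuous_within by (rule tendsto_eventually)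
  next
    case True
    let ?t = "C u"
    show ?thesis unfolding continuous_within
    proof (rule tendstoI)
      fix e :: real assume e: "e > 0"
      obtain b where b: "?t < b" and near: "\<And>y. ?t < y \<Longrightarrow> y < b \<Longrightarrow> f ?t - e/2 \<le> f y \<and> f y \<le> f ?t + e/2"
        using right_cont_near[OF f C_nonneg, of "e/2" u] e by auto
      have ub: "u < a ((?t + b)/2)"
        using less_iff[of ?t "(?t+b)/2"] b C_nonneg[of u] True by auto
      have "dist (time_change a f v) (time_change a f u) < e" if v: "u < v" "v < a ((?t+b)/2)" for v
      proof -
        have "C v \<le> (?t+b)/2" using C_le_iff[of "(?t+b)/2" v] v b C_nonneg[of u] by auto
        moreover have "?t < C v" using less_C_iff[OF C_nonneg[of u], of v] True v by auto
        ultimately have "f ?t - e/2 \<le> time_change a f v \<and> time_change a f v \<le> f ?t + e/2"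
          using near b by (intro time_change_bounds[of ?t]) auto
        moreover have "time_change a f u = f ?t" using True by (simp add: time_change_def)
        ultimately show ?thesis using e by (auto simp: dist_real_def)
      qed
      then show "eventually (\<lambda>v. dist (time_change a f v) (time_change a f u) < e) (at_right u)"
        unfolding eventually_at_right[OF ub] using ub by blast
    qed
  qed
qed

text \<open>Either \<open>u\<close> is approached from within the gap at \<open>C u\<close>, where the time change is constantly the left
  limit, or \<open>C v \<uparrow> C u\<close> strictly as \<open>v \<uparrow> u\<close>.\<close>
lemma tendsto_left_time_change:
  assumes u: "0 < u" and f: "(f \<longlongrightarrow> l) (at_left (C u))"
  shows "(time_change a f \<longlongrightarrow> l) (at_left u)"
proof (cases "\<exists>v0<u. C v0 = C u")
  case True
  then obtain v0 where v0: "v0 < u" "C v0 = C u" by blast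
  have "time_change a f v = l" if v: "v0 < v" "v < u" for v
  proof -
    have "C v = C u" using C_mono[of v0 v] C_mono[of v u] v v0 by auto
    moreover have "v \<noteq> a (C u)" using le_clock_C[of u] v by auto
    ultimately show ?thesis
      using tendsto_left_imp_pre_value[OF f] by (auto simp: time_change_def)
  qed
  then have "eventually (\<lambda>v. time_change a f v = l) (at_left u)"
    unfolding eventually_at_left[OF v0(1)] using v0(1) by blast
  then show ?thesis by (rule tendsto_eventually)
next
  case False
  let ?t = "C u"
  have t: "0 < ?t" using C_pos u by simp
  show ?thesis
  proof (rule tendstoI)
    fix e :: real assume e: "e > 0"
    obtain b where b: "b < ?t" and near: "\<And>y. b < y \<Longrightarrow> y < ?t \<Longrightarrow> l - e/2 \<le> f y \<and> f y \<le> l + e/2"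
      using tendsto_left_near[OF f, of "e/2"] e by auto
    define d where "d = max b 0"
    have d: "d \<ge> 0" "d < ?t" using b t by (auto simp: d_def)
    have "a d < u" using less_C_iff[of d u] d by auto
    moreover have "dist (time_change a f v) l < e" if v: "a d < v" "v < u" for v
    proof -
      have "d < C v" using less_C_iff[of d v] d v by auto
      moreover have "C v < ?t" using C_mono[of v u] False v by force
      ultimately have "l - e/2 \<le> time_change a f v \<and> time_change a f v \<le> l + e/2"
        using near by (intro time_change_bounds[of d]) (auto simp: d_def)
      then show ?thesis using e by (auto simp: dist_real_def)
    qed
    ultimately show "eventually (\<lambda>v. dist (time_change a f v) l < e) (at_left u)"
      unfolding eventually_at_left[OF \<open>a d < u\<close>] by blast
  qed
qed

lemma left_limits_time_change:
  assumes "left_limits_path f"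
  shows "left_limits_path (time_change a f)"
  unfolding left_limits_path_def
  using tendsto_left_time_change left_limits_tendsto(1)[OF assms C_pos] by blast

lemma cadlag_time_change: "cadlag_path f \<Longrightarrow> cadlag_path (time_change a f)"
  by (simp add: cadlag_path_def right_cont_time_change left_limits_time_change)

lemma left_lim_time_change:
  assumes "left_limits_path f" "0 < u"
  shows "left_lim (time_change a f) u = left_lim f (C u)"
  using tendsto_left_imp_left_lim[OF tendsto_left_time_change[OF assms(2)
        left_limits_tendsto(1)[OF assms(1) C_pos[OF assms(2)]]]] assms(2) by simp

lemma no_negative_jumps_time_change:
  assumes f: "cadlag_path f" and j: "no_negative_jumps f"
  shows "no_negative_jumps (time_change a f)"
  unfolding no_negative_jumps_def
proof (intro allI impI)
  fix u :: real assume "0 \<le> u"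
  show "0 \<le> jump (time_change a f) u"
  proof (cases "u = 0")
    case True then show ?thesis by (simp add: jump_def left_lim_def)
  next
    case False
    then have u: "0 < u" using \<open>0 \<le> u\<close> by simp
    have ll: "left_limits_path f" using f by (simp add: cadlag_path_def)
    have "pre_value f (C u) = left_lim f (C u)"
      using left_limits_tendsto[OF ll C_pos[OF u]]
      by (intro tendsto_unique[of "at_left (C u)"]) auto
    then show ?thesis
      using j C_nonneg[of u] unfolding jump_def left_lim_time_change[OF ll u] no_negative_jumps_def
      by (auto simp: time_change_def jump_def)
  qed
qed

text \<open>Within one gap the value is constant and at most the value at the end of the gap; distinct values of \<open>C\<close>
  are separated by a value of \<open>f\<close>.\<close>
lemma mono_time_change:
  assumes f: "mono_on {0..} f"
  shows "mono_on {0..} (time_change a f)"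
proof (rule mono_onI)
  have below: "pre_value f t \<le> f t" if "0 < t" for t
    by (rule pre_value_bounds(2)[of 0 t "f 0"]) (use f that in \<open>auto intro: mono_onD\<close>)
  have above: "f s \<le> pre_value f t" if "0 \<le> s" "s < t" for s t
    by (rule pre_value_bounds(1)[of s t "f s" f "f t"]) (use f that in \<open>auto intro: mono_onD\<close>)
  fix u v :: real assume uv: "u \<in> {0..}" "v \<in> {0..}" "u \<le> v"
  have le: "time_change a f u \<le> f (C u)"
    unfolding time_change_def using below pos_of_gap[of u] uv by auto
  show "time_change a f u \<le> time_change a f v"
  proof (cases "C u = C v")
    case True
    show ?thesis
    proof (cases "a (C u) = u")
      case True
      then have "u = v" using \<open>C u = C v\<close> le_clock_C[of v] uv(3) by (metis order_antisym)
      then show ?thesis by simp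
    next
      case False
      then show ?thesis using le True below[of "C v"] pos_of_gap[of u] uv
        by (auto simp: time_change_def)
    qed
  next
    case False
    then have "C u < C v" using C_mono[of u v] uv by simp
    then have "f (C u) \<le> pre_value f (C v)" "f (C u) \<le> f (C v)"
      using above[OF C_nonneg, of u "C v"] mono_onD[OF f, of "C u" "C v"] C_nonneg by auto
    then have "f (C u) \<le> time_change a f v" by (simp add: time_change_def)
    then show ?thesis using le by simp
  qed
qed

end

section \<open>Change of variables and the pathwise inequality\<close>

lemma continuous_part_le:
  assumes a: "left_limits_path a" "mono_on {0..} a" and t: "0 \<le> t"
  shows "continuous_part a t \<le> a t"
proof -
  have "0 \<le> jump a r" if "r \<in> {0..t}" for r
  proof (cases "r = 0")
    case False
    then have r: "0 < r" using that by simp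
    have "eventually (\<lambda>s. a s \<le> a r) (at_left r)"
      unfolding eventually_at_left[OF r] using a(2) r
      by (intro exI[of _ 0]) (auto intro: mono_onD)
    then have "left_lim a r \<le> a r"
      by (intro tendsto_upperbound[OF left_limits_tendsto(1)[OF a(1) r]]) auto
    then show ?thesis by (simp add: jump_def)
  qed (simp add: jump_def left_lim_def)
  then have "0 \<le> (\<Sum>\<^sub>\<infinity>r\<in>{0..t}. jump a r)" by (rule infsum_nonneg)
  then show ?thesis by (simp add: continuous_part_def)
qed

text \<open>A jump inside the interval would contradict constancy, so both sums of jumps agree. Strict monotonicity of
  the continuous part thus forces strict monotonicity of the function, whether or not the jumps are
  summable.\<close>
lemma continuous_part_eq_on_flat:
  assumes flat: "\<And>r. s \<le> r \<Longrightarrow> r \<le> t \<Longrightarrow> a r = a s" and st: "0 \<le> s" "s < t"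
  shows "continuous_part a t = continuous_part a s"
proof -
  have "jump a r = 0" if r: "s < r" "r \<le> t" for r
  proof -
    have "eventually (\<lambda>v. a v = a r) (at_left r)"
      unfolding eventually_at_left[OF r(1)]
    proof (intro exI[of _ s] conjI allI impI)
      fix v assume "s < v" "v < r"
      then have "a v = a s" "a r = a s" using flat[of v] flat[of r] r by simp_all
      then show "a v = a r" by simp
    qed (use r in simp)
    then have "(a \<longlongrightarrow> a r) (at_left r)" by (rule tendsto_eventually)
    then show ?thesis using tendsto_left_imp_left_lim[of a "a r" r] r st by (simp add: jump_def)
  qed
  then have "(\<Sum>\<^sub>\<infinity>r\<in>{0..t}. jump a r) = (\<Sum>\<^sub>\<infinity>r\<in>{0..s}. jump a r)"
    using st by (intro infsum_cong_neutral) auto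
  then show ?thesis using flat[of t] st by (simp add: continuous_part_def)
qed

lemma clock_of_strict_continuous_part:
  assumes a: "cadlag_path a" "mono_on {0..} a" "a 0 = 0"
    and strict: "strict_mono_on {0..} (continuous_part a)"
    and unb: "filterlim (continuous_part a) at_top at_top"
  shows "clock a"
proof
  show "strict_mono_on {0..} a"
  proof (rule strict_mono_onI)
    fix s t :: real assume st: "s \<in> {0..}" "t \<in> {0..}" "s < t"
    show "a s < a t"
    proof (rule ccontr)
      assume "\<not> a s < a t"
      moreover have "a s \<le> a r" "a r \<le> a t" if "s \<le> r" "r \<le> t" for r
        using a(2) st that by (auto intro: mono_onD)
      ultimately have flat: "a r = a s" if "s \<le> r" "r \<le> t" for r
        using that by (meson leI order.antisym order_trans)
      have "continuous_part a t = continuous_part a s"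
        by (rule continuous_part_eq_on_flat[where a=a and s=s and t=t, OF flat]) (use st in simp_all)
      then show False using strict_mono_onD[OF strict st] by simp
    qed
  qed
  show "\<exists>t\<ge>0. x \<le> a t" for x
  proof -
    have "eventually (\<lambda>t. x \<le> continuous_part a t \<and> 0 \<le> t) at_top"
      using unb eventually_ge_at_top[of "0::real"]
      by (intro eventually_conj) (auto simp: filterlim_at_top)
    then obtain t where "x \<le> continuous_part a t" "0 \<le> t"
      using eventually_happens'[OF trivial_limit_at_top_linorder] by blast
    then show ?thesis
      using continuous_part_le[of a t] a by (auto simp: cadlag_path_def)
  qed
qed (use a in \<open>auto simp: cadlag_path_def\<close>)

lemma emeasure_stieltjes_Ioc:
  assumes "right_cont_path a" "mono_on {0..} a" "x \<le> y"
  shows "emeasure (stieltjes a) {x<..y} = ennreal (a (max 0 y) - a (max 0 x))"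
  unfolding stieltjes_def
proof (rule emeasure_interval_measure_Ioc[OF assms(3)])
  show "a (max 0 s) \<le> a (max 0 t)" if "s \<le> t" for s t
    using that assms(2) by (intro mono_onD[OF assms(2)]) auto
  show "continuous (at_right s) (\<lambda>s. a (max 0 s))" for s
  proof (cases "0 \<le> s")
    case True
    have "eventually (\<lambda>r. a (max 0 r) = a r) (at_right s)"
      unfolding eventually_at_right[of s "s+1", simplified] using True
      by (intro exI[of _ "s+1"]) (auto simp: max_def)
    moreover have "(a \<longlongrightarrow> a (max 0 s)) (at_right s)"
      using assms(1) True by (auto simp: right_cont_path_def continuous_within max_def)
    ultimately show ?thesis unfolding continuous_within by (simp add: filterlim_cong)
  next
    case False
    then have "s < 0" by simp
    have "eventually (\<lambda>r. a (max 0 r) = a (max 0 s)) (at_right s)"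
      unfolding eventually_at_right[OF \<open>s < 0\<close>] using False
      by (intro exI[of _ 0]) (auto simp: max_def)
    then show ?thesis unfolding continuous_within by (rule tendsto_eventually)
  qed
qed

abbreviation uniform_clock :: "real measure" where
  "uniform_clock \<equiv> stieltjes (\<lambda>s. s)"

lemma emeasure_uniform_clock_Ioc:
  "x \<le> y \<Longrightarrow> emeasure uniform_clock {x<..y} = ennreal (max 0 y - max 0 x)"
  by (rule emeasure_stieltjes_Ioc) (auto simp: right_cont_path_def mono_on_def)

lemma sets_stieltjes [simp, measurable_cong]: "sets (stieltjes a) = sets borel"
  by (simp add: stieltjes_def)

lemma space_stieltjes [simp]: "space (stieltjes a) = UNIV"
  by (simp add: stieltjes_def)

lemma uniform_clock_nonpos: "emeasure uniform_clock {..0} = 0"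
proof -
  have "{..0} = (\<Union>n. {- real n - 1<..0})"
  proof (intro equalityI subsetI)
    fix x :: real assume "x \<in> {..0}"
    moreover obtain n where "- x < real n" using reals_Archimedean2 by blast
    ultimately show "x \<in> (\<Union>n. {- real n - 1<..0})" by (intro UN_I[of n]) auto
  qed auto
  moreover have "{- real n - 1<..0} \<in> null_sets uniform_clock" for n
    using emeasure_uniform_clock_Ioc[of "- real n - 1" 0] by (intro null_setsI) auto
  ultimately have "{..0} \<in> null_sets uniform_clock" using null_sets_UN[of "\<lambda>n. {- real n - 1<..0}"] by simp
  then show ?thesis by auto
qed

context clock
begin

lemma mono: "mono_on {0..} a"
  using strict by (rule strict_mono_on_imp_mono_on)

lemma measurable_C [measurable]: "C \<in> borel_measurable borel"
  by (rule borel_measurable_mono[OF mono_C])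

text \<open>Both measures give \<open>(x, y]\<close> the mass \<open>a y - a x\<close>, since \<open>x < C v \<le> y\<close> means \<open>a x < v \<le> a y\<close>.\<close>
lemma stieltjes_eq_distr: "stieltjes a = distr uniform_clock borel C"
proof (rule measure_eqI_generator_eq[where E = "range (\<lambda>(x, y). {x<..y::real})" and \<Omega> = UNIV
      and A = "\<lambda>n::nat. {- real n<..real n}"])
  show "Int_stable (range (\<lambda>(x, y). {x<..y::real}))"
  proof (rule Int_stableI)
    fix S T assume "S \<in> range (\<lambda>(x, y). {x<..y::real})" "T \<in> range (\<lambda>(x, y). {x<..y::real})"
    then obtain x y x' y' where "S = {x<..y}" "T = {x'<..y'}" by auto
    then have "S \<inter> T = {max x x'<..min y y'}" by auto
    then show "S \<inter> T \<in> range (\<lambda>(x, y). {x<..y::real})" by auto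
  qed
  have borel: "sets borel = sigma_sets UNIV (range (\<lambda>(x, y). {x<..y::real}))"
    by (subst borel_sigma_sets_Ioc) (simp add: sets_measure_of)
  show "sets (stieltjes a) = sigma_sets UNIV (range (\<lambda>(x, y). {x<..y::real}))"
    "sets (distr uniform_clock borel C) = sigma_sets UNIV (range (\<lambda>(x, y). {x<..y::real}))"
    using borel by auto
  show "(\<Union>n. {- real n<..real n}) = UNIV"
  proof (intro equalityI subsetI UNIV_I)
    fix x :: real
    obtain n where "\<bar>x\<bar> < real n" using reals_Archimedean2 by blast
    then show "x \<in> (\<Union>n. {- real n<..real n})" by (intro UN_I[of n]) auto
  qed
  show "emeasure (stieltjes a) {- real n<..real n} \<noteq> \<infinity>" for n
    using emeasure_stieltjes_Ioc[OF right_cont mono, of "- real n" "real n"] by simp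
  fix S assume "S \<in> range (\<lambda>(x, y). {x<..y::real})"
  then obtain x y where S: "S = {x<..y}" by auto
  show "emeasure (stieltjes a) S = emeasure (distr uniform_clock borel C) S"
  proof (cases "x \<le> y")
    case False
    then show ?thesis using S by simp
  next
    case True
    have eq: "emeasure (distr uniform_clock borel C) S = emeasure uniform_clock (C -` {x<..y})"
      unfolding S by (subst emeasure_distr) auto
    consider "y < 0" | "x < 0" "0 \<le> y" | "0 \<le> x" by linarith
    then have "emeasure uniform_clock (C -` {x<..y}) = ennreal (a (max 0 y) - a (max 0 x))"
    proof cases
      case 1
      then have "C -` {x<..y} = {}" using C_nonneg by (fastforce dest: order_trans)
      then show ?thesis using 1 True by simp
    next
      case 2
      have "C -` {x<..y} = {..0} \<union> {0<..a y}"
        using C_nonneg C_le_iff[OF 2(2)] clock_nonneg[OF 2(2)] 2(1)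
        by (auto simp: less_le_trans intro: order_trans)
      moreover have "{..0} \<in> null_sets uniform_clock" using uniform_clock_nonpos by auto
      ultimately show ?thesis
        using 2 emeasure_uniform_clock_Ioc[of 0 "a y"] clock_nonneg[OF 2(2)]
        by (simp add: emeasure_Un_null_set[where B = "{..0}"] Un_commute[of "{..0}"] max_def)
    next
      case 3
      then have "C -` {x<..y} = {a x<..a y}" using True C_le_iff[of y] less_C_iff[of x] by auto
      then show ?thesis
        using 3 True emeasure_uniform_clock_Ioc[of "a x" "a y"] clock_nonneg[of x] clock_nonneg[of y]
          le_iff[of x y] by (simp add: max_def)
    qed
    then show ?thesis using eq emeasure_stieltjes_Ioc[OF right_cont mono True] S by simp
  qed
qed auto

lemma integral_time_change:
  fixes g :: "real \<Rightarrow> real"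
  assumes g: "(\<lambda>s. indicator {0<..} s * g s) \<in> borel_measurable borel" and t: "0 \<le> t"
  shows "(LINT s:{0<..t}|stieltjes a. g s) = (LINT v:{0<..a t}|uniform_clock. g (C v))"
proof -
  have eq: "indicator {0<..t} s *\<^sub>R g s = indicator {0<..t} s * (indicator {0<..} s * g s)" for s
    by (auto simp: indicator_def)
  have "(\<lambda>s. indicator {0<..t} s * (indicator {0<..} s * g s)) \<in> borel_measurable borel"
    by (intro borel_measurable_times g) simp
  then have meas: "(\<lambda>s. indicator {0<..t} s *\<^sub>R g s) \<in> borel_measurable borel"
    by (simp only: eq)
  have "(LINT s:{0<..t}|stieltjes a. g s)
      = (LINT v|uniform_clock. indicator {0<..t} (C v) *\<^sub>R g (C v))"
    unfolding set_lebesgue_integral_def stieltjes_eq_distr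
    by (rule integral_distr) (use meas in auto)
  also have "\<dots> = (LINT v:{0<..a t}|uniform_clock. g (C v))"
    unfolding set_lebesgue_integral_def
    using C_le_iff[OF t] C_pos C_nonpos by (intro Bochner_Integration.integral_cong)
      (auto simp: indicator_def not_le[symmetric])
  finally show ?thesis .
qed

text \<open>Both assumptions of the theorem are instances, with \<open>g\<close> the integrand as a function of the old time. At a
  value of the clock the inequality is passed from rational times to \<open>C u\<close> from the right, which uses that
  the transformed integral is locally Lipschitz in its upper limit. In a gap it is passed to \<open>C u\<close> from the
  left, where the integral up to a rational \<open>q < C u\<close> is at most the one up to \<open>u\<close>.\<close>
lemma time_change_inequality:
  fixes f m h g :: "real \<Rightarrow> real"
  assumes f: "right_cont_path f" "\<And>s. 0 \<le> s \<Longrightarrow> c \<le> f s"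
    and m: "cadlag_path m" and h: "cadlag_path h"
    and g_meas: "(\<lambda>s. indicator {0<..} s * g s) \<in> borel_measurable borel"
    and g_nonneg: "\<And>s. 0 < s \<Longrightarrow> 0 \<le> g s"
    and g_bdd: "\<And>T. \<exists>K. \<forall>s. 0 < s \<and> s \<le> T \<longrightarrow> g s \<le> K"
    and ineq: "\<And>q. q \<in> \<rat> \<Longrightarrow> 0 \<le> q \<Longrightarrow> f q \<le> (LINT s:{0<..q}|stieltjes a. g s) + m q + h q"
    and u: "0 \<le> u"
  shows "time_change a f u \<le>
    (LINT v:{0<..u}|uniform_clock. g (C v)) + time_change a m u + time_change a h u"
proof -
  \<comment> \<open>the integral on the new scale as a function of its upper limit\<close>
  define J where "J w = (LINT v:{0<..w}|uniform_clock. g (C v))" for w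
  have meas: "(\<lambda>v. indicator {0<..w} v *\<^sub>R g (C v)) \<in> borel_measurable uniform_clock" for w
  proof -
    have "(\<lambda>v. indicator {0<..w} v * (indicator {0<..} (C v) * g (C v))) \<in> borel_measurable uniform_clock"
      using measurable_compose[OF measurable_C g_meas] by simp
    moreover have "indicator {0<..w} v * (indicator {0<..} (C v) * g (C v)) =
        indicator {0<..w} v *\<^sub>R g (C v)" for v
      using C_pos[of v] by (auto simp: indicator_def)
    ultimately show ?thesis by (simp cong: measurable_cong)
  qed
  have int: "set_integrable uniform_clock {0<..w} (\<lambda>v. g (C v))" for w
  proof -
    obtain K where K: "\<And>s. 0 < s \<Longrightarrow> s \<le> C w \<Longrightarrow> g s \<le> K" using g_bdd[of "C w"] by blast
    have bound: "norm (g (C v)) \<le> K" if "0 < v" "v \<le> w" for v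
      using K[OF C_pos[OF that(1)] C_mono[OF that(2)]] g_nonneg[OF C_pos[OF that(1)]] by simp
    have "emeasure uniform_clock {0<..w} < \<infinity>"
      using emeasure_uniform_clock_Ioc[of 0 w] by (cases "0 \<le> w") auto
    then show ?thesis unfolding set_integrable_def
      by (intro integrableI_bounded_set[where A="{0<..w}" and B=K] meas)
         (use bound in \<open>auto simp: indicator_def\<close>)
  qed
  have diff: "J w = J v + (LINT r:{v<..w}|uniform_clock. g (C r))" if "0 \<le> v" "v \<le> w" for v w
  proof -
    have "{0<..w} = {0<..v} \<union> {v<..w}" using that by auto
    moreover have "set_integrable uniform_clock {v<..w} (\<lambda>v. g (C v))"
      by (rule set_integrable_subset[OF int[of w]]) (use that in auto)
    ultimately show ?thesis unfolding J_def by (simp add: set_integral_Un[OF _ int])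
  qed
  have J_mono: "J v \<le> J w" if "0 \<le> v" "v \<le> w" for v w
  proof -
    have "0 \<le> (LINT r:{v<..w}|uniform_clock. g (C r))"
      unfolding set_lebesgue_integral_def
      by (rule Bochner_Integration.integral_nonneg) (use g_nonneg C_pos that in \<open>auto simp: indicator_def\<close>)
    then show ?thesis using diff[OF that] by simp
  qed
  have J_right: "(J \<longlongrightarrow> J w) (at_right w)" if w: "0 \<le> w" for w
  proof -
    obtain K where K: "\<And>s. 0 < s \<Longrightarrow> s \<le> C (w+1) \<Longrightarrow> g s \<le> K" using g_bdd[of "C (w+1)"] by blast
    have K0: "0 \<le> K" using K[of "C (w+1)"] g_nonneg[of "C (w+1)"] C_pos[of "w+1"] w by force
    have bound: "J v \<le> J w + K * (v - w)" if v: "w < v" "v < w + 1" for v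
    proof -
      have fin: "emeasure uniform_clock {w<..v} = ennreal (v - w)"
        using emeasure_uniform_clock_Ioc[of w v] w v by simp
      have "(LINT r:{w<..v}|uniform_clock. g (C r)) \<le> (LINT r:{w<..v}|uniform_clock. K)"
      proof (rule set_integral_mono)
        show "set_integrable uniform_clock {w<..v} (\<lambda>r. g (C r))"
          by (rule set_integrable_subset[OF int[of v]]) (use w in auto)
        show "set_integrable uniform_clock {w<..v} (\<lambda>r. K)"
          unfolding set_integrable_def using fin by (intro integrable_scaleR_left) auto
        show "g (C r) \<le> K" if "r \<in> {w<..v}" for r
          using K[OF C_pos C_mono[of r "w+1"]] that v w by auto
      qed
      also have "\<dots> = K * (v - w)"
        using fin v by (subst set_integral_const) (auto simp: measure_def)
      finally show ?thesis using diff[of w v] v w by simp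
    qed
    show ?thesis
    proof (rule tendsto_sandwich)
      show "eventually (\<lambda>v. J w \<le> J v) (at_right w)"
        unfolding eventually_at_right[of w "w+1", simplified]
        by (intro exI[of _ "w+1"]) (use J_mono w in auto)
      show "eventually (\<lambda>v. J v \<le> J w + K * (v - w)) (at_right w)"
        unfolding eventually_at_right[of w "w+1", simplified]
        by (intro exI[of _ "w+1"]) (use bound in auto)
      show "((\<lambda>v. J w + K * (v - w)) \<longlongrightarrow> J w) (at_right w)"
        by (auto intro!: tendsto_eq_intros)
    qed auto
  qed
  have ineq': "f q \<le> J (a q) + m q + h q" if "q \<in> \<rat>" "0 \<le> q" for q
    using ineq[OF that] integral_time_change[OF g_meas that(2)] by (simp add: J_def)
  have J_zero: "0 \<le> J w" for w
    unfolding J_def set_lebesgue_integral_def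
    by (rule Bochner_Integration.integral_nonneg) (use g_nonneg C_pos in \<open>auto simp: indicator_def\<close>)
  let ?t = "C u"
  have "time_change a f u \<le> J u + time_change a m u + time_change a h u"
  proof (cases "a ?t = u")
    case True
    define F where "F = at ?t within ({?t<..} \<inter> \<rat>)"
    have nontriv: "F \<noteq> bot"
    proof -
      have "?t islimpt ({?t<..} \<inter> \<rat>)"
        unfolding islimpt_approachable
      proof (intro allI impI)
        fix e :: real assume "e > 0"
        then obtain q where q: "q \<in> \<rat>" "?t < q" "q < ?t + e"
          using Rats_dense_in_real[of ?t "?t + e"] by auto
        then show "\<exists>x'\<in>{?t<..} \<inter> \<rat>. x' \<noteq> ?t \<and> dist x' ?t < e"
          by (intro bexI[of _ q]) (auto simp: dist_real_def)
      qed
      then show ?thesis unfolding F_def using trivial_limit_within by blast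
    qed
    have sub: "(k \<longlongrightarrow> l) (at_right ?t) \<Longrightarrow> (k \<longlongrightarrow> l) F" for k :: "real \<Rightarrow> real" and l
      unfolding F_def by (erule tendsto_within_subset) auto
    have rc: "(k \<longlongrightarrow> k ?t) F" if "right_cont_path k" for k
      using that C_nonneg[of u] by (intro sub) (auto simp: right_cont_path_def continuous_within)
    have "filterlim a (at_right (a ?t)) (at_right ?t)"
      unfolding filterlim_at using right_cont C_nonneg[of u] less_iff[OF C_nonneg[of u]]
      by (auto simp: right_cont_path_def continuous_within eventually_at_right_less
          eventually_at_right[of ?t "?t + 1", simplified]
          intro!: exI[of _ "?t + 1"] order.strict_implies_not_eq[symmetric])
    then have "((\<lambda>q. J (a q)) \<longlongrightarrow> J (a ?t)) F"
      using J_right[OF clock_nonneg[OF C_nonneg]] by (intro sub) (rule filterlim_compose)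
    then have lim: "((\<lambda>q. J (a q) + m q + h q) \<longlongrightarrow> J (a ?t) + m ?t + h ?t) F"
      using m h by (intro tendsto_add) (auto simp: cadlag_path_def intro: rc)
    have "f ?t \<le> J (a ?t) + m ?t + h ?t"
    proof (rule tendsto_le[OF nontriv lim rc[OF f(1)]])
      show "eventually (\<lambda>q. f q \<le> J (a q) + m q + h q) F"
        unfolding F_def eventually_at_filter
        by (rule always_eventually) (use ineq' C_nonneg[of u] in auto)
    qed
    then show ?thesis using True by (simp add: time_change_def)
  next
    case False
    have t: "0 < ?t" and lt: "u < a ?t"
      using pos_of_gap[OF u False] le_clock_C[of u] False by auto
    let ?F = "at ?t within {..<?t} \<inter> \<rat>"
    define b where "b s = J u + m s + h s" for s
    have lim: "(b \<longlongrightarrow> J u + pre_value m ?t + pre_value h ?t) (at_left ?t)"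
      unfolding b_def using m h t
      by (intro tendsto_intros left_limits_tendsto(2)) (auto simp: cadlag_path_def)
    have "eventually (\<lambda>q. ereal (f q) \<le> ereal (b q)) ?F"
    proof (rule eventually_rational_left[OF t])
      fix q assume q: "0 < q" "q < ?t" "q \<in> \<rat>"
      have "a q < u" using less_C_iff[of q u] q by simp
      then have "J (a q) \<le> J u" using J_mono clock_nonneg[of q] q by simp
      then show "ereal (f q) \<le> ereal (b q)" using ineq'[of q] q by (simp add: b_def)
    qed
    then have "left_limsup f ?t \<le> left_limsup b ?t"
      unfolding left_limsup_def by (rule Limsup_mono)
    also have "\<dots> = ereal (J u + pre_value m ?t + pre_value h ?t)"
      using lim by (rule tendsto_left_imp_left_limsup)
    finally have le: "left_limsup f ?t \<le> ereal (J u + pre_value m ?t + pre_value h ?t)" .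
    have ge: "ereal c \<le> left_limsup f ?t"
      by (rule left_limsup_ge[OF t]) (use f(2) in auto)
    have "pre_value f ?t \<le> J u + pre_value m ?t + pre_value h ?t"
      using le ge unfolding pre_value_def by (cases "left_limsup f ?t") auto
    then show ?thesis using False by (simp add: time_change_def)
  qed
  then show ?thesis by (simp add: J_def)
qed

end

section \<open>Uniformly dominated tails\<close>

lemma integrable_imp_set_integrable:
  fixes f :: "'a \<Rightarrow> real"
  shows "integrable M f \<Longrightarrow> E \<in> sets M \<Longrightarrow> set_integrable M E f"
  unfolding set_integrable_def by (rule integrable_mult_indicator)

text \<open>Uniform integrability in a quantitative form that survives almost sure limits by Fatou's lemma. By
  conditional Jensen every conditional expectation of \<open>\<xi>\<close> has this property, because \<open>x \<mapsto> (\<bar>x\<bar> - R)\<^sup>+\<close> is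
  convex.\<close>
definition tails_dominated :: "'a measure \<Rightarrow> ('a \<Rightarrow> real) \<Rightarrow> ('a \<Rightarrow> real) \<Rightarrow> bool" where
  "tails_dominated P \<xi> Y \<longleftrightarrow> integrable P Y \<and>
     (\<forall>R\<ge>0. (\<integral>\<omega>. max 0 (\<bar>Y \<omega>\<bar> - R) \<partial>P) \<le> (\<integral>\<omega>. max 0 (\<bar>\<xi> \<omega>\<bar> - R) \<partial>P))"

lemma (in prob_space) integrable_tail:
  fixes Y :: "'a \<Rightarrow> real"
  assumes "integrable M Y"
  shows "integrable M (\<lambda>\<omega>. max 0 (\<bar>Y \<omega>\<bar> - R))"
  using assms by (intro integrable_max) auto

lemma (in prob_space) tails_dominated_limit:
  fixes Y :: "'a \<Rightarrow> real"
  assumes \<xi>: "integrable M \<xi>" and dom: "\<And>k::nat. tails_dominated M \<xi> (Yk k)"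
    and Y: "Y \<in> borel_measurable M" and lim: "AE \<omega> in M. (\<lambda>k. Yk k \<omega>) \<longlonglongrightarrow> Y \<omega>"
  shows "tails_dominated M \<xi> Y"
proof -
  have [measurable]: "Yk k \<in> borel_measurable M" for k
    using dom[of k] by (auto simp: tails_dominated_def)
  note Y [measurable]
  have fatou: "(\<integral>\<^sup>+\<omega>. ennreal (max 0 (\<bar>Y \<omega>\<bar> - R)) \<partial>M) \<le> ennreal (\<integral>\<omega>. max 0 (\<bar>\<xi> \<omega>\<bar> - R) \<partial>M)"
    if R: "0 \<le> R" for R
  proof -
    have "(\<integral>\<^sup>+\<omega>. ennreal (max 0 (\<bar>Y \<omega>\<bar> - R)) \<partial>M)
        = (\<integral>\<^sup>+\<omega>. liminf (\<lambda>k. ennreal (max 0 (\<bar>Yk k \<omega>\<bar> - R))) \<partial>M)"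
    proof (rule nn_integral_cong_AE, use lim in eventually_elim)
      fix \<omega> assume "(\<lambda>k. Yk k \<omega>) \<longlonglongrightarrow> Y \<omega>"
      then have "(\<lambda>k. ennreal (max 0 (\<bar>Yk k \<omega>\<bar> - R))) \<longlonglongrightarrow> ennreal (max 0 (\<bar>Y \<omega>\<bar> - R))"
        by (intro tendsto_intros) auto
      then show "ennreal (max 0 (\<bar>Y \<omega>\<bar> - R)) = liminf (\<lambda>k. ennreal (max 0 (\<bar>Yk k \<omega>\<bar> - R)))"
        by (intro lim_imp_Liminf[symmetric]) auto
    qed
    also have "\<dots> \<le> liminf (\<lambda>k. \<integral>\<^sup>+\<omega>. ennreal (max 0 (\<bar>Yk k \<omega>\<bar> - R)) \<partial>M)"
      by (rule nn_integral_liminf) auto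
    also have "\<dots> \<le> liminf (\<lambda>k::nat. ennreal (\<integral>\<omega>. max 0 (\<bar>\<xi> \<omega>\<bar> - R) \<partial>M))"
    proof (intro Liminf_mono always_eventually allI)
      fix k
      have "(\<integral>\<^sup>+\<omega>. ennreal (max 0 (\<bar>Yk k \<omega>\<bar> - R)) \<partial>M) = ennreal (\<integral>\<omega>. max 0 (\<bar>Yk k \<omega>\<bar> - R) \<partial>M)"
        using dom[of k] by (intro nn_integral_eq_integral integrable_tail) (auto simp: tails_dominated_def)
      also have "\<dots> \<le> ennreal (\<integral>\<omega>. max 0 (\<bar>\<xi> \<omega>\<bar> - R) \<partial>M)"
        using dom[of k] R by (intro ennreal_leI) (auto simp: tails_dominated_def)
      finally show "(\<integral>\<^sup>+\<omega>. ennreal (max 0 (\<bar>Yk k \<omega>\<bar> - R)) \<partial>M) \<le> ennreal (\<integral>\<omega>. max 0 (\<bar>\<xi> \<omega>\<bar> - R) \<partial>M)" .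
    qed
    also have "\<dots> = ennreal (\<integral>\<omega>. max 0 (\<bar>\<xi> \<omega>\<bar> - R) \<partial>M)" by (rule Liminf_const) simp
    finally show ?thesis .
  qed
  have int: "integrable M Y"
  proof (rule integrableI_bounded[OF Y])
    have "(\<integral>\<^sup>+\<omega>. ennreal (norm (Y \<omega>)) \<partial>M) \<le> ennreal (\<integral>\<omega>. max 0 (\<bar>\<xi> \<omega>\<bar> - 0) \<partial>M)"
      using fatou[of 0] by (simp add: max_def)
    then show "(\<integral>\<^sup>+\<omega>. ennreal (norm (Y \<omega>)) \<partial>M) < \<infinity>" by (rule le_less_trans) simp
  qed
  have "(\<integral>\<omega>. max 0 (\<bar>Y \<omega>\<bar> - R) \<partial>M) \<le> (\<integral>\<omega>. max 0 (\<bar>\<xi> \<omega>\<bar> - R) \<partial>M)" if "0 \<le> R" for R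
    using fatou[OF that] nn_integral_eq_integral[OF integrable_tail[OF int, of R]]
    by (simp add: integral_nonneg)
  then show ?thesis using int by (simp add: tails_dominated_def)
qed

lemma (in prob_space) tails_vanish:
  fixes \<xi> :: "'a \<Rightarrow> real"
  assumes \<xi>: "integrable M \<xi>" and e: "0 < e"
  shows "\<exists>R\<ge>0. (\<integral>\<omega>. max 0 (\<bar>\<xi> \<omega>\<bar> - R) \<partial>M) < e"
proof -
  have [measurable]: "\<xi> \<in> borel_measurable M" using \<xi> by auto
  have "(\<lambda>k. \<integral>\<omega>. max 0 (\<bar>\<xi> \<omega>\<bar> - real k) \<partial>M) \<longlonglongrightarrow> (\<integral>\<omega>. 0 \<partial>M)"
  proof (rule integral_dominated_convergence[where w = "\<lambda>\<omega>. \<bar>\<xi> \<omega>\<bar>"])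
    show "AE \<omega> in M. (\<lambda>k. max 0 (\<bar>\<xi> \<omega>\<bar> - real k)) \<longlonglongrightarrow> 0"
    proof (rule AE_I2, rule tendsto_eventually)
      fix \<omega>
      show "eventually (\<lambda>k. max 0 (\<bar>\<xi> \<omega>\<bar> - real k) = 0) sequentially"
        using filterlim_real_sequentially unfolding filterlim_at_top
        by (auto elim!: allE[of _ "\<bar>\<xi> \<omega>\<bar>"] eventually_mono)
    qed
  qed (use \<xi> in auto)
  then have "eventually (\<lambda>k. (\<integral>\<omega>. max 0 (\<bar>\<xi> \<omega>\<bar> - real k) \<partial>M) < e) sequentially"
    using e by (intro order_tendstoD(2)) auto
  then obtain k where "(\<integral>\<omega>. max 0 (\<bar>\<xi> \<omega>\<bar> - real k) \<partial>M) < e"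
    using eventually_happens'[OF sequentially_bot] by blast
  then show ?thesis by (intro exI[of _ "real k"]) simp
qed

text \<open>Truncating at level \<open>R\<close> costs at most the tail of \<open>\<xi>\<close> at \<open>R\<close>, uniformly in \<open>k\<close>, and the truncated variables
  converge by dominated convergence.\<close>
lemma (in prob_space) tails_dominated_set_integral_limit:
  fixes Y :: "'a \<Rightarrow> real"
  assumes \<xi>: "integrable M \<xi>" and dom: "\<And>k::nat. tails_dominated M \<xi> (Yk k)"
    and Y: "Y \<in> borel_measurable M" and lim: "AE \<omega> in M. (\<lambda>k. Yk k \<omega>) \<longlonglongrightarrow> Y \<omega>"
    and E [measurable]: "E \<in> sets M"
  shows "(\<lambda>k. LINT \<omega>:E|M. Yk k \<omega>) \<longlonglongrightarrow> (LINT \<omega>:E|M. Y \<omega>)"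
proof (rule LIMSEQ_I)
  fix e :: real assume e: "0 < e"
  obtain R where R: "0 \<le> R" "(\<integral>\<omega>. max 0 (\<bar>\<xi> \<omega>\<bar> - R) \<partial>M) < e/4"
    using tails_vanish[OF \<xi>, of "e/4"] e by auto
  \<comment> \<open>\<open>\<bar>x - clip x\<bar>\<close> is the tail \<open>(\<bar>x\<bar> - R)\<^sup>+\<close> controlled by \<open>\<xi>\<close>\<close>
  define clip where "clip x = max (- R) (min R x)" for x :: real
  have [measurable]: "clip \<in> borel_measurable borel" unfolding clip_def by measurable
  have clip_bound: "\<bar>clip x\<bar> \<le> R" for x using R(1) by (auto simp: clip_def)
  have clip_close: "\<bar>x - clip x\<bar> = max 0 (\<bar>x\<bar> - R)" for x using R(1) by (auto simp: clip_def)
  have domY: "tails_dominated M \<xi> Y" by (rule tails_dominated_limit[OF \<xi> dom Y lim])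
  have near: "\<bar>(LINT \<omega>:E|M. Z \<omega>) - (LINT \<omega>:E|M. clip (Z \<omega>))\<bar> \<le> e/4"
    if Z: "tails_dominated M \<xi> Z" for Z
  proof -
    have iZ: "integrable M Z" using Z by (simp add: tails_dominated_def)
    have [measurable]: "Z \<in> borel_measurable M" using iZ by auto
    have iclip: "integrable M (\<lambda>\<omega>. clip (Z \<omega>))"
      by (rule integrable_const_bound[of _ R]) (use clip_bound in auto)
    have sZ: "set_integrable M E Z" "set_integrable M E (\<lambda>\<omega>. clip (Z \<omega>))"
      using iZ iclip by (auto intro: integrable_imp_set_integrable)
    have "\<bar>(LINT \<omega>:E|M. Z \<omega>) - (LINT \<omega>:E|M. clip (Z \<omega>))\<bar> = \<bar>LINT \<omega>:E|M. Z \<omega> - clip (Z \<omega>)\<bar>"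
      using sZ by (simp add: set_integral_diff)
    also have "\<dots> \<le> (\<integral>\<omega>. max 0 (\<bar>Z \<omega>\<bar> - R) \<partial>M)"
      unfolding set_lebesgue_integral_def
    proof (rule order_trans[OF integral_abs_bound], rule integral_mono')
      show "integrable M (\<lambda>\<omega>. max 0 (\<bar>Z \<omega>\<bar> - R))" by (rule integrable_tail[OF iZ])
    qed (use clip_close in \<open>auto simp: indicator_def\<close>)
    also have "\<dots> \<le> e/4" using Z R by (auto simp: tails_dominated_def intro: order_trans less_imp_le)
    finally show ?thesis .
  qed
  have [measurable]: "Yk k \<in> borel_measurable M" for k
    using dom[of k] by (auto simp: tails_dominated_def)
  note Y [measurable]
  have "(\<lambda>k. LINT \<omega>:E|M. clip (Yk k \<omega>)) \<longlonglongrightarrow> (LINT \<omega>:E|M. clip (Y \<omega>))"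
    unfolding set_lebesgue_integral_def
  proof (rule integral_dominated_convergence[where w = "\<lambda>_. R"])
    show "AE \<omega> in M. (\<lambda>k. indicator E \<omega> *\<^sub>R clip (Yk k \<omega>)) \<longlonglongrightarrow> indicator E \<omega> *\<^sub>R clip (Y \<omega>)"
      using lim by eventually_elim (auto simp: clip_def intro!: tendsto_intros)
    show "AE \<omega> in M. norm (indicator E \<omega> *\<^sub>R clip (Yk k \<omega>)) \<le> R" for k
      using clip_bound R(1) by (auto simp: indicator_def)
  qed auto
  from LIMSEQ_D[OF this, of "e/4"] e obtain k0
    where k0: "\<And>k. k0 \<le> k \<Longrightarrow> \<bar>(LINT \<omega>:E|M. clip (Yk k \<omega>)) - (LINT \<omega>:E|M. clip (Y \<omega>))\<bar> < e/4"
    by (auto simp: real_norm_def)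
  have "norm ((LINT \<omega>:E|M. Yk k \<omega>) - (LINT \<omega>:E|M. Y \<omega>)) < e" if "k0 \<le> k" for k
    using near[OF dom[of k]] near[OF domY] k0[OF that] unfolding real_norm_def by linarith
  then show "\<exists>k0. \<forall>k\<ge>k0. norm ((LINT \<omega>:E|M. Yk k \<omega>) - (LINT \<omega>:E|M. Y \<omega>)) < e" by blast
qed

text \<open>The tail \<open>(\<bar>Y\<bar> - R)\<^sup>+\<close> is linear in \<open>Y\<close> on each of the two events, so there \<open>Y\<close> may be replaced by \<open>\<xi>\<close>.\<close>
lemma (in prob_space) tails_dominatedI:
  fixes Y :: "'a \<Rightarrow> real"
  assumes \<xi>: "integrable M \<xi>" and Y: "integrable M Y"
    and upper: "\<And>R. 0 \<le> R \<Longrightarrow>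
      (LINT \<omega>:{\<omega>\<in>space M. R < Y \<omega>}|M. Y \<omega>) = (LINT \<omega>:{\<omega>\<in>space M. R < Y \<omega>}|M. \<xi> \<omega>)"
    and lower: "\<And>R. 0 \<le> R \<Longrightarrow>
      (LINT \<omega>:{\<omega>\<in>space M. Y \<omega> < - R}|M. Y \<omega>) = (LINT \<omega>:{\<omega>\<in>space M. Y \<omega> < - R}|M. \<xi> \<omega>)"
  shows "tails_dominated M \<xi> Y"
  unfolding tails_dominated_def
proof (intro conjI allI impI Y)
  fix R :: real assume R: "0 \<le> R"
  have [measurable]: "Y \<in> borel_measurable M" "\<xi> \<in> borel_measurable M" using Y \<xi> by auto
  define U L where "U = {\<omega>\<in>space M. R < Y \<omega>}" and "L = {\<omega>\<in>space M. Y \<omega> < - R}"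
  have [measurable]: "U \<in> sets M" "L \<in> sets M" unfolding U_def L_def by measurable
  \<comment> \<open>\<open>lin Y\<close> is the tail of \<open>Y\<close>, while \<open>lin \<xi>\<close> is only bounded by the tail of \<open>\<xi>\<close>\<close>
  define lin where "lin Z \<omega> = indicator U \<omega> *\<^sub>R Z \<omega> - indicator L \<omega> *\<^sub>R Z \<omega>
      - (R * indicator U \<omega> + R * indicator L \<omega> :: real)" for Z :: "'a \<Rightarrow> real" and \<omega>
  have int: "integrable M (\<lambda>\<omega>. indicator U \<omega> *\<^sub>R Z \<omega>)" "integrable M (\<lambda>\<omega>. indicator L \<omega> *\<^sub>R Z \<omega>)"
    if "integrable M Z" for Z :: "'a \<Rightarrow> real"
    using that by (intro integrable_mult_indicator; simp)+
  have int': "integrable M (\<lambda>\<omega>. R * indicator U \<omega> + R * indicator L \<omega>)"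
    by (auto intro!: Bochner_Integration.integrable_add
        integrable_mult_right integrable_real_indicator simp: emeasure_eq_measure)
  have lin: "(\<integral>\<omega>. lin Z \<omega> \<partial>M) = (LINT \<omega>:U|M. Z \<omega>) - (LINT \<omega>:L|M. Z \<omega>)
      - (\<integral>\<omega>. R * indicator U \<omega> + R * indicator L \<omega> \<partial>M)" if "integrable M Z" for Z
    unfolding lin_def set_lebesgue_integral_def using int[OF that] int'
    by (simp add: Bochner_Integration.integral_diff Bochner_Integration.integrable_diff)
  have "(\<integral>\<omega>. max 0 (\<bar>Y \<omega>\<bar> - R) \<partial>M) = (\<integral>\<omega>. lin Y \<omega> \<partial>M)"
    by (rule Bochner_Integration.integral_cong)
       (use R in \<open>auto simp: lin_def U_def L_def indicator_def\<close>)
  also have "\<dots> = (\<integral>\<omega>. lin \<xi> \<omega> \<partial>M)"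
    using lin[OF Y] lin[OF \<xi>] upper[OF R] lower[OF R] by (simp add: U_def L_def)
  also have "\<dots> \<le> (\<integral>\<omega>. max 0 (\<bar>\<xi> \<omega>\<bar> - R) \<partial>M)"
  proof (rule integral_mono')
    show "lin \<xi> \<omega> \<le> max 0 (\<bar>\<xi> \<omega>\<bar> - R)" if "\<omega> \<in> space M" for \<omega>
      using R that by (auto simp: lin_def U_def L_def indicator_def)
  qed (auto intro: integrable_tail \<xi>)
  finally show "(\<integral>\<omega>. max 0 (\<bar>Y \<omega>\<bar> - R) \<partial>M) \<le> (\<integral>\<omega>. max 0 (\<bar>\<xi> \<omega>\<bar> - R) \<partial>M)" .
qed

section \<open>Stopping at finitely many values\<close>

locale filtered =
  fixes P :: "'a measure" and F :: "real \<Rightarrow> 'a measure"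
  assumes filtered_prob_space: "filtered_prob_space P F"
begin

sublocale prob_space P using filtered_prob_space by (simp add: filtered_prob_space_def)

lemma space_F [simp]: "space (F t) = space P"
  using filtered_prob_space by (auto simp: filtered_prob_space_def filtration_def)

lemma F_mono: "s \<le> t \<Longrightarrow> B \<in> sets (F s) \<Longrightarrow> B \<in> sets (F t)"
  using filtered_prob_space by (auto simp: filtered_prob_space_def filtration_def)

lemma sets_F_subset: "B \<in> sets (F t) \<Longrightarrow> B \<in> sets P"
proof -
  assume "B \<in> sets (F t)"
  then have "B \<in> sets (F (max 0 t))" by (rule F_mono[rotated]) simp
  moreover have "subalgebra P (F (max 0 t))" using filtered_prob_space by (simp add: filtered_prob_space_def)
  ultimately show "B \<in> sets P" by (auto simp: subalgebra_def)
qed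

lemma subalgebra_F: "subalgebra P (F t)"
  using sets_F_subset by (auto simp: subalgebra_def)

lemma measurable_F_P: "f \<in> measurable (F t) N \<Longrightarrow> f \<in> measurable P N"
  using measurable_from_subalg[OF subalgebra_F] by blast

lemma measurable_F_mono: "s \<le> t \<Longrightarrow> f \<in> measurable (F s) N \<Longrightarrow> f \<in> measurable (F t) N"
  by (auto simp: measurable_def intro: F_mono[of s t])

text \<open>Beyond the horizon \<open>n\<close> a martingale closed at time \<open>n\<close> is constant, so nothing is required of the values
  of \<open>Q\<close> there. This allows \<open>n\<close> to play the role of the value \<open>\<infinity>\<close>.\<close>
definition simple_stop :: "real \<Rightarrow> ('a \<Rightarrow> real) \<Rightarrow> bool" where
  "simple_stop n Q \<longleftrightarrow> Q \<in> borel_measurable P \<and> finite (Q ` space P) \<and> (\<forall>\<omega>\<in>space P. 0 \<le> Q \<omega>) \<and>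
     (\<forall>s. 0 \<le> s \<and> s < n \<longrightarrow> {\<omega>\<in>space P. Q \<omega> \<le> s} \<in> sets (F s))"

lemma simple_stop_min:
  assumes "simple_stop n Q" "simple_stop n Q'"
  shows "simple_stop n (\<lambda>\<omega>. min (Q \<omega>) (Q' \<omega>))"
proof -
  have "(\<lambda>\<omega>. min (Q \<omega>) (Q' \<omega>)) ` space P \<subseteq> Q ` space P \<union> Q' ` space P" by (auto simp: min_def)
  then have "finite ((\<lambda>\<omega>. min (Q \<omega>) (Q' \<omega>)) ` space P)"
    using assms by (auto simp: simple_stop_def intro: finite_subset)
  moreover have "{\<omega>\<in>space P. min (Q \<omega>) (Q' \<omega>) \<le> s} = {\<omega>\<in>space P. Q \<omega> \<le> s} \<union> {\<omega>\<in>space P. Q' \<omega> \<le> s}" for s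
    by (auto simp: min_le_iff_disj)
  moreover have "(\<lambda>\<omega>. min (Q \<omega>) (Q' \<omega>)) \<in> borel_measurable P"
    using assms by (intro borel_measurable_min) (auto simp: simple_stop_def)
  moreover have "{\<omega>\<in>space P. Q \<omega> \<le> s} \<union> {\<omega>\<in>space P. Q' \<omega> \<le> s} \<in> sets (F s)" if "0 \<le> s" "s < n" for s
    using assms that by (intro sets.Un) (auto simp: simple_stop_def)
  ultimately show ?thesis using assms by (simp add: simple_stop_def)
qed

lemma simple_stop_eq:
  assumes fin: "finite (Q ` space P)" and E: "\<And>s. 0 \<le> s \<Longrightarrow> s < n \<Longrightarrow> E \<inter> {\<omega>\<in>space P. Q \<omega> \<le> s} \<in> sets (F s)"
    and nonneg: "\<forall>\<omega>\<in>space P. 0 \<le> Q \<omega>" and q: "0 \<le> q" "q < n"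
  shows "E \<inter> {\<omega>\<in>space P. Q \<omega> = q} \<in> sets (F q)"
proof -
  have "E \<inter> {\<omega>\<in>space P. Q \<omega> = q} = (E \<inter> {\<omega>\<in>space P. Q \<omega> \<le> q})
      - (\<Union>r\<in>{r\<in>Q ` space P. r < q}. E \<inter> {\<omega>\<in>space P. Q \<omega> \<le> r})"
    by auto
  also have "\<dots> \<in> sets (F q)"
  proof (intro sets.Diff sets.finite_UN)
    show "E \<inter> {\<omega>\<in>space P. Q \<omega> \<le> r} \<in> sets (F q)" if "r \<in> {r\<in>Q ` space P. r < q}" for r
      by (rule F_mono[of r q]) (use that E nonneg q in auto)
  qed (use fin E q in auto)
  finally show ?thesis .
qed

end

text \<open>A cadlag martingale that is constantly equal to \<open>\<xi>\<close> from time \<open>n\<close> on.\<close>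
locale closed_martingale = filtered +
  fixes N :: "real \<Rightarrow> 'a \<Rightarrow> real" and \<xi> :: "'a \<Rightarrow> real" and n :: real
  assumes adapted: "adapted F N"
    and integrable_final: "integrable P \<xi>"
    and integrable_N: "0 \<le> s \<Longrightarrow> integrable P (N s)"
    and closed: "0 \<le> s \<Longrightarrow> B \<in> sets (F s) \<Longrightarrow> (LINT \<omega>:B|P. N s \<omega>) = (LINT \<omega>:B|P. \<xi> \<omega>)"
    and final: "n \<le> s \<Longrightarrow> \<omega> \<in> space P \<Longrightarrow> N s \<omega> = \<xi> \<omega>"
    and cadlag: "\<omega> \<in> space P \<Longrightarrow> cadlag_path (\<lambda>s. N s \<omega>)"
begin

lemma integrable_at_simple:
  assumes "Q \<in> borel_measurable P" "finite (Q ` space P)" "\<forall>\<omega>\<in>space P. 0 \<le> Q \<omega>"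
  shows "integrable P (\<lambda>\<omega>. N (Q \<omega>) \<omega>)"
    "\<And>E. E \<in> sets P \<Longrightarrow> (LINT \<omega>:E|P. N (Q \<omega>) \<omega>) =
       (\<Sum>q\<in>Q ` space P. LINT \<omega>:E \<inter> {\<omega>\<in>space P. Q \<omega> = q}|P. N q \<omega>)"
proof -
  note assms(1)[measurable]
  have split: "k (N (Q \<omega>) \<omega>) = (\<Sum>q\<in>Q ` space P. indicator {\<omega>\<in>space P. Q \<omega> = q} \<omega> *\<^sub>R k (N q \<omega>))"
    if "\<omega> \<in> space P" for \<omega> and k :: "real \<Rightarrow> real"
  proof -
    have "(\<Sum>q\<in>Q ` space P. indicator {\<omega>\<in>space P. Q \<omega> = q} \<omega> *\<^sub>R k (N q \<omega>)) =
      (\<Sum>q\<in>Q ` space P. if Q \<omega> = q then k (N q \<omega>) else 0)"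
      by (rule sum.cong) (use that in auto)
    then show ?thesis using that assms(2) by (simp add: sum.delta)
  qed
  have "integrable P (\<lambda>\<omega>. \<Sum>q\<in>Q ` space P. indicator {\<omega>\<in>space P. Q \<omega> = q} \<omega> *\<^sub>R N q \<omega>)"
    by (intro Bochner_Integration.integrable_sum integrable_mult_indicator)
       (use assms(3) in \<open>auto intro!: integrable_N\<close>)
  then show "integrable P (\<lambda>\<omega>. N (Q \<omega>) \<omega>)"
    by (rule Bochner_Integration.integrable_cong[THEN iffD1, rotated -1]) (use split[of _ "\<lambda>x. x"] in auto)
  fix E assume E [measurable]: "E \<in> sets P"
  have "(LINT \<omega>:E|P. N (Q \<omega>) \<omega>) =
      (\<integral>\<omega>. (\<Sum>q\<in>Q ` space P. indicator (E \<inter> {\<omega>\<in>space P. Q \<omega> = q}) \<omega> *\<^sub>R N q \<omega>) \<partial>P)"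
    unfolding set_lebesgue_integral_def
  proof (rule Bochner_Integration.integral_cong[OF refl])
    fix \<omega> assume "\<omega> \<in> space P"
    from split[OF this, of "\<lambda>x. indicator E \<omega> *\<^sub>R x"]
    show "indicator E \<omega> *\<^sub>R N (Q \<omega>) \<omega> =
      (\<Sum>q\<in>Q ` space P. indicator (E \<inter> {\<omega>\<in>space P. Q \<omega> = q}) \<omega> *\<^sub>R N q \<omega>)"
      by (simp add: indicator_inter_arith ac_simps)
  qed
  also have "\<dots> = (\<Sum>q\<in>Q ` space P. LINT \<omega>:E \<inter> {\<omega>\<in>space P. Q \<omega> = q}|P. N q \<omega>)"
    unfolding set_lebesgue_integral_def
    by (intro Bochner_Integration.integral_sum integrable_mult_indicator)
       (use assms(3) in \<open>auto intro!: integrable_N\<close>)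
  finally show "(LINT \<omega>:E|P. N (Q \<omega>) \<omega>) =
       (\<Sum>q\<in>Q ` space P. LINT \<omega>:E \<inter> {\<omega>\<in>space P. Q \<omega> = q}|P. N q \<omega>)" .
qed

text \<open>Optional stopping, by summing over the finitely many values of \<open>Q\<close>.\<close>
lemma set_integral_at_simple:
  assumes Q: "Q \<in> borel_measurable P" "finite (Q ` space P)" "\<forall>\<omega>\<in>space P. 0 \<le> Q \<omega>"
    and E: "E \<in> sets P"
    and EQ: "\<And>q. 0 \<le> q \<Longrightarrow> q < n \<Longrightarrow> E \<inter> {\<omega>\<in>space P. Q \<omega> = q} \<in> sets (F q)"
  shows "(LINT \<omega>:E|P. N (Q \<omega>) \<omega>) = (LINT \<omega>:E|P. \<xi> \<omega>)"
proof -
  note Q(1)[measurable] E[measurable]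
  have "(LINT \<omega>:E|P. N (Q \<omega>) \<omega>) =
       (\<Sum>q\<in>Q ` space P. LINT \<omega>:E \<inter> {\<omega>\<in>space P. Q \<omega> = q}|P. N q \<omega>)"
    by (rule integrable_at_simple(2)[OF Q E])
  also have "\<dots> = (\<Sum>q\<in>Q ` space P. LINT \<omega>:E \<inter> {\<omega>\<in>space P. Q \<omega> = q}|P. \<xi> \<omega>)"
  proof (rule sum.cong[OF refl])
    fix q assume "q \<in> Q ` space P"
    then have q: "0 \<le> q" using Q(3) by auto
    show "(LINT \<omega>:E \<inter> {\<omega>\<in>space P. Q \<omega> = q}|P. N q \<omega>) = (LINT \<omega>:E \<inter> {\<omega>\<in>space P. Q \<omega> = q}|P. \<xi> \<omega>)"
    proof (cases "q < n")
      case True then show ?thesis by (intro closed EQ q)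
    next
      case False
      then show ?thesis using final[of q] unfolding set_lebesgue_integral_def
        by (intro Bochner_Integration.integral_cong) auto
    qed
  qed
  also have "\<dots> = (LINT \<omega>:(\<Union>q\<in>Q ` space P. E \<inter> {\<omega>\<in>space P. Q \<omega> = q})|P. \<xi> \<omega>)"
    by (rule set_integral_finite_Union[symmetric])
       (use Q(2) in \<open>auto simp: disjoint_family_on_def intro!: integrable_imp_set_integrable integrable_final\<close>)
  also have "(\<Union>q\<in>Q ` space P. E \<inter> {\<omega>\<in>space P. Q \<omega> = q}) = E"
    using sets.sets_into_space[OF E] by auto
  finally show ?thesis .
qed

lemma tails_dominated_at_simple:
  assumes "simple_stop n Q"
  shows "tails_dominated P \<xi> (\<lambda>\<omega>. N (Q \<omega>) \<omega>)"
proof -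
  have Q: "Q \<in> borel_measurable P" "finite (Q ` space P)" "\<forall>\<omega>\<in>space P. 0 \<le> Q \<omega>"
    using assms by (auto simp: simple_stop_def)
  have *: "(LINT \<omega>:{\<omega>\<in>space P. N (Q \<omega>) \<omega> \<in> D}|P. N (Q \<omega>) \<omega>) = (LINT \<omega>:{\<omega>\<in>space P. N (Q \<omega>) \<omega> \<in> D}|P. \<xi> \<omega>)"
    if D: "D \<in> sets borel" for D
  proof (rule set_integral_at_simple[OF Q])
    have "(\<lambda>\<omega>. N (Q \<omega>) \<omega>) \<in> borel_measurable P" using integrable_at_simple(1)[OF Q] by auto
    then show "{\<omega>\<in>space P. N (Q \<omega>) \<omega> \<in> D} \<in> sets P" using D by measurable
    fix q assume q: "0 \<le> q" "q < n"
    have "space P \<inter> {\<omega>\<in>space P. Q \<omega> = q} \<in> sets (F q)"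
      by (rule simple_stop_eq[OF Q(2) _ Q(3) q])
         (use assms in \<open>auto simp: simple_stop_def Int_def conj_ac cong: conj_cong\<close>)
    moreover have "N q \<in> borel_measurable (F q)" using adapted q by (simp add: adapted_def)
    then have "N q -` D \<inter> space (F q) \<in> sets (F q)" using D by (rule measurable_sets)
    ultimately have "(N q -` D \<inter> space (F q)) \<inter> (space P \<inter> {\<omega>\<in>space P. Q \<omega> = q}) \<in> sets (F q)" by blast
    also have "(N q -` D \<inter> space (F q)) \<inter> (space P \<inter> {\<omega>\<in>space P. Q \<omega> = q})
      = {\<omega>\<in>space P. N (Q \<omega>) \<omega> \<in> D} \<inter> {\<omega>\<in>space P. Q \<omega> = q}" by auto
    finally show "{\<omega>\<in>space P. N (Q \<omega>) \<omega> \<in> D} \<inter> {\<omega>\<in>space P. Q \<omega> = q} \<in> sets (F q)" .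
  qed
  show ?thesis
    using *[of "{_<..}"] *[of "{..<_}"]
    by (intro tails_dominatedI integrable_final integrable_at_simple(1)[OF Q]) auto
qed

end

section \<open>Inner regularity on the predictable sigma-algebra\<close>

context filtered
begin

text \<open>Finite unions of \<open>[a, b] \<times> B\<close> with \<open>B\<close> known at a time \<open>c\<close> strictly before \<open>a\<close>. The gap between \<open>c\<close> and
  \<open>a\<close> is what allows the debut of the set to be announced; closed intervals make the sections compact.\<close>
inductive_set elementary :: "(real \<times> 'a) set set" where
  empty: "{} \<in> elementary"
| cell: "0 \<le> c \<Longrightarrow> c < a \<Longrightarrow> B \<in> sets (F c) \<Longrightarrow> {a..b} \<times> B \<in> elementary"
| union: "K \<in> elementary \<Longrightarrow> L \<in> elementary \<Longrightarrow> K \<union> L \<in> elementary"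

lemma elementary_Int_cell:
  assumes "K \<in> elementary" "0 \<le> c" "c < a" "B \<in> sets (F c)"
  shows "({a..b} \<times> B) \<inter> K \<in> elementary"
  using assms(1)
proof induction
  case empty
  then show ?case by (simp add: elementary.empty)
next
  case (cell c' a' B' b')
  have "({a..b} \<times> B) \<inter> ({a'..b'} \<times> B') = {max a a'..min b b'} \<times> (B \<inter> B')" by auto
  also have "\<dots> \<in> elementary"
    by (rule elementary.cell[of "max c c'"])
       (use cell assms F_mono[of c "max c c'" B] F_mono[of c' "max c c'" B'] in auto)
  finally show ?case .
next
  case (union K L)
  then show ?case by (simp add: Int_Un_distrib elementary.union)
qed

lemma elementary_Int: "K \<in> elementary \<Longrightarrow> L \<in> elementary \<Longrightarrow> K \<inter> L \<in> elementary"
proof (induction rule: elementary.induct)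
  case (cell c a B b)
  then show ?case using elementary_Int_cell by blast
qed (simp_all add: elementary.empty elementary.union Int_Un_distrib2)

lemma elementary_section:
  "K \<in> elementary \<Longrightarrow> compact {t. (t, \<omega>) \<in> K}"
proof (induction rule: elementary.induct)
  case (cell c a B b)
  have "{t. (t, \<omega>) \<in> {a..b} \<times> B} = (if \<omega> \<in> B then {a..b} else {})" by auto
  then show ?case by simp
next
  case (union K L)
  have "{t. (t, \<omega>) \<in> K \<union> L} = {t. (t, \<omega>) \<in> K} \<union> {t. (t, \<omega>) \<in> L}" by auto
  then show ?case using union.IH by (simp add: compact_Un)
qed simp

text \<open>On \<open>[a, b] \<times> B\<close> the announcing time is \<open>max c (a - e)\<close> on \<open>B\<close>, at which \<open>B\<close> is already known; finite
  unions are handled by minima. Where a section is empty the announcing time is at least \<open>n\<close>.\<close>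
lemma elementary_announced:
  assumes "K \<in> elementary" "0 < e" "0 \<le> n"
  shows "\<exists>S. simple_stop n S \<and> (\<forall>\<omega>\<in>space P. \<forall>t. (t, \<omega>) \<in> K \<longrightarrow> S \<omega> < t) \<and>
    (\<forall>\<omega>\<in>space P. S \<omega> < n \<longrightarrow> (\<exists>t. (t, \<omega>) \<in> K \<and> t \<le> S \<omega> + e))"
  using assms(1)
proof induction
  case empty
  have "(\<lambda>_::'a. n) ` space P \<subseteq> {n}" by auto
  then have "simple_stop n (\<lambda>_. n)" using assms(3) by (auto simp: simple_stop_def intro: finite_subset)
  then show ?case by (intro exI[of _ "\<lambda>_. n"]) auto
next
  case (cell c a B b)
  have B: "B \<in> sets P" "B \<subseteq> space P" using cell sets_F_subset sets.sets_into_space by blast+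
  show ?case
  proof (cases "a \<le> b")
    case False
    have "(\<lambda>_::'a. n) ` space P \<subseteq> {n}" by auto
    then have "simple_stop n (\<lambda>_. n)" using assms(3) by (auto simp: simple_stop_def intro: finite_subset)
    then show ?thesis using False by (intro exI[of _ "\<lambda>_. n"]) auto
  next
    case True
    define v where "v = max c (a - e)"
    have v: "0 \<le> v" "v < a" "c \<le> v" "a \<le> v + e" using cell assms(2) by (auto simp: v_def)
    define S where "S \<omega> = (if \<omega> \<in> B then v else n)" for \<omega>
    have "S ` space P \<subseteq> {v, n}" by (auto simp: S_def)
    moreover have "{\<omega>\<in>space P. S \<omega> \<le> s} \<in> sets (F s)" if s: "0 \<le> s" "s < n" for s
    proof -
      have "{\<omega>\<in>space P. S \<omega> \<le> s} = (if v \<le> s then B else {})" using B s by (auto simp: S_def)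
      then show ?thesis using F_mono[of c s B] cell v by auto
    qed
    moreover have "S \<in> borel_measurable P" unfolding S_def using B(1) by measurable
    ultimately have "simple_stop n S"
      using v assms(3) by (auto simp: simple_stop_def S_def intro: finite_subset)
    moreover have "S \<omega> < t" if "(t, \<omega>) \<in> {a..b} \<times> B" for \<omega> t using that v by (auto simp: S_def)
    moreover have "(a, \<omega>) \<in> {a..b} \<times> B \<and> a \<le> S \<omega> + e" if "S \<omega> < n" for \<omega>
      using that v True by (auto simp: S_def split: if_splits)
    ultimately show ?thesis by (intro exI[of _ S]) blast
  qed
next
  case (union K L)
  then obtain S S' where S: "simple_stop n S" "\<forall>\<omega>\<in>space P. \<forall>t. (t, \<omega>) \<in> K \<longrightarrow> S \<omega> < t"
      "\<forall>\<omega>\<in>space P. S \<omega> < n \<longrightarrow> (\<exists>t. (t, \<omega>) \<in> K \<and> t \<le> S \<omega> + e)"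
    and S': "simple_stop n S'" "\<forall>\<omega>\<in>space P. \<forall>t. (t, \<omega>) \<in> L \<longrightarrow> S' \<omega> < t"
      "\<forall>\<omega>\<in>space P. S' \<omega> < n \<longrightarrow> (\<exists>t. (t, \<omega>) \<in> L \<and> t \<le> S' \<omega> + e)"
    by blast
  show ?case
  proof (intro exI[of _ "\<lambda>\<omega>. min (S \<omega>) (S' \<omega>)"] conjI ballI allI impI)
    show "simple_stop n (\<lambda>\<omega>. min (S \<omega>) (S' \<omega>))" by (rule simple_stop_min[OF S(1) S'(1)])
    show "min (S \<omega>) (S' \<omega>) < t" if "\<omega> \<in> space P" "(t, \<omega>) \<in> K \<union> L" for \<omega> t
      using S(2) S'(2) that by (auto simp: min_less_iff_disj)
    show "\<exists>t. (t, \<omega>) \<in> K \<union> L \<and> t \<le> min (S \<omega>) (S' \<omega>) + e"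
      if "\<omega> \<in> space P" "min (S \<omega>) (S' \<omega>) < n" for \<omega>
      using S(3) S'(3) that by (cases "S \<omega> \<le> S' \<omega>") (auto simp: min_def)
  qed
qed

definition elementary_delta :: "(real \<times> 'a) set set" where
  "elementary_delta = {\<Inter>m::nat. K m | K. \<forall>m. K m \<in> elementary}"

lemma elementary_delta_decseq:
  assumes "K \<in> elementary_delta"
  obtains L :: "nat \<Rightarrow> (real \<times> 'a) set"
  where "decseq L" "\<And>m. L m \<in> elementary" "K = (\<Inter>m. L m)"
proof -
  obtain K' where K': "K = (\<Inter>m::nat. K' m)" "\<And>m. K' m \<in> elementary"
    using assms by (auto simp: elementary_delta_def)
  define L where "L m = (\<Inter>i\<le>m. K' i)" for m
  have "L m \<in> elementary" for m
  proof (induction m)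
    case (Suc m)
    have "L (Suc m) = K' (Suc m) \<inter> L m" by (auto simp: L_def le_Suc_eq)
    then show ?case using Suc K'(2) by (simp add: elementary_Int)
  qed (use K' in \<open>simp add: L_def\<close>)
  moreover have "decseq L" unfolding L_def by (intro decseq_SucI) auto
  moreover have "K = (\<Inter>m. L m)" unfolding K'(1) L_def by auto
  ultimately show ?thesis using that by blast
qed

lemma elementary_deltaI: "K \<in> elementary \<Longrightarrow> K \<in> elementary_delta"
  unfolding elementary_delta_def by (auto intro!: exI[of _ "\<lambda>_. K"])

lemma elementary_delta_Un:
  assumes "K \<in> elementary_delta" "L \<in> elementary_delta"
  shows "K \<union> L \<in> elementary_delta"
proof -
  obtain K' where K': "decseq K'" "\<And>m. K' m \<in> elementary" "K = (\<Inter>m. K' m)"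
    using elementary_delta_decseq[OF assms(1)] by blast
  obtain L' where L': "decseq L'" "\<And>m. L' m \<in> elementary" "L = (\<Inter>m. L' m)"
    using elementary_delta_decseq[OF assms(2)] by blast
  have "K \<union> L = (\<Inter>m. K' m \<union> L' m)"
  proof (intro equalityI subsetI)
    fix x assume x: "x \<in> (\<Inter>m. K' m \<union> L' m)"
    show "x \<in> K \<union> L"
    proof (rule ccontr)
      assume "x \<notin> K \<union> L"
      then obtain i j where "x \<notin> K' i" "x \<notin> L' j" using K'(3) L'(3) by auto
      then have "x \<notin> K' (max i j)" "x \<notin> L' (max i j)"
        using decseqD[OF K'(1), of i "max i j"] decseqD[OF L'(1), of j "max i j"] by auto
      then show False using x by auto
    qed
  qed (use K'(3) L'(3) in auto)
  then show ?thesis using K'(2) L'(2)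
    unfolding elementary_delta_def by (auto intro!: exI[of _ "\<lambda>m. K' m \<union> L' m"] elementary.union)
qed

lemma elementary_delta_finite_UN:
  fixes K :: "nat \<Rightarrow> (real \<times> 'a) set"
  assumes "\<And>i. K i \<in> elementary_delta"
  shows "(\<Union>i\<le>m. K i) \<in> elementary_delta"
proof (induction m)
  case (Suc m)
  then show ?case using elementary_delta_Un[OF assms[of "Suc m"]] by (simp add: atMost_Suc)
qed (use assms in simp)

lemma elementary_delta_INT:
  fixes K :: "nat \<Rightarrow> (real \<times> 'a) set"
  assumes "\<And>i. K i \<in> elementary_delta"
  shows "(\<Inter>i. K i) \<in> elementary_delta"
proof -
  have "\<forall>i. \<exists>L. K i = (\<Inter>m::nat. L m) \<and> (\<forall>m. L m \<in> elementary)"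
    using assms by (auto simp: elementary_delta_def)
  then obtain L where L: "\<And>i. K i = (\<Inter>m::nat. L i m)" "\<And>i m. L i m \<in> elementary" by metis
  define L' where "L' k = L (fst (prod_decode k)) (snd (prod_decode k))" for k
  have "(\<Inter>i. K i) = (\<Inter>k. L' k)"
  proof (intro equalityI subsetI)
    fix x assume x: "x \<in> (\<Inter>k. L' k)"
    have "x \<in> L i m" for i m
    proof -
      have "x \<in> L' (prod_encode (i, m))" using x by blast
      then show ?thesis by (simp add: L'_def)
    qed
    then show "x \<in> (\<Inter>i. K i)" using L(1) by auto
  qed (use L(1) in \<open>auto simp: L'_def\<close>)
  then show ?thesis using L(2) unfolding elementary_delta_def by (auto simp: L'_def intro!: exI[of _ L'])
qed

lemma predictable_gen_subset:
  "{{0} \<times> B | B. B \<in> sets (F 0)} \<union> {{s<..t} \<times> B | s t B. 0 \<le> s \<and> s \<le> t \<and> B \<in> sets (F s)}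
    \<subseteq> Pow ({0..} \<times> space (F 0))"
  using sets.sets_into_space by fastforce

lemma space_predictable [simp]: "space (predictable_sigma F) = {0..} \<times> space P"
  unfolding predictable_sigma_def using predictable_gen_subset by (simp add: space_measure_of_conv)

lemma sets_predictable:
  "sets (predictable_sigma F) = sigma_sets ({0..} \<times> space P)
    ({{0} \<times> B | B. B \<in> sets (F 0)} \<union> {{s<..t} \<times> B | s t B. 0 \<le> s \<and> s \<le> t \<and> B \<in> sets (F s)})"
  unfolding predictable_sigma_def using sets_measure_of[OF predictable_gen_subset] by simp

lemma predictable_zero: "B \<in> sets (F 0) \<Longrightarrow> {0} \<times> B \<in> sets (predictable_sigma F)"
  unfolding sets_predictable by (rule sigma_sets.Basic) auto

lemma predictable_Ioc: "0 \<le> s \<Longrightarrow> B \<in> sets (F s) \<Longrightarrow> {s<..t} \<times> B \<in> sets (predictable_sigma F)"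
proof (cases "s \<le> t")
  case True
  then show "0 \<le> s \<Longrightarrow> B \<in> sets (F s) \<Longrightarrow> ?thesis"
    unfolding sets_predictable by (intro sigma_sets.Basic) auto
qed simp

lemma measurable_predictable:
  assumes space: "f \<in> space M \<rightarrow> {0..} \<times> space P"
    and zero: "\<And>B. B \<in> sets (F 0) \<Longrightarrow> f -` ({0} \<times> B) \<inter> space M \<in> sets M"
    and Ioc: "\<And>s t B. 0 \<le> s \<Longrightarrow> s \<le> t \<Longrightarrow> B \<in> sets (F s) \<Longrightarrow> f -` ({s<..t} \<times> B) \<inter> space M \<in> sets M"
  shows "f \<in> measurable M (predictable_sigma F)"
  by (rule measurable_sigma_sets[OF sets_predictable _ space])
     (use zero Ioc predictable_gen_subset in auto)

lemma predictable_Ioi: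
  assumes "0 \<le> s" "B \<in> sets (F s)"
  shows "{s<..} \<times> B \<in> sets (predictable_sigma F)"
proof -
  have "{s<..} \<times> B = (\<Union>m::nat. {s<..real m} \<times> B)"
  proof (intro equalityI subsetI)
    fix x assume x: "x \<in> {s<..} \<times> B"
    obtain m :: nat where "fst x < real m" using reals_Archimedean2 by blast
    then show "x \<in> (\<Union>m::nat. {s<..real m} \<times> B)" using x by (auto intro!: exI[of _ m])
  qed auto
  then show ?thesis using predictable_Ioc[OF assms] by (simp add: sets.countable_UN)
qed

lemma predictable_Ioo:
  assumes "0 \<le> s" "B \<in> sets (F s)"
  shows "{s<..<t} \<times> B \<in> sets (predictable_sigma F)"
proof -
  have "{s<..<t} \<times> B = (\<Union>m::nat. {s<..t - 1 / real (Suc m)} \<times> B)"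
  proof (intro equalityI subsetI)
    fix x assume x: "x \<in> {s<..<t} \<times> B"
    then have "0 < t - fst x" by auto
    then obtain m :: nat where "1 / real (Suc m) < t - fst x" by (rule nat_approx_posE)
    then show "x \<in> (\<Union>m::nat. {s<..t - 1 / real (Suc m)} \<times> B)" using x by (auto intro!: exI[of _ m])
  next
    fix x assume "x \<in> (\<Union>m::nat. {s<..t - 1 / real (Suc m)} \<times> B)"
    then obtain m :: nat where m: "x \<in> {s<..t - 1 / real (Suc m)} \<times> B" by blast
    then have "s < fst x" "fst x \<le> t - 1 / real (Suc m)" "snd x \<in> B" unfolding mem_Times_iff by simp_all
    moreover have "0 < 1 / real (Suc m)" by simp
    ultimately have "fst x < t" by linarith
    then show "x \<in> {s<..<t} \<times> B" using m by auto
  qed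
  then show ?thesis using predictable_Ioc[OF assms] by (simp add: sets.countable_UN)
qed

lemma elementary_predictable: "K \<in> elementary \<Longrightarrow> K \<in> sets (predictable_sigma F)"
proof (induction rule: elementary.induct)
  case (cell c a B b)
  then have "{a..b} \<times> B = ({c<..b} \<times> B) - ({c<..<a} \<times> B)" by auto
  then show ?case using predictable_Ioc predictable_Ioo cell by auto
qed auto

lemma elementary_delta_predictable: "K \<in> elementary_delta \<Longrightarrow> K \<in> sets (predictable_sigma F)"
  unfolding elementary_delta_def using elementary_predictable by (auto intro!: sets.countable_INT)

text \<open>Time \<open>0\<close> is left out because nothing can be announced before it.\<close>
definition inner_regular_for :: "(real \<times> 'a) measure \<Rightarrow> (real \<times> 'a) set \<Rightarrow> bool" where
  "inner_regular_for \<mu> \<Gamma> \<longleftrightarrow> (\<forall>e>0. \<exists>K\<in>elementary_delta. K \<subseteq> \<Gamma> \<and>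
     measure \<mu> (\<Gamma> \<inter> ({0<..} \<times> space P) - K) < e)"

lemma inner_regular_sequence:
  fixes \<Gamma> :: "nat \<Rightarrow> (real \<times> 'a) set"
  assumes \<mu>: "finite_measure \<mu>" "sets \<mu> = sets (predictable_sigma F)"
    and \<Gamma>: "\<And>i. \<Gamma> i \<in> sets \<mu>" "\<And>i. inner_regular_for \<mu> (\<Gamma> i)" and e: "0 < e"
  shows "\<exists>K. (\<forall>i. K i \<in> elementary_delta) \<and> (\<forall>i. K i \<subseteq> \<Gamma> i) \<and>
    measure \<mu> (\<Union>i. \<Gamma> i \<inter> ({0<..} \<times> space P) - K i) < e"
proof -
  interpret finite_measure \<mu> by fact
  have "\<exists>K. K \<in> elementary_delta \<and> K \<subseteq> \<Gamma> i \<and>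
      measure \<mu> (\<Gamma> i \<inter> ({0<..} \<times> space P) - K) < e / 2 * (1/2) ^ Suc i" for i
    using \<Gamma>(2)[of i] e unfolding inner_regular_for_def
    by (auto elim!: allE[of _ "e / 2 * (1/2) ^ Suc i"])
  then obtain K where K: "\<And>i. K i \<in> elementary_delta" "\<And>i. K i \<subseteq> \<Gamma> i"
      "\<And>i. measure \<mu> (\<Gamma> i \<inter> ({0<..} \<times> space P) - K i) < e / 2 * (1/2) ^ Suc i" by metis
  have sums: "(\<lambda>i. e / 2 * (1/2) ^ Suc i) sums (e / 2 * 1)"
    by (intro sums_mult power_half_series)
  have meas: "\<Gamma> i \<inter> ({0<..} \<times> space P) - K i \<in> sets \<mu>" for i
    using \<Gamma>(1)[of i] predictable_Ioi[of 0 "space P"] sets.top[of "F 0"]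
      elementary_delta_predictable[OF K(1)[of i]] \<mu>(2) by auto
  have summable: "summable (\<lambda>i. measure \<mu> (\<Gamma> i \<inter> ({0<..} \<times> space P) - K i))"
    by (rule summable_comparison_test'[OF sums_summable[OF sums], of 0])
       (use K(3) in \<open>auto intro: less_imp_le\<close>)
  have "measure \<mu> (\<Union>i. \<Gamma> i \<inter> ({0<..} \<times> space P) - K i)
      \<le> (\<Sum>i. measure \<mu> (\<Gamma> i \<inter> ({0<..} \<times> space P) - K i))"
    by (rule finite_measure_subadditive_countably[OF _ summable]) (use meas in auto)
  also have "\<dots> \<le> (\<Sum>i. e / 2 * (1/2) ^ Suc i)"
    by (rule suminf_le[OF _ summable sums_summable[OF sums]]) (use K(3) in \<open>auto intro: less_imp_le\<close>)
  also have "\<dots> < e" using sums_unique[OF sums] e by simp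
  finally show ?thesis using K by blast
qed

lemma inner_regular_UN:
  fixes \<Gamma> :: "nat \<Rightarrow> (real \<times> 'a) set"
  assumes \<mu>: "finite_measure \<mu>" "sets \<mu> = sets (predictable_sigma F)"
    and \<Gamma>: "\<And>i. \<Gamma> i \<in> sets \<mu>" "\<And>i. inner_regular_for \<mu> (\<Gamma> i)"
  shows "inner_regular_for \<mu> (\<Union>i. \<Gamma> i)"
  unfolding inner_regular_for_def
proof (intro allI impI)
  fix e :: real assume e: "0 < e"
  interpret finite_measure \<mu> by fact
  obtain K where K: "\<And>i. K i \<in> elementary_delta" "\<And>i. K i \<subseteq> \<Gamma> i"
    "measure \<mu> (\<Union>i. \<Gamma> i \<inter> ({0<..} \<times> space P) - K i) < e"
    using inner_regular_sequence[of \<mu> \<Gamma>, OF \<mu> \<Gamma> e] by blast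
  let ?p = "{0<..} \<times> space P"
  have [measurable]: "?p \<in> sets \<mu>" "\<And>i. \<Gamma> i \<in> sets \<mu>" "\<And>i. K i \<in> sets \<mu>"
    using \<Gamma>(1) predictable_Ioi[of 0 "space P"] sets.top[of "F 0"]
      elementary_delta_predictable[OF K(1)] \<mu>(2) by auto
  define D where "D m = (\<Union>i. \<Gamma> i) \<inter> ?p - (\<Union>i\<le>m. K i)" for m
  have "(\<lambda>m. measure \<mu> (D m)) \<longlonglongrightarrow> measure \<mu> (\<Inter>m. D m)"
    by (rule finite_Lim_measure_decseq) (auto simp: D_def decseq_def)
  moreover have "measure \<mu> (\<Inter>m. D m) \<le> measure \<mu> (\<Union>i. \<Gamma> i \<inter> ?p - K i)"
  proof (rule finite_measure_mono)
    show "(\<Inter>m. D m) \<subseteq> (\<Union>i. \<Gamma> i \<inter> ?p - K i)" by (auto simp: D_def)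
  qed auto
  ultimately have "eventually (\<lambda>m. measure \<mu> (D m) < e) sequentially"
    using K(3) by (intro order_tendstoD(2)[OF _ le_less_trans])
  then obtain m where "measure \<mu> (D m) < e" using eventually_happens'[OF sequentially_bot] by blast
  then show "\<exists>K\<in>elementary_delta. K \<subseteq> (\<Union>i. \<Gamma> i) \<and> measure \<mu> ((\<Union>i. \<Gamma> i) \<inter> ?p - K) < e"
    using K(2) elementary_delta_finite_UN[OF K(1)] by (intro bexI[of _ "\<Union>i\<le>m. K i"]) (auto simp: D_def)
qed

lemma inner_regular_INT:
  fixes \<Gamma> :: "nat \<Rightarrow> (real \<times> 'a) set"
  assumes \<mu>: "finite_measure \<mu>" "sets \<mu> = sets (predictable_sigma F)"
    and \<Gamma>: "\<And>i. \<Gamma> i \<in> sets \<mu>" "\<And>i. inner_regular_for \<mu> (\<Gamma> i)"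
  shows "inner_regular_for \<mu> (\<Inter>i. \<Gamma> i)"
  unfolding inner_regular_for_def
proof (intro allI impI)
  fix e :: real assume e: "0 < e"
  interpret finite_measure \<mu> by fact
  obtain K where K: "\<And>i. K i \<in> elementary_delta" "\<And>i. K i \<subseteq> \<Gamma> i"
    "measure \<mu> (\<Union>i. \<Gamma> i \<inter> ({0<..} \<times> space P) - K i) < e"
    using inner_regular_sequence[of \<mu> \<Gamma>, OF \<mu> \<Gamma> e] by blast
  let ?p = "{0<..} \<times> space P"
  have [measurable]: "?p \<in> sets \<mu>" "\<And>i. \<Gamma> i \<in> sets \<mu>" "\<And>i. K i \<in> sets \<mu>"
    using \<Gamma>(1) predictable_Ioi[of 0 "space P"] sets.top[of "F 0"]
      elementary_delta_predictable[OF K(1)] \<mu>(2) by auto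
  have sub: "(\<Inter>i. K i) \<subseteq> (\<Inter>i. \<Gamma> i)" using K(2) by (intro INT_greatest INF_lower2[OF UNIV_I])
  have le: "measure \<mu> ((\<Inter>i. \<Gamma> i) \<inter> ?p - (\<Inter>i. K i)) \<le> measure \<mu> (\<Union>i. \<Gamma> i \<inter> ?p - K i)"
    by (rule finite_measure_mono) auto
  show "\<exists>K\<in>elementary_delta. K \<subseteq> (\<Inter>i. \<Gamma> i) \<and> measure \<mu> ((\<Inter>i. \<Gamma> i) \<inter> ?p - K) < e"
    by (intro bexI[of _ "\<Inter>i. K i"] conjI sub le_less_trans[OF le K(3)] elementary_delta_INT K(1))
qed

lemma inner_regular_positive_part:
  assumes "inner_regular_for \<mu> \<Gamma>'" "\<Gamma>' \<subseteq> \<Gamma>" "\<Gamma> \<inter> ({0<..} \<times> space P) \<subseteq> \<Gamma>'"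
  shows "inner_regular_for \<mu> \<Gamma>"
proof -
  have "\<Gamma> \<inter> ({0<..} \<times> space P) = \<Gamma>' \<inter> ({0<..} \<times> space P)" using assms by auto
  then show ?thesis using assms(1,2) unfolding inner_regular_for_def by (metis subset_trans)
qed

lemma inner_regular_elementary: "K \<in> elementary \<Longrightarrow> inner_regular_for \<mu> K"
  unfolding inner_regular_for_def
proof (intro allI impI bexI[of _ K] conjI)
  fix e :: real assume "0 < e"
  have "K \<inter> ({0<..} \<times> space P) - K = {}" by auto
  then show "measure \<mu> (K \<inter> ({0<..} \<times> space P) - K) < e"
    using \<open>0 < e\<close> by (simp only: measure_empty)
qed (auto intro: elementary_deltaI)

lemma inner_regular_Un:
  assumes \<mu>: "finite_measure \<mu>" "sets \<mu> = sets (predictable_sigma F)"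
    and "\<Gamma> \<in> sets \<mu>" "\<Gamma>' \<in> sets \<mu>" "inner_regular_for \<mu> \<Gamma>" "inner_regular_for \<mu> \<Gamma>'"
  shows "inner_regular_for \<mu> (\<Gamma> \<union> \<Gamma>')"
proof -
  have "inner_regular_for \<mu> (\<Union>i::nat. if i = 0 then \<Gamma> else \<Gamma>')"
    by (rule inner_regular_UN[OF \<mu>]) (use assms in auto)
  moreover have "(\<Union>i::nat. if i = 0 then \<Gamma> else \<Gamma>') = \<Gamma> \<union> \<Gamma>'"
    by (auto split: if_splits intro: exI[of _ "0::nat"] exI[of _ "1::nat"])
  ultimately show ?thesis by simp
qed

lemma inner_regular_Ioc:
  assumes \<mu>: "finite_measure \<mu>" "sets \<mu> = sets (predictable_sigma F)"
    and s: "0 \<le> s" and B: "B \<in> sets (F s)"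
  shows "inner_regular_for \<mu> ({s<..t} \<times> B)"
proof -
  have eq: "{s<..t} \<times> B = (\<Union>m::nat. {s + 1 / real (Suc m)..t} \<times> B)"
  proof (intro equalityI subsetI)
    fix x assume x: "x \<in> {s<..t} \<times> B"
    then have "0 < fst x - s" by auto
    then obtain m :: nat where "1 / real (Suc m) < fst x - s" by (rule nat_approx_posE)
    then show "x \<in> (\<Union>m::nat. {s + 1 / real (Suc m)..t} \<times> B)" using x by (auto intro!: exI[of _ m])
  next
    fix x assume "x \<in> (\<Union>m::nat. {s + 1 / real (Suc m)..t} \<times> B)"
    then obtain m :: nat where m: "x \<in> {s + 1 / real (Suc m)..t} \<times> B" by blast
    then have "s + 1 / real (Suc m) \<le> fst x" "fst x \<le> t" "snd x \<in> B" unfolding mem_Times_iff by simp_all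
    moreover have "0 < 1 / real (Suc m)" by simp
    ultimately have "s < fst x" by linarith
    then show "x \<in> {s<..t} \<times> B" using m by auto
  qed
  have el: "{s + 1 / real (Suc m)..t} \<times> B \<in> elementary" for m :: nat
    by (rule elementary.cell[OF s _ B]) simp
  show ?thesis unfolding eq
    by (rule inner_regular_UN[OF \<mu>])
       (use inner_regular_elementary el elementary_predictable \<mu>(2) in auto)
qed

lemma inner_regular_Ioi:
  assumes \<mu>: "finite_measure \<mu>" "sets \<mu> = sets (predictable_sigma F)"
    and s: "0 \<le> s" and B: "B \<in> sets (F s)"
  shows "inner_regular_for \<mu> ({s<..} \<times> B)"
proof -
  have eq: "{s<..} \<times> B = (\<Union>m::nat. {s<..real m} \<times> B)"
  proof (intro equalityI subsetI)
    fix x assume x: "x \<in> {s<..} \<times> B"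
    obtain m :: nat where "fst x < real m" using reals_Archimedean2 by blast
    then show "x \<in> (\<Union>m::nat. {s<..real m} \<times> B)" using x by (auto intro!: exI[of _ m])
  qed auto
  show ?thesis unfolding eq
    by (rule inner_regular_UN[OF \<mu>]) (use inner_regular_Ioc[OF \<mu> s B] predictable_Ioc s B \<mu>(2) in auto)
qed

text \<open>The sets that are approximable together with their complements form a \<open>\<sigma>\<close>-algebra: countable unions need
  finite unions of approximating sets, and countable intersections need the closure of
  \<open>elementary_delta\<close> under such intersections. The half-open generators are increasing unions of
  elementary sets.\<close>
lemma predictable_inner_regular:
  assumes \<mu>: "finite_measure \<mu>" "sets \<mu> = sets (predictable_sigma F)"
    and \<Gamma>: "\<Gamma> \<in> sets (predictable_sigma F)"
  shows "inner_regular_for \<mu> \<Gamma>"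
proof -
  let ?\<Omega> = "{0..} \<times> space P"
  have top: "space P \<in> sets (F s)" for s using sets.top[of "F s"] by simp
  have all: "inner_regular_for \<mu> ?\<Omega>"
    by (rule inner_regular_positive_part[OF inner_regular_Ioi[OF \<mu> order.refl top]]) auto
  have none: "inner_regular_for \<mu> {}" by (rule inner_regular_elementary[OF elementary.empty])
  have "\<Gamma> \<in> sets \<mu> \<and> inner_regular_for \<mu> \<Gamma> \<and> inner_regular_for \<mu> (?\<Omega> - \<Gamma>)"
    using \<Gamma> unfolding sets_predictable
  proof (induction rule: sigma_sets.induct)
    case (Basic G)
    then consider (zero) B where "G = {0} \<times> B" "B \<in> sets (F 0)"
      | (Ioc) s t B where "G = {s<..t} \<times> B" "0 \<le> s" "s \<le> t" "B \<in> sets (F s)" by blast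
    then show ?case
    proof cases
      case zero
      have "inner_regular_for \<mu> G"
        by (rule inner_regular_positive_part[OF none]) (use zero in auto)
      moreover have "inner_regular_for \<mu> (?\<Omega> - G)"
        by (rule inner_regular_positive_part[OF inner_regular_Ioi[OF \<mu> order.refl top]]) (use zero in auto)
      ultimately show ?thesis using zero predictable_zero \<mu>(2) by auto
    next
      case Ioc
      have mem: "{0<..s} \<times> space P \<in> sets \<mu>" "{s<..t} \<times> (space P - B) \<in> sets \<mu>" "{t<..} \<times> space P \<in> sets \<mu>"
        using predictable_Ioc[OF order.refl top, of s] predictable_Ioi[OF _ top, of t]
          predictable_Ioc[of s "space P - B" t] Ioc top sets.Diff[OF top Ioc(4)] \<mu>(2) by auto
      have "inner_regular_for \<mu> ({0<..s} \<times> space P \<union> ({s<..t} \<times> (space P - B) \<union> {t<..} \<times> space P))"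
        by (intro inner_regular_Un[OF \<mu>] mem sets.Un inner_regular_Ioc[OF \<mu>] inner_regular_Ioi[OF \<mu>] top)
           (use Ioc sets.Diff[OF top Ioc(4)] in auto)
      then have "inner_regular_for \<mu> (?\<Omega> - G)"
        by (rule inner_regular_positive_part) (use Ioc in auto)
      then show ?thesis
        using Ioc inner_regular_Ioc[OF \<mu> Ioc(2,4)] predictable_Ioc \<mu>(2) by auto
    qed
  next
    case Empty
    then show ?case using none all by simp
  next
    case (Compl G)
    have sub: "G \<subseteq> ?\<Omega>" using Compl.IH sets.sets_into_space[of G \<mu>] sets_eq_imp_space_eq[OF \<mu>(2)] by simp
    then have "?\<Omega> - (?\<Omega> - G) = G" by auto
    moreover have "?\<Omega> - G \<in> sets \<mu>"
      using Compl.IH sets.compl_sets[of G \<mu>] sets_eq_imp_space_eq[OF \<mu>(2)] by simp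
    ultimately show ?case using Compl.IH by simp
  next
    case (Union G)
    have "?\<Omega> - (\<Union>i. G i) = (\<Inter>i. ?\<Omega> - G i)" by auto
    moreover have "?\<Omega> - G i \<in> sets \<mu>" for i
      using Union.IH[of i] sets.compl_sets[of "G i" \<mu>] sets_eq_imp_space_eq[OF \<mu>(2)] by simp
    ultimately show ?case
      using Union.IH inner_regular_UN[OF \<mu>, of G] inner_regular_INT[OF \<mu>, of "\<lambda>i. ?\<Omega> - G i"] by auto
  qed
  then show ?thesis by blast
qed

end

section \<open>The left limit of a martingale on a predictable graph\<close>

lemma tendsto_left_seq:
  fixes f :: "real \<Rightarrow> real"
  assumes f: "left_limits_path f" "0 < t" and Q: "Q \<longlonglongrightarrow> t" and lt: "eventually (\<lambda>m. Q m < t) sequentially"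
  shows "(\<lambda>m. f (Q m)) \<longlonglongrightarrow> left_lim f t"
proof -
  have "filterlim Q (at_left t) sequentially"
    unfolding filterlim_at using Q lt by (auto elim!: eventually_mono)
  then show ?thesis using left_limits_tendsto(1)[OF f] by (rule filterlim_compose[rotated])
qed

lemma tendsto_right_seq:
  fixes f :: "real \<Rightarrow> real"
  assumes f: "right_cont_path f" "0 \<le> t" and Q: "Q \<longlonglongrightarrow> t" and lt: "eventually (\<lambda>m. t < Q m) sequentially"
  shows "(\<lambda>m. f (Q m)) \<longlonglongrightarrow> f t"
proof -
  have "filterlim Q (at_right t) sequentially"
    unfolding filterlim_at using Q lt by (auto elim!: eventually_mono)
  moreover have "(f \<longlongrightarrow> f t) (at_right t)"
    using f by (auto simp: right_cont_path_def continuous_within)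
  ultimately show ?thesis by (rule filterlim_compose[rotated])
qed

context filtered
begin

text \<open>The next grid point strictly after \<open>T\<close>, with the horizon \<open>n\<close> in place of late values.\<close>
definition grid_above :: "real \<Rightarrow> ('a \<Rightarrow> real) \<Rightarrow> nat \<Rightarrow> 'a \<Rightarrow> real" where
  "grid_above n T m \<omega> =
     (if T \<omega> < n then (of_int \<lfloor>real (Suc m) * T \<omega>\<rfloor> + 1) / real (Suc m) else n)"

lemma grid_above_bounds:
  assumes "T \<omega> < n"
  shows "T \<omega> < grid_above n T m \<omega>" "grid_above n T m \<omega> \<le> T \<omega> + 1 / real (Suc m)"
proof -
  let ?d = "real (Suc m)"
  have d: "0 < ?d" by simp
  have "?d * T \<omega> < of_int \<lfloor>?d * T \<omega>\<rfloor> + 1" "of_int \<lfloor>?d * T \<omega>\<rfloor> \<le> ?d * T \<omega>" by linarith+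
  then show "T \<omega> < grid_above n T m \<omega>" "grid_above n T m \<omega> \<le> T \<omega> + 1 / ?d"
    using assms d unfolding grid_above_def by (simp_all add: field_simps del: of_nat_Suc)
qed

lemma stopping_less:
  assumes T: "\<And>s. 0 \<le> s \<Longrightarrow> {\<omega>\<in>space P. T \<omega> \<le> s} \<in> sets (F s)"
    and nonneg: "\<And>\<omega>. \<omega> \<in> space P \<Longrightarrow> 0 \<le> T \<omega>" and "x \<le> s" "0 \<le> s"
  shows "{\<omega>\<in>space P. T \<omega> < x} \<in> sets (F s)"
proof -
  have "{\<omega>\<in>space P. T \<omega> < x} = (\<Union>k::nat. {\<omega>\<in>space P. T \<omega> \<le> x - 1 / real (Suc k)})"
  proof (intro equalityI subsetI)
    fix \<omega> assume w: "\<omega> \<in> {\<omega>\<in>space P. T \<omega> < x}"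
    then have "0 < x - T \<omega>" by simp
    then obtain k :: nat where "1 / real (Suc k) < x - T \<omega>" by (rule nat_approx_posE)
    then show "\<omega> \<in> (\<Union>k::nat. {\<omega>\<in>space P. T \<omega> \<le> x - 1 / real (Suc k)})"
      using w by (auto intro!: exI[of _ k])
  next
    fix \<omega> assume "\<omega> \<in> (\<Union>k::nat. {\<omega>\<in>space P. T \<omega> \<le> x - 1 / real (Suc k)})"
    then obtain k :: nat where "\<omega> \<in> space P" "T \<omega> \<le> x - 1 / real (Suc k)" by blast
    moreover have "0 < 1 / real (Suc k)" by simp
    ultimately have "T \<omega> < x" by linarith
    with \<open>\<omega> \<in> space P\<close> show "\<omega> \<in> {\<omega>\<in>space P. T \<omega> < x}" by simp
  qed
  moreover have "{\<omega>\<in>space P. T \<omega> \<le> x - 1 / real (Suc k)} \<in> sets (F s)" for k :: nat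
  proof (cases "0 \<le> x - 1 / real (Suc k)")
    case True
    have "0 < 1 / real (Suc k)" by simp
    then have "x - 1 / real (Suc k) \<le> s" using assms(3) by linarith
    then show ?thesis by (rule F_mono[OF _ T[OF True]])
  next
    case False
    then have "{\<omega>\<in>space P. T \<omega> \<le> x - 1 / real (Suc k)} = {}" using nonneg by force
    then show ?thesis by (simp only: sets.empty_sets)
  qed
  ultimately show ?thesis by (simp only:) (intro sets.countable_nat_UN, auto)
qed

lemma simple_stop_grid_above:
  assumes T: "\<And>s. 0 \<le> s \<Longrightarrow> {\<omega>\<in>space P. T \<omega> \<le> s} \<in> sets (F s)"
    and nonneg: "\<And>\<omega>. \<omega> \<in> space P \<Longrightarrow> 0 \<le> T \<omega>" and meas: "T \<in> borel_measurable P" and n: "0 \<le> n"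
  shows "simple_stop n (grid_above n T m)"
proof -
  let ?d = "real (Suc m)"
  have d: "0 < ?d" by simp
  note meas [measurable]
  have "grid_above n T m ` space P \<subseteq> (\<lambda>k. (of_int k + 1) / ?d) ` {0..\<lfloor>?d * n\<rfloor>} \<union> {n}"
  proof
    fix y assume "y \<in> grid_above n T m ` space P"
    then obtain \<omega> where w: "\<omega> \<in> space P" "y = grid_above n T m \<omega>" by blast
    show "y \<in> (\<lambda>k. (of_int k + 1) / ?d) ` {0..\<lfloor>?d * n\<rfloor>} \<union> {n}"
    proof (cases "T \<omega> < n")
      case True
      then have "\<lfloor>?d * T \<omega>\<rfloor> \<le> \<lfloor>?d * n\<rfloor>" by (intro floor_mono) (simp add: mult_left_mono)
      moreover have "0 \<le> \<lfloor>?d * T \<omega>\<rfloor>" using nonneg[OF w(1)] by simp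
      ultimately have "\<lfloor>?d * T \<omega>\<rfloor> \<in> {0..\<lfloor>?d * n\<rfloor>}" by simp
      moreover have "y = (of_int \<lfloor>?d * T \<omega>\<rfloor> + 1) / ?d" using w True by (simp add: grid_above_def)
      ultimately show ?thesis by (intro UnI1 image_eqI)
    qed (use w in \<open>simp add: grid_above_def\<close>)
  qed
  then have fin: "finite (grid_above n T m ` space P)" by (rule finite_subset) simp
  have "{\<omega>\<in>space P. grid_above n T m \<omega> \<le> s} \<in> sets (F s)" if s: "0 \<le> s" "s < n" for s
  proof -
    let ?x = "of_int \<lfloor>?d * s\<rfloor> / ?d"
    have x: "?x \<le> s" using d by (simp add: divide_le_eq mult.commute del: of_nat_Suc)
    have "grid_above n T m \<omega> \<le> s \<longleftrightarrow> T \<omega> < ?x" for \<omega>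
    proof (cases "T \<omega> < n")
      case True
      have "grid_above n T m \<omega> \<le> s \<longleftrightarrow> of_int (\<lfloor>?d * T \<omega>\<rfloor> + 1) \<le> ?d * s"
        using True d by (simp add: grid_above_def divide_le_eq mult.commute del: of_nat_Suc)
      also have "\<dots> \<longleftrightarrow> \<lfloor>?d * T \<omega>\<rfloor> < \<lfloor>?d * s\<rfloor>" by linarith
      also have "\<dots> \<longleftrightarrow> ?d * T \<omega> < of_int \<lfloor>?d * s\<rfloor>" by linarith
      also have "\<dots> \<longleftrightarrow> T \<omega> < ?x" using d by (simp add: less_divide_eq mult.commute del: of_nat_Suc)
      finally show ?thesis .
    next
      case False
      then show ?thesis using s x by (auto simp: grid_above_def)
    qed
    then show ?thesis using stopping_less[OF T nonneg x s(1)] by simp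
  qed
  moreover have "grid_above n T m \<in> borel_measurable P"
    unfolding grid_above_def by measurable
  moreover have "0 \<le> grid_above n T m \<omega>" if "\<omega> \<in> space P" for \<omega>
    using grid_above_bounds(1)[of T \<omega> n m] nonneg[OF that] n
    by (cases "T \<omega> < n") (auto simp: grid_above_def)
  ultimately show ?thesis using fin by (simp add: simple_stop_def)
qed

end

context closed_martingale
begin

text \<open>On \<open>D\<close> the martingale is evaluated just before \<open>T\<close>, elsewhere at \<open>T\<close>.\<close>
definition value_before :: "('a \<Rightarrow> real) \<Rightarrow> 'a set \<Rightarrow> 'a \<Rightarrow> real" where
  "value_before T D \<omega> = (if \<omega> \<in> D then left_lim (\<lambda>s. N s \<omega>) (T \<omega>) else N (T \<omega>) \<omega>)"

text \<open>Let \<open>S\<^sub>m\<close> announce the elementary set \<open>L\<^sub>m \<downarrow> K\<close> up to \<open>1/(m+1)\<close>. On \<open>D\<close> the debut of \<open>L\<^sub>m\<close> increases to that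
  of \<open>K\<close>, which is \<open>T\<close>, so \<open>S\<^sub>m \<rightarrow> T\<close> from strictly below; off \<open>D\<close> the section of some \<open>L\<^sub>m\<close> is empty by
  compactness, and \<open>S\<^sub>m\<close> is eventually at least \<open>n\<close>. The minimum of \<open>S\<^sub>m\<close> and the grid time after \<open>T\<close> therefore
  approaches \<open>T\<close> from the left on \<open>D\<close> and from the right off \<open>D\<close>, which yields both values of
  \<open>value_before\<close> from one sequence of stopping times with finitely many values. For an event \<open>E \<in> F\<^sub>r\<close> these
  times are raised to \<open>r\<close>, which eventually no longer affects the value of the martingale.\<close>
lemma value_before_delta:
  assumes T: "\<And>s. 0 \<le> s \<Longrightarrow> {\<omega>\<in>space P. T \<omega> \<le> s} \<in> sets (F s)"
    and nonneg: "\<And>\<omega>. \<omega> \<in> space P \<Longrightarrow> 0 \<le> T \<omega>" and meas: "T \<in> borel_measurable P"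
    and K: "K \<in> elementary_delta" and graph: "\<And>t \<omega>. (t, \<omega>) \<in> K \<Longrightarrow> \<omega> \<in> space P \<Longrightarrow> t = T \<omega>"
    and n: "0 \<le> n"
  defines "D \<equiv> {\<omega>\<in>space P. (T \<omega>, \<omega>) \<in> K}"
  shows "tails_dominated P \<xi> (value_before T D)"
    and "\<And>r E. 0 \<le> r \<Longrightarrow> E \<in> sets (F r) \<Longrightarrow> (\<And>\<omega>. \<omega> \<in> E \<Longrightarrow> r \<le> T \<omega>) \<Longrightarrow>
      (\<And>\<omega>. \<omega> \<in> E \<Longrightarrow> \<omega> \<in> D \<Longrightarrow> r < T \<omega>) \<Longrightarrow>
      (LINT \<omega>:E|P. value_before T D \<omega>) = (LINT \<omega>:E|P. \<xi> \<omega>)"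
proof -
  obtain L where L: "decseq L" "\<And>m. L m \<in> elementary" "K = (\<Inter>m. L m)"
    using elementary_delta_decseq[OF K] by blast
  define e where "e m = 1 / real (Suc m)" for m
  have e: "0 < e m" for m by (simp add: e_def)
  have e_lim: "e \<longlonglongrightarrow> 0" unfolding e_def by (rule LIMSEQ_inverse_real_of_nat[unfolded inverse_eq_divide])
  have "\<forall>m. \<exists>S. simple_stop n S \<and> (\<forall>\<omega>\<in>space P. \<forall>t. (t, \<omega>) \<in> L m \<longrightarrow> S \<omega> < t) \<and>
    (\<forall>\<omega>\<in>space P. S \<omega> < n \<longrightarrow> (\<exists>t. (t, \<omega>) \<in> L m \<and> t \<le> S \<omega> + e m))"
    using elementary_announced[OF L(2) e n] by blast
  then obtain S where S: "\<And>m. simple_stop n (S m)"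
      "\<And>m \<omega> t. \<omega> \<in> space P \<Longrightarrow> (t, \<omega>) \<in> L m \<Longrightarrow> S m \<omega> < t"
      "\<And>m \<omega>. \<omega> \<in> space P \<Longrightarrow> S m \<omega> < n \<Longrightarrow> \<exists>t. (t, \<omega>) \<in> L m \<and> t \<le> S m \<omega> + e m"
    by metis
  define Q where "Q m \<omega> = min (S m \<omega>) (grid_above n T m \<omega>)" for m \<omega>
  have Q: "simple_stop n (Q m)" for m
    unfolding Q_def by (rule simple_stop_min[OF S(1) simple_stop_grid_above[OF T nonneg meas n]])
  have beyond: "eventually (\<lambda>m. n \<le> S m \<omega> \<or> z < S m \<omega> + e m) sequentially"
    if w: "\<omega> \<in> space P" and z: "\<And>t. (t, \<omega>) \<in> K \<Longrightarrow> z < t" for \<omega> z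
  proof -
    \<comment> \<open>otherwise the nested compact sections would have a common point \<open>\<le> z\<close>, which would lie in \<open>K\<close>\<close>
    have "\<exists>m0. {t. (t, \<omega>) \<in> L m0} \<inter> {..z} = {}"
    proof (rule ccontr)
      assume "\<nexists>m0. {t. (t, \<omega>) \<in> L m0} \<inter> {..z} = {}"
      moreover have "compact ({t. (t, \<omega>) \<in> L m} \<inter> {..z})" for m
        using elementary_section[OF L(2)] by (intro compact_Int_closed) auto
      ultimately have "(\<Inter>m. {t. (t, \<omega>) \<in> L m} \<inter> {..z}) \<noteq> {}"
        using decseqD[OF L(1)] by (intro compact_nest) blast+
      then show False using z L(3) by force
    qed
    then obtain m0 where m0: "{t. (t, \<omega>) \<in> L m0} \<inter> {..z} = {}" by blast
    have "n \<le> S m \<omega> \<or> z < S m \<omega> + e m" if "m0 \<le> m" for m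
    proof (cases "S m \<omega> < n")
      case True
      then obtain t where t: "(t, \<omega>) \<in> L m" "t \<le> S m \<omega> + e m" using S(3)[OF w] by blast
      then have "(t, \<omega>) \<in> L m0" using decseqD[OF L(1) that] by blast
      then show ?thesis using m0 t(2) by fastforce
    qed simp
    then show ?thesis by (auto simp: eventually_sequentially)
  qed
  have grid_lim: "(\<lambda>m. grid_above n T m \<omega>) \<longlonglongrightarrow> T \<omega>" if "T \<omega> < n" for \<omega>
  proof (rule tendsto_sandwich[where f = "\<lambda>_. T \<omega>"])
    show "(\<lambda>m. T \<omega> + e m) \<longlonglongrightarrow> T \<omega>" using tendsto_add[OF tendsto_const e_lim] by simp
  qed (use grid_above_bounds[where T=T and \<omega>=\<omega> and n=n, OF that] in \<open>auto simp: e_def less_imp_le simp del: of_nat_Suc\<close>)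
  have lim: "(\<lambda>m. N (Q m \<omega>) \<omega>) \<longlonglongrightarrow> value_before T D \<omega> \<and>
      (\<forall>r. r \<le> T \<omega> \<and> (\<omega> \<in> D \<longrightarrow> r < T \<omega>) \<longrightarrow>
        eventually (\<lambda>m. N (max (Q m \<omega>) r) \<omega> = N (Q m \<omega>) \<omega>) sequentially)"
    if w: "\<omega> \<in> space P" for \<omega>
  proof -
    have rc: "right_cont_path (\<lambda>s. N s \<omega>)" and ll: "left_limits_path (\<lambda>s. N s \<omega>)"
      using cadlag[OF w] by (auto simp: cadlag_path_def)
    \<comment> \<open>once the times have passed the horizon the martingale equals \<open>\<xi>\<close>\<close>
    have late: "?thesis" if ev: "eventually (\<lambda>m. n \<le> Q m \<omega>) sequentially" and val: "value_before T D \<omega> = \<xi> \<omega>"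
    proof (intro conjI allI impI)
      show "(\<lambda>m. N (Q m \<omega>) \<omega>) \<longlonglongrightarrow> value_before T D \<omega>"
        unfolding val by (rule tendsto_eventually, use ev in eventually_elim) (rule final[OF _ w])
      show "eventually (\<lambda>m. N (max (Q m \<omega>) r) \<omega> = N (Q m \<omega>) \<omega>) sequentially" for r
        using ev by eventually_elim (simp add: final[OF _ w] le_max_iff_disj)
    qed
    show ?thesis
    proof (cases "\<omega> \<in> D")
      case True
      then have inK: "(T \<omega>, \<omega>) \<in> K" by (simp add: D_def)
      have Tpos: "S m \<omega> < T \<omega>" for m using S(2)[OF w] inK L(3) by blast
      have T0: "0 < T \<omega>" using Tpos[of 0] S(1)[of 0] w by (force simp: simple_stop_def)
      have bey: "eventually (\<lambda>m. n \<le> S m \<omega> \<or> z < S m \<omega> + e m) sequentially" if "z < T \<omega>" for z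
        by (rule beyond[OF w]) (use graph[OF _ w] that in auto)
      show ?thesis
      proof (cases "n < T \<omega>")
        case True
        have "eventually (\<lambda>m. e m < (T \<omega> - n) / 2) sequentially"
          using e_lim True by (intro order_tendstoD(2)) auto
        moreover have "eventually (\<lambda>m. n \<le> S m \<omega> \<or> (T \<omega> + n) / 2 < S m \<omega> + e m) sequentially"
          by (rule bey) (use True in auto)
        ultimately have "eventually (\<lambda>m. n \<le> Q m \<omega>) sequentially"
        proof eventually_elim
          case (elim m)
          then have "n \<le> S m \<omega>" by (auto simp: field_simps)
          then show ?case using True by (simp add: Q_def grid_above_def)
        qed
        moreover have "left_lim (\<lambda>s. N s \<omega>) (T \<omega>) = \<xi> \<omega>"
        proof (rule tendsto_left_imp_left_lim)
          show "((\<lambda>s. N s \<omega>) \<longlongrightarrow> \<xi> \<omega>) (at_left (T \<omega>))"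
            by (rule tendsto_eventually, unfold eventually_at_left[OF True])
               (use True final[OF _ w] in \<open>auto intro!: exI[of _ n]\<close>)
        qed (use T0 in simp)
        ultimately show ?thesis using \<open>\<omega> \<in> D\<close> by (intro late) (auto simp: value_before_def)
      next
        case False
        have Sn: "S m \<omega> < n" for m using Tpos[of m] False by simp
        have QS: "Q m \<omega> = S m \<omega>" for m
          using grid_above_bounds(1)[of T \<omega> n m] Tpos[of m] False by (auto simp: Q_def grid_above_def)
        have Q_lim: "(\<lambda>m. Q m \<omega>) \<longlonglongrightarrow> T \<omega>"
        proof (rule order_tendstoI)
          fix z assume z: "z < T \<omega>"
          have "eventually (\<lambda>m. e m < (T \<omega> - z) / 2) sequentially"
            using e_lim z by (intro order_tendstoD(2)) auto
          moreover have "eventually (\<lambda>m. n \<le> S m \<omega> \<or> (T \<omega> + z) / 2 < S m \<omega> + e m) sequentially"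
            by (rule bey) (use z in auto)
          ultimately show "eventually (\<lambda>m. z < Q m \<omega>) sequentially"
          proof eventually_elim
            case (elim m)
            then show ?case using Sn[of m] unfolding QS by (simp add: field_simps)
          qed
        next
          fix z assume "T \<omega> < z"
          then show "eventually (\<lambda>m. Q m \<omega> < z) sequentially"
            by (intro always_eventually allI) (simp add: QS less_trans[OF Tpos])
        qed
        show ?thesis
        proof (intro conjI allI impI)
          show "(\<lambda>m. N (Q m \<omega>) \<omega>) \<longlonglongrightarrow> value_before T D \<omega>"
            using tendsto_left_seq[OF ll T0 Q_lim] Tpos \<open>\<omega> \<in> D\<close> by (simp add: QS value_before_def)
          fix r assume "r \<le> T \<omega> \<and> (\<omega> \<in> D \<longrightarrow> r < T \<omega>)"
          then have "eventually (\<lambda>m. r < Q m \<omega>) sequentially"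
            using \<open>\<omega> \<in> D\<close> by (intro order_tendstoD(1)[OF Q_lim]) auto
          then show "eventually (\<lambda>m. N (max (Q m \<omega>) r) \<omega> = N (Q m \<omega>) \<omega>) sequentially"
            by eventually_elim (simp add: max_def)
        qed
      qed
    next
      case False
      have empty: "(t, \<omega>) \<notin> K" for t using False graph[OF _ w] w by (auto simp: D_def)
      have "eventually (\<lambda>m. e m < 1) sequentially" using e_lim by (intro order_tendstoD(2)) auto
      moreover have "eventually (\<lambda>m. n \<le> S m \<omega> \<or> n + 1 < S m \<omega> + e m) sequentially"
        by (rule beyond[OF w]) (use empty in auto)
      ultimately have ev: "eventually (\<lambda>m. n \<le> S m \<omega>) sequentially"
        by eventually_elim auto
      have val: "value_before T D \<omega> = N (T \<omega>) \<omega>" using False by (simp add: value_before_def)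
      show ?thesis
      proof (cases "T \<omega> < n")
        case False
        show ?thesis
        proof (rule late)
          show "eventually (\<lambda>m. n \<le> Q m \<omega>) sequentially"
            using ev by eventually_elim (use False in \<open>simp add: Q_def grid_above_def\<close>)
        qed (use False val final[OF _ w] in auto)
      next
        case True
        have "(\<lambda>m. N (grid_above n T m \<omega>) \<omega>) \<longlonglongrightarrow> N (T \<omega>) \<omega>"
          using grid_above_bounds(1)[where n=n and T=T and \<omega>=\<omega>, OF True]
          by (intro tendsto_right_seq[where f = "\<lambda>s. N s \<omega>", OF rc nonneg[OF w] grid_lim[OF True]]
              always_eventually allI)
        moreover have "eventually (\<lambda>m. N (grid_above n T m \<omega>) \<omega> = N (Q m \<omega>) \<omega>) sequentially"
          using ev
        proof eventually_elim
          case (elim m)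
          show ?case
          proof (cases "grid_above n T m \<omega> \<le> S m \<omega>")
            case False
            then show ?thesis using elim final[OF _ w] by (simp add: Q_def)
          qed (simp add: Q_def)
        qed
        ultimately have "(\<lambda>m. N (Q m \<omega>) \<omega>) \<longlonglongrightarrow> value_before T D \<omega>"
          unfolding val by (rule Lim_transform_eventually)
        moreover have "eventually (\<lambda>m. N (max (Q m \<omega>) r) \<omega> = N (Q m \<omega>) \<omega>) sequentially"
          if "r \<le> T \<omega>" for r
          using ev
        proof eventually_elim
          case (elim m)
          then have "r \<le> Q m \<omega>"
            using grid_above_bounds(1)[of T \<omega> n m] that True by (simp add: Q_def)
          then show ?case by (simp add: max_def)
        qed
        ultimately show ?thesis by blast
      qed
    qed
  qed
  have Qs: "Q m \<in> borel_measurable P" "finite (Q m ` space P)" "\<forall>\<omega>\<in>space P. 0 \<le> Q m \<omega>" for m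
    using Q[of m] by (auto simp: simple_stop_def)
  have dom: "tails_dominated P \<xi> (\<lambda>\<omega>. N (Q m \<omega>) \<omega>)" for m by (rule tails_dominated_at_simple[OF Q])
  have V: "value_before T D \<in> borel_measurable P"
    by (rule borel_measurable_LIMSEQ_real[where u = "\<lambda>m \<omega>. N (Q m \<omega>) \<omega>"])
       (use lim dom in \<open>auto simp: tails_dominated_def\<close>)
  show "tails_dominated P \<xi> (value_before T D)"
    by (rule tails_dominated_limit[where Yk = "\<lambda>m \<omega>. N (Q m \<omega>) \<omega>", OF integrable_final dom V])
       (use lim in auto)
  fix r E assume r: "0 \<le> r" and E: "E \<in> sets (F r)" and ET: "\<And>\<omega>. \<omega> \<in> E \<Longrightarrow> r \<le> T \<omega>"
    "\<And>\<omega>. \<omega> \<in> E \<Longrightarrow> \<omega> \<in> D \<Longrightarrow> r < T \<omega>"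
  have EP: "E \<in> sets P" "E \<subseteq> space P" using sets_F_subset[OF E] sets.sets_into_space by auto
  let ?R = "\<lambda>m \<omega>. max (Q m \<omega>) r"
  have R: "simple_stop n (\<lambda>\<omega>. if \<omega> \<in> E then ?R m \<omega> else n)" for m
  proof -
    have "(\<lambda>\<omega>. if \<omega> \<in> E then ?R m \<omega> else n) ` space P \<subseteq> Q m ` space P \<union> {r, n}" by (auto simp: max_def)
    then have "finite ((\<lambda>\<omega>. if \<omega> \<in> E then ?R m \<omega> else n) ` space P)"
      by (rule finite_subset) (use Qs in auto)
    moreover have "(\<lambda>\<omega>. if \<omega> \<in> E then ?R m \<omega> else n) \<in> borel_measurable P"
      using Qs(1)[of m] EP(1) by measurable
    moreover have "{\<omega>\<in>space P. (if \<omega> \<in> E then ?R m \<omega> else n) \<le> s} \<in> sets (F s)"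
      if s: "0 \<le> s" "s < n" for s
    proof -
      have "{\<omega>\<in>space P. (if \<omega> \<in> E then ?R m \<omega> else n) \<le> s}
        = (if r \<le> s then E \<inter> {\<omega>\<in>space P. Q m \<omega> \<le> s} else {})" using s EP(2) by auto
      then show ?thesis using F_mono[OF _ E, of s] Q[of m] s by (auto simp: simple_stop_def)
    qed
    ultimately show ?thesis using Qs(3)[of m] n by (simp add: simple_stop_def le_max_iff_disj)
  qed
  let ?R' = "\<lambda>m \<omega>. if \<omega> \<in> E then ?R m \<omega> else n"
  \<comment> \<open>off \<open>E\<close> the times are set to the horizon, so that the limit there is \<open>\<xi>\<close>\<close>
  let ?Y = "\<lambda>\<omega>. if \<omega> \<in> E then value_before T D \<omega> else \<xi> \<omega>"
  have domR: "tails_dominated P \<xi> (\<lambda>\<omega>. N (?R' m \<omega>) \<omega>)" for m by (rule tails_dominated_at_simple[OF R])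
  have eq: "(LINT \<omega>:E|P. N (?R' m \<omega>) \<omega>) = (LINT \<omega>:E|P. \<xi> \<omega>)" for m
  proof (rule set_integral_at_simple[OF _ _ _ EP(1)])
    show "?R' m \<in> borel_measurable P" "finite (?R' m ` space P)" "\<forall>\<omega>\<in>space P. 0 \<le> ?R' m \<omega>"
      using R[of m] by (auto simp only: simple_stop_def)
    fix q assume q: "0 \<le> q" "q < n"
    have "E \<inter> {\<omega>\<in>space P. ?R' m \<omega> = q} = space P \<inter> {\<omega>\<in>space P. ?R' m \<omega> = q}" using q EP(2) by auto
    also have "\<dots> \<in> sets (F q)"
      by (rule simple_stop_eq[OF _ _ _ q])
         (use R[of m] in \<open>auto simp only: simple_stop_def Int_absorb1[OF Collect_restrict]\<close>)
    finally show "E \<inter> {\<omega>\<in>space P. ?R' m \<omega> = q} \<in> sets (F q)" .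
  qed
  have "(\<lambda>m. LINT \<omega>:E|P. N (?R' m \<omega>) \<omega>) \<longlonglongrightarrow> (LINT \<omega>:E|P. ?Y \<omega>)"
  proof (rule tails_dominated_set_integral_limit[OF integrable_final domR _ _ EP(1)])
    show "?Y \<in> borel_measurable P" using V integrable_final EP(1) by measurable
    show "AE \<omega> in P. (\<lambda>m. N (?R' m \<omega>) \<omega>) \<longlonglongrightarrow> ?Y \<omega>"
    proof (rule AE_I2)
      fix \<omega> assume w: "\<omega> \<in> space P"
      show "(\<lambda>m. N (?R' m \<omega>) \<omega>) \<longlonglongrightarrow> ?Y \<omega>"
      proof (cases "\<omega> \<in> E")
        case True
        then have "eventually (\<lambda>m. N (Q m \<omega>) \<omega> = N (max (Q m \<omega>) r) \<omega>) sequentially"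
          using lim[OF w] ET[OF True] by (auto elim!: allE[of _ r] eventually_mono)
        then show ?thesis using lim[OF w] True by (auto intro: Lim_transform_eventually)
      next
        case False then show ?thesis using final[OF order.refl w] by simp
      qed
    qed
  qed
  then have "(LINT \<omega>:E|P. ?Y \<omega>) = (LINT \<omega>:E|P. \<xi> \<omega>)"
    unfolding eq using LIMSEQ_unique tendsto_const by blast
  moreover have "(LINT \<omega>:E|P. ?Y \<omega>) = (LINT \<omega>:E|P. value_before T D \<omega>)"
    unfolding set_lebesgue_integral_def by (rule Bochner_Integration.integral_cong) auto
  ultimately show "(LINT \<omega>:E|P. value_before T D \<omega>) = (LINT \<omega>:E|P. \<xi> \<omega>)" by simp
qed

text \<open>The distribution of the graph of \<open>T\<close> is a finite measure on the predictable \<open>\<sigma>\<close>-algebra. Inner regularity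
  gives sets \<open>K\<^sub>j \<subseteq> \<Gamma>\<close> missing mass at most \<open>2\<^bsup>-j-1\<^esup>\<close>, and by Borel--Cantelli almost every \<open>\<omega>\<close> is eventually
  on the correct side.\<close>
lemma value_before_predictable:
  assumes T: "\<And>s. 0 \<le> s \<Longrightarrow> {\<omega>\<in>space P. T \<omega> \<le> s} \<in> sets (F s)"
    and nonneg: "\<And>\<omega>. \<omega> \<in> space P \<Longrightarrow> 0 \<le> T \<omega>" and meas: "T \<in> borel_measurable P"
    and \<Gamma>: "\<Gamma> \<in> sets (predictable_sigma F)"
    and graph: "\<And>t \<omega>. (t, \<omega>) \<in> \<Gamma> \<Longrightarrow> \<omega> \<in> space P \<Longrightarrow> t = T \<omega> \<and> 0 < t"
    and n: "0 \<le> n"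
  defines "D \<equiv> {\<omega>\<in>space P. (T \<omega>, \<omega>) \<in> \<Gamma>}"
  assumes V: "value_before T D \<in> borel_measurable P"
  shows "tails_dominated P \<xi> (value_before T D)"
    and "\<And>r E. 0 \<le> r \<Longrightarrow> E \<in> sets (F r) \<Longrightarrow> (\<And>\<omega>. \<omega> \<in> E \<Longrightarrow> r \<le> T \<omega>) \<Longrightarrow>
      (\<And>\<omega>. \<omega> \<in> E \<Longrightarrow> \<omega> \<in> D \<Longrightarrow> r < T \<omega>) \<Longrightarrow>
      (LINT \<omega>:E|P. value_before T D \<omega>) = (LINT \<omega>:E|P. \<xi> \<omega>)"
proof -
  note meas [measurable]
  have graph_meas: "(\<lambda>\<omega>. (T \<omega>, \<omega>)) \<in> measurable P (predictable_sigma F)"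
  proof (rule measurable_predictable)
    fix B assume "B \<in> sets (F 0)"
    then have "B \<in> sets P" by (rule sets_F_subset)
    then have "{\<omega>\<in>space P. T \<omega> = 0} \<inter> B \<in> sets P" by measurable
    also have "{\<omega>\<in>space P. T \<omega> = 0} \<inter> B = (\<lambda>\<omega>. (T \<omega>, \<omega>)) -` ({0} \<times> B) \<inter> space P" by auto
    finally show "(\<lambda>\<omega>. (T \<omega>, \<omega>)) -` ({0} \<times> B) \<inter> space P \<in> sets P" .
  next
    fix s t B assume "B \<in> sets (F s)"
    then have "B \<in> sets P" by (rule sets_F_subset)
    then have "{\<omega>\<in>space P. s < T \<omega> \<and> T \<omega> \<le> t} \<inter> B \<in> sets P" by measurable
    also have "{\<omega>\<in>space P. s < T \<omega> \<and> T \<omega> \<le> t} \<inter> B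
      = (\<lambda>\<omega>. (T \<omega>, \<omega>)) -` ({s<..t} \<times> B) \<inter> space P" by auto
    finally show "(\<lambda>\<omega>. (T \<omega>, \<omega>)) -` ({s<..t} \<times> B) \<inter> space P \<in> sets P" .
  qed (use nonneg in auto)
  define \<mu> where "\<mu> = distr P (predictable_sigma F) (\<lambda>\<omega>. (T \<omega>, \<omega>))"
  have \<mu>: "finite_measure \<mu>" "sets \<mu> = sets (predictable_sigma F)"
    unfolding \<mu>_def by (auto intro: finite_measure_distr graph_meas)
  have "\<exists>K\<in>elementary_delta. K \<subseteq> \<Gamma> \<and> measure \<mu> (\<Gamma> \<inter> ({0<..} \<times> space P) - K) < (1/2) ^ Suc j" for j
    using predictable_inner_regular[OF \<mu> \<Gamma>] unfolding inner_regular_for_def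
    by (elim allE[of _ "(1/2) ^ Suc j"] impE) simp_all
  then obtain K where K: "\<And>j. K j \<in> elementary_delta" "\<And>j. K j \<subseteq> \<Gamma>"
      "\<And>j. measure \<mu> (\<Gamma> \<inter> ({0<..} \<times> space P) - K j) < (1/2) ^ Suc j" by metis
  define Dj where "Dj j = {\<omega>\<in>space P. (T \<omega>, \<omega>) \<in> K j}" for j
  have graphK: "t = T \<omega>" if "(t, \<omega>) \<in> K j" "\<omega> \<in> space P" for t \<omega> j
    using graph K(2) that by blast
  note delta = value_before_delta[OF T nonneg meas K(1) graphK n, folded Dj_def]
  have D_eq: "D - Dj j = (\<lambda>\<omega>. (T \<omega>, \<omega>)) -` (\<Gamma> \<inter> ({0<..} \<times> space P) - K j) \<inter> space P" for j
    using graph by (auto simp: D_def Dj_def)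
  have set: "\<Gamma> \<inter> ({0<..} \<times> space P) - K j \<in> sets (predictable_sigma F)" for j
    using \<Gamma> predictable_Ioi[of 0 "space P"] sets.top[of "F 0"] elementary_delta_predictable[OF K(1)[of j]] by auto
  have DDj: "D - Dj j \<in> sets P" for j unfolding D_eq by (rule measurable_sets[OF graph_meas set])
  have small: "measure P (D - Dj j) < (1/2) ^ Suc j" for j
    using K(3)[of j] unfolding \<mu>_def measure_distr[OF graph_meas set] D_eq by simp
  have "AE \<omega> in P. eventually (\<lambda>j. \<omega> \<in> space P - (D - Dj j)) sequentially"
  proof (rule borel_cantelli_AE1[OF DDj])
    show "emeasure P (D - Dj j) < \<infinity>" for j by (simp add: emeasure_eq_measure)
    show "summable (\<lambda>j. measure P (D - Dj j))"
      by (rule summable_comparison_test'[OF sums_summable[OF power_half_series], of 0])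
         (use small in \<open>auto intro: less_imp_le\<close>)
  qed
  then have lim: "AE \<omega> in P. (\<lambda>j. value_before T (Dj j) \<omega>) \<longlonglongrightarrow> value_before T D \<omega>"
  proof eventually_elim
    case (elim \<omega>)
    have sub: "Dj j \<subseteq> D" for j using K(2) by (auto simp: D_def Dj_def)
    have "eventually (\<lambda>j. value_before T (Dj j) \<omega> = value_before T D \<omega>) sequentially"
      by (rule eventually_mono[OF elim]) (use sub in \<open>auto simp: value_before_def\<close>)
    then show ?case by (rule tendsto_eventually)
  qed
  show "tails_dominated P \<xi> (value_before T D)"
    by (rule tails_dominated_limit[OF integrable_final delta(1) V lim])
  fix r E assume E: "0 \<le> r" "E \<in> sets (F r)" "\<And>\<omega>. \<omega> \<in> E \<Longrightarrow> r \<le> T \<omega>"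
    "\<And>\<omega>. \<omega> \<in> E \<Longrightarrow> \<omega> \<in> D \<Longrightarrow> r < T \<omega>"
  have eq: "(LINT \<omega>:E|P. value_before T (Dj j) \<omega>) = (LINT \<omega>:E|P. \<xi> \<omega>)" for j
    by (rule delta(2)[where r = r and E = E]) (use E K(2) in \<open>auto simp: D_def Dj_def\<close>)
  have "(\<lambda>j. LINT \<omega>:E|P. value_before T (Dj j) \<omega>) \<longlonglongrightarrow> (LINT \<omega>:E|P. value_before T D \<omega>)"
    by (rule tails_dominated_set_integral_limit[OF integrable_final delta(1) V lim sets_F_subset[OF E(2)]])
  then show "(LINT \<omega>:E|P. value_before T D \<omega>) = (LINT \<omega>:E|P. \<xi> \<omega>)"
    unfolding eq by (rule LIMSEQ_unique[OF _ tendsto_const])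
qed

end

section \<open>Time-changed paths as limits along rational grids\<close>

context clock
begin

text \<open>This expression involves \<open>f\<close> only at times \<open>r\<close> with \<open>a r \<le> v\<close>, that is, after they have been revealed on the
  new time scale. In a gap the two conditions on \<open>r\<close> say \<open>r < C v \<le> r + 1/(k+1)\<close>.\<close>
definition grid_limsup :: "(real \<Rightarrow> real) \<Rightarrow> real \<Rightarrow> ereal" where
  "grid_limsup f v = (INF k::nat. SUP r\<in>\<rat> \<inter> {0..}.
     if a r \<le> v \<and> v < a (r + 1 / real (Suc k)) then ereal (f r) else - \<infinity>)"

lemma grid_limsup_gap:
  assumes v: "0 \<le> v" "v < a (C v)"
  shows "grid_limsup f v = left_limsup f (C v)"
proof -
  let ?t = "C v"
  let ?S = "\<lambda>k. SUP r\<in>\<rat> \<inter> {0..}. if r < ?t \<and> ?t \<le> r + 1 / real (Suc k) then ereal (f r) else - \<infinity>"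
  let ?L = "\<lambda>e. SUP y\<in>{..<?t} \<inter> \<rat> \<inter> ball ?t e - {?t}. ereal (f y)"
  have t: "0 < ?t" using pos_of_gap[OF v(1)] v(2) by auto
  have before: "a r \<le> v \<longleftrightarrow> r < ?t" if "0 \<le> r" for r
    using less_C_iff[of r v] less_iff[OF C_nonneg[of v] that] le_iff[OF C_nonneg[of v] that] that v(2)
    by (smt (verit))
  have after: "v < a r \<longleftrightarrow> ?t \<le> r" if "0 \<le> r" for r using before[OF that] by auto
  have eq: "grid_limsup f v = (INF k. ?S k)"
    unfolding grid_limsup_def by (intro INF_cong SUP_cong refl) (use before after in auto)
  show ?thesis
    unfolding eq left_limsup_def Limsup_within
  proof (rule antisym)
    show "(INF k. ?S k) \<le> (INF e\<in>{0<..}. ?L e)"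
    proof (rule INF_greatest)
      fix e :: real assume "e \<in> {0<..}"
      then have "0 < e" by simp
      then obtain k :: nat where k: "1 / real (Suc k) < e" by (rule nat_approx_posE)
      have "?S k \<le> ?L e"
      proof (rule SUP_least)
        fix r :: real assume "r \<in> \<rat> \<inter> {0..}"
        then show "(if r < ?t \<and> ?t \<le> r + 1 / real (Suc k) then ereal (f r) else - \<infinity>) \<le> ?L e"
          using k by (auto intro!: SUP_upper2[of r] simp: dist_real_def)
      qed
      then show "(INF k. ?S k) \<le> ?L e" by (rule INF_lower2[of k, rotated]) simp
    qed
    show "(INF e\<in>{0<..}. ?L e) \<le> (INF k. ?S k)"
    proof (rule INF_greatest)
      fix k :: nat
      define e where "e = min ?t (1 / real (Suc k))"
      have e: "0 < e" "e \<le> ?t" "e \<le> 1 / real (Suc k)" using t by (auto simp: e_def)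
      have "?L e \<le> ?S k"
      proof (rule SUP_least)
        fix y assume "y \<in> {..<?t} \<inter> \<rat> \<inter> ball ?t e - {?t}"
        then have y: "y < ?t" "y \<in> \<rat>" "?t - e < y" by (auto simp: dist_real_def)
        then show "ereal (f y) \<le> ?S k"
          using e by (intro SUP_upper2[of y]) (simp_all del: of_nat_Suc)
      qed
      then show "(INF e\<in>{0<..}. ?L e) \<le> ?S k" by (rule INF_lower2[of e, rotated]) (use e in simp)
    qed
  qed
qed

lemma grid_limsup_near:
  assumes u: "a (C u) = u" and v: "u < v" "C v < b"
    and f: "\<And>s. C u < s \<Longrightarrow> s < b \<Longrightarrow> l \<le> f s \<and> f s \<le> h"
  shows "ereal l \<le> grid_limsup f v \<and> grid_limsup f v \<le> ereal h"
proof
  have lt: "C u < C v" using less_C_iff[OF C_nonneg, of u v] u v by simp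
  show "ereal l \<le> grid_limsup f v"
    unfolding grid_limsup_def
  proof (rule INF_greatest)
    fix k :: nat
    have "max (C u) (C v - 1 / real (Suc k)) < C v" using lt by simp
    from Rats_dense_in_real[OF this] obtain r
      where r: "r \<in> \<rat>" "C u < r" "C v - 1 / real (Suc k) < r" "r < C v" by auto
    have r0: "0 \<le> r" using r(2) C_nonneg[of u] by simp
    have "a r < v" using less_C_iff[OF r0] r(4) by simp
    moreover have "v < a (r + 1 / real (Suc k))"
      using less_iff[OF C_nonneg[of v], of "r + 1 / real (Suc k)"] le_clock_C[of v] r0 r(3)
      by (smt (verit) divide_nonneg_nonneg of_nat_0_le_iff)
    ultimately show "ereal l \<le> (SUP r\<in>\<rat> \<inter> {0..}.
        if a r \<le> v \<and> v < a (r + 1 / real (Suc k)) then ereal (f r) else - \<infinity>)"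
      using f[of r] r r0 v by (intro SUP_upper2[of r]) auto
  qed
  have "0 < C v - C u" using lt by simp
  then obtain k :: nat where k: "1 / real (Suc k) < C v - C u" by (rule nat_approx_posE)
  show "grid_limsup f v \<le> ereal h"
    unfolding grid_limsup_def
  proof (rule INF_lower2[of k], simp, rule SUP_least)
    fix r :: real assume "r \<in> \<rat> \<inter> {0..}"
    then have r0: "0 \<le> r" by simp
    show "(if a r \<le> v \<and> v < a (r + 1 / real (Suc k)) then ereal (f r) else - \<infinity>) \<le> ereal h"
    proof (cases "a r \<le> v \<and> v < a (r + 1 / real (Suc k))")
      case True
      have "r \<le> C v" using C_mono[of "a r" v] True r0 by simp
      moreover have "C v \<le> r + 1 / real (Suc k)"
        using C_le_iff[of "r + 1 / real (Suc k)" v] True r0 by simp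
      ultimately show ?thesis using f[of r] k v True by (simp del: of_nat_Suc)
    next
      case False
      then show ?thesis by (subst if_not_P) auto
    qed
  qed
qed

text \<open>The levels \<open>u + 1/(k+1)\<close> are strictly above \<open>u\<close>. In a gap they eventually lie in the same gap. Otherwise
  \<open>C\<close> moves strictly to the right of \<open>C u\<close>, where \<open>f\<close> is close to \<open>f (C u)\<close>; a grid at level \<open>u\<close> itself
  could miss the value at \<open>C u\<close>.\<close>
lemma grid_limsup_tendsto:
  assumes f: "right_cont_path f" and u: "0 \<le> u"
  shows "(\<lambda>k. let x = grid_limsup f (u + 1 / real (Suc k)) in if \<bar>x\<bar> = \<infinity> then f 0 else real_of_ereal x)
    \<longlonglongrightarrow> time_change a f u" (is "?g \<longlonglongrightarrow> _")
proof -
  have lim: "(\<lambda>k. u + 1 / real (Suc k)) \<longlonglongrightarrow> u"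
    using tendsto_add[OF tendsto_const LIMSEQ_inverse_real_of_nat] by (simp add: inverse_eq_divide)
  show ?thesis
  proof (cases "a (C u) = u")
    case False
    then have lt: "u < a (C u)" using le_clock_C[of u] by simp
    have "eventually (\<lambda>k. u + 1 / real (Suc k) < a (C u)) sequentially"
      using lim lt by (rule order_tendstoD(2))
    then have "eventually (\<lambda>k. ?g k = time_change a f u) sequentially"
    proof eventually_elim
      case (elim k)
      have *: "u \<le> u + 1 / real (Suc k)" by simp
      have "C (u + 1 / real (Suc k)) = C u"
        using C_mono[OF *] C_le_iff[OF C_nonneg[of u], of "u + 1 / real (Suc k)"] elim by simp
      then show ?case
        using grid_limsup_gap[of "u + 1 / real (Suc k)" f] elim u False
        by (simp add: time_change_def pre_value_def del: of_nat_Suc)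
    qed
    then show ?thesis by (rule tendsto_eventually)
  next
    case True
    let ?t = "C u"
    show ?thesis
    proof (rule tendstoI)
      fix e :: real assume e: "0 < e"
      obtain b where b: "?t < b" and near: "\<And>y. ?t < y \<Longrightarrow> y < b \<Longrightarrow> f ?t - e/2 \<le> f y \<and> f y \<le> f ?t + e/2"
        using right_cont_near[OF f C_nonneg, of "e/2" u] e by auto
      have ub: "u < a ((?t + b)/2)"
        using less_iff[of ?t "(?t+b)/2"] b C_nonneg[of u] True by auto
      have "eventually (\<lambda>k. u + 1 / real (Suc k) < a ((?t + b)/2)) sequentially"
        using lim ub by (rule order_tendstoD(2))
      then show "eventually (\<lambda>k. dist (?g k) (time_change a f u) < e) sequentially"
      proof eventually_elim
        case (elim k)
        let ?v = "u + 1 / real (Suc k)"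
        have "C ?v \<le> (?t + b)/2"
          using C_le_iff[of "(?t+b)/2" ?v] elim b C_nonneg[of u] by simp
        then have "ereal (f ?t - e/2) \<le> grid_limsup f ?v \<and> grid_limsup f ?v \<le> ereal (f ?t + e/2)"
          using b by (intro grid_limsup_near[where b = b and u = u] True near) auto
        moreover have "time_change a f u = f ?t" using True by (simp add: time_change_def)
        ultimately show ?case
          using e by (cases "grid_limsup f ?v") (auto simp: dist_real_def)
      qed
    qed
  qed
qed

end

section \<open>Predictable processes\<close>

context filtered
begin

lemma slice_measurable:
  assumes "0 \<le> t"
  shows "(\<lambda>\<omega>. (t, \<omega>)) \<in> measurable (F t) (predictable_sigma F)"
proof (rule measurable_predictable)
  fix B assume B: "B \<in> sets (F 0)"
  have "(\<lambda>\<omega>. (t, \<omega>)) -` ({0} \<times> B) \<inter> space (F t) = (if t = 0 then B else {})"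
    using sets.sets_into_space[OF B] by auto
  then show "(\<lambda>\<omega>. (t, \<omega>)) -` ({0} \<times> B) \<inter> space (F t) \<in> sets (F t)" using B by auto
next
  fix s r B assume B: "B \<in> sets (F s)"
  have "(\<lambda>\<omega>. (t, \<omega>)) -` ({s<..r} \<times> B) \<inter> space (F t) = (if s < t \<and> t \<le> r then B else {})"
    using sets.sets_into_space[OF B] by auto
  then show "(\<lambda>\<omega>. (t, \<omega>)) -` ({s<..r} \<times> B) \<inter> space (F t) \<in> sets (F t)"
    using F_mono[OF _ B, of t] by auto
qed (use assms in auto)

lemma predictable_imp_adapted: "predictable F Y \<Longrightarrow> adapted F Y"
  unfolding predictable_def adapted_def
  by (intro allI impI) (use measurable_compose[OF slice_measurable, of _ "\<lambda>(t, \<omega>). Y t \<omega>" borel] in simp)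

lemma predictable_time: "(\<lambda>(t, \<omega>). t) \<in> borel_measurable (predictable_sigma F)"
proof (rule borel_measurable_iff_greater[THEN iffD2], rule allI)
  fix c :: real
  have top: "space P \<in> sets (F s)" for s using sets.top[of "F s"] by simp
  have "{w \<in> space (predictable_sigma F). c < (case w of (t, \<omega>) \<Rightarrow> t)} =
    (if c < 0 then space (predictable_sigma F) else {c<..} \<times> space P)" by auto
  then show "{w \<in> space (predictable_sigma F). c < (case w of (t, \<omega>) \<Rightarrow> t)} \<in> sets (predictable_sigma F)"
    using predictable_Ioi[OF _ top, of c] sets.top[of "predictable_sigma F"]
    by (simp del: space_predictable)
qed

text \<open>For a non-decreasing process the left limit at \<open>t\<close> exceeds \<open>c\<close> iff the process does so at some rational time
  before \<open>t\<close>.\<close>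
lemma predictable_pre_value:
  assumes H: "adapted F H" and mono: "\<And>\<omega>. \<omega> \<in> space P \<Longrightarrow> mono_on {0..} (\<lambda>t. H t \<omega>)"
  shows "(\<lambda>(t, \<omega>). if t = 0 then 0 else pre_value (\<lambda>t. H t \<omega>) t) \<in> borel_measurable (predictable_sigma F)"
proof (rule borel_measurable_iff_greater[THEN iffD2], rule allI)
  fix c :: real
  have iff: "c < pre_value (\<lambda>t. H t \<omega>) t \<longleftrightarrow> (\<exists>q\<in>\<rat> \<inter> {0..}. q < t \<and> c < H q \<omega>)"
    if w: "\<omega> \<in> space P" and t: "0 < t" for t \<omega>
  proof
    assume c: "c < pre_value (\<lambda>t. H t \<omega>) t"
    show "\<exists>q\<in>\<rat> \<inter> {0..}. q < t \<and> c < H q \<omega>"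
    proof (rule ccontr)
      assume "\<not> (\<exists>q\<in>\<rat> \<inter> {0..}. q < t \<and> c < H q \<omega>)"
      then have le: "H q \<omega> \<le> c" if "q \<in> \<rat>" "0 < q" "q < t" for q
        using that by (auto simp: not_less[symmetric])
      have "pre_value (\<lambda>t. H t \<omega>) t \<le> c"
        using t mono_onD[OF mono[OF w], of 0] le
        by (intro pre_value_bounds(2)[of 0 t "H 0 \<omega>" "\<lambda>t. H t \<omega>" c]) auto
      then show False using c by simp
    qed
  next
    assume "\<exists>q\<in>\<rat> \<inter> {0..}. q < t \<and> c < H q \<omega>"
    then obtain q where q: "0 \<le> q" "q < t" "c < H q \<omega>" by auto
    have "H q \<omega> \<le> pre_value (\<lambda>t. H t \<omega>) t"
      by (rule pre_value_bounds(1)[of q t "H q \<omega>" "\<lambda>t. H t \<omega>" "H t \<omega>"])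
         (use q in \<open>auto intro!: mono_onD[OF mono[OF w]]\<close>)
    then show "c < pre_value (\<lambda>t. H t \<omega>) t" using q by simp
  qed
  have meas: "{\<omega>\<in>space P. c < H q \<omega>} \<in> sets (F q)" if "0 \<le> q" for q
  proof -
    have "H q \<in> borel_measurable (F q)" using H that by (simp add: adapted_def)
    then have "{\<omega>\<in>space (F q). c < H q \<omega>} \<in> sets (F q)" by measurable
    then show ?thesis by simp
  qed
  have "{w \<in> space (predictable_sigma F). c < (case w of (t, \<omega>) \<Rightarrow> if t = 0 then 0 else pre_value (\<lambda>t. H t \<omega>) t)}
    = (if c < 0 then {0} \<times> space P else {}) \<union> (\<Union>q\<in>\<rat> \<inter> {0..}. {q<..} \<times> {\<omega>\<in>space P. c < H q \<omega>})"
    (is "?L = ?R")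
  proof (intro equalityI subsetI)
    fix w assume w: "w \<in> ?L"
    obtain t \<omega> where [simp]: "w = (t, \<omega>)" by (cases w)
    show "w \<in> ?R" using w iff[of \<omega> t] by (cases "t = 0") auto
  next
    fix w assume w: "w \<in> ?R"
    obtain t \<omega> where [simp]: "w = (t, \<omega>)" by (cases w)
    show "w \<in> ?L"
    proof (cases "t = 0")
      case False
      then have "\<omega> \<in> space P" "0 < t" "\<exists>q\<in>\<rat> \<inter> {0..}. q < t \<and> c < H q \<omega>"
        using w by (auto split: if_splits)
      then show ?thesis using iff[of \<omega> t] by auto
    qed (use w in \<open>auto split: if_splits\<close>)
  qed
  moreover have "?R \<in> sets (predictable_sigma F)"
    using predictable_zero[of "space P"] sets.top[of "F 0"] predictable_Ioi[OF _ meas] countable_rat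
    by (intro sets.Un sets.countable_UN') auto
  ultimately show "?L \<in> sets (predictable_sigma F)" by simp
qed

end

section \<open>The time-changed filtration\<close>

locale clocked = filtered +
  fixes A :: "real \<Rightarrow> 'a \<Rightarrow> real"
  assumes usual: "usual_conditions P F"
    and A_predictable: "predictable F A"
    and A_clock: "\<And>\<omega>. \<omega> \<in> space P \<Longrightarrow> clock (\<lambda>t. A t \<omega>)"
begin

abbreviation inv_A :: "real \<Rightarrow> 'a \<Rightarrow> real" where
  "inv_A u \<omega> \<equiv> clock_inv (\<lambda>t. A t \<omega>) u"

definition changed :: "(real \<Rightarrow> 'a \<Rightarrow> real) \<Rightarrow> real \<Rightarrow> 'a \<Rightarrow> real" where
  "changed Y u \<omega> = time_change (\<lambda>t. A t \<omega>) (\<lambda>t. Y t \<omega>) u"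

text \<open>An event \<open>B\<close> known at the old time \<open>r\<close> becomes known at the new time \<open>A r\<close>.\<close>
definition revealed :: "real \<Rightarrow> 'a set set" where
  "revealed v = {B \<inter> {\<omega>\<in>space P. A r \<omega> \<le> w} | B r w. 0 \<le> r \<and> B \<in> sets (F r) \<and> w \<le> v}"

definition G :: "real \<Rightarrow> 'a measure" where
  "G v = sigma (space P) (revealed v)"

text \<open>Passing to the intersection over \<open>v > u\<close> is needed for the right-continuity of the filtration and, at a
  value \<open>u\<close> of the clock, for the adaptedness of the time-changed processes.\<close>
definition changed_filtration :: "real \<Rightarrow> 'a measure" where
  "changed_filtration u = sigma (space P) (\<Inter>v\<in>{u<..}. sets (G v))"

abbreviation "F' \<equiv> changed_filtration"

lemma A_adapted: "0 \<le> r \<Longrightarrow> A r \<in> borel_measurable (F r)"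
  using predictable_imp_adapted[OF A_predictable] by (simp add: adapted_def)

lemma A_sets: "0 \<le> r \<Longrightarrow> {\<omega>\<in>space P. A r \<omega> \<le> w} \<in> sets (F r)"
  "0 \<le> r \<Longrightarrow> {\<omega>\<in>space P. w \<le> A r \<omega>} \<in> sets (F r)"
  using borel_measurable_le[OF A_adapted borel_measurable_const, of r w]
    borel_measurable_le[OF borel_measurable_const A_adapted, of r w] by simp_all

lemma revealed_subset: "revealed v \<subseteq> Pow (space P)"
  unfolding revealed_def by auto

lemma space_G [simp]: "space (G v) = space P"
  unfolding G_def using revealed_subset by (simp add: space_measure_of)

lemma sets_G: "sets (G v) = sigma_sets (space P) (revealed v)"
  unfolding G_def using revealed_subset by simp

lemma revealed_G: "0 \<le> r \<Longrightarrow> B \<in> sets (F r) \<Longrightarrow> w \<le> v \<Longrightarrow> B \<inter> {\<omega>\<in>space P. A r \<omega> \<le> w} \<in> sets (G v)"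
  unfolding sets_G revealed_def by (intro sigma_sets.Basic) blast

lemma G_mono: "v \<le> w \<Longrightarrow> sets (G v) \<subseteq> sets (G w)"
  unfolding sets_G by (rule sigma_sets_mono') (auto simp: revealed_def intro: order_trans)

lemma G_subset: "sets (G v) \<subseteq> sets P"
  unfolding sets_G
proof (rule sets.sigma_sets_subset)
  show "revealed v \<subseteq> sets P" unfolding revealed_def
  proof safe
    fix B r and w :: real assume "0 \<le> r" "B \<in> sets (F r)"
    then have "B \<inter> {\<omega>\<in>space P. A r \<omega> \<le> w} \<in> sets (F r)" by (intro sets.Int A_sets)
    then show "B \<inter> {\<omega>\<in>space P. A r \<omega> \<le> w} \<in> sets P" by (rule sets_F_subset)
  qed
qed

lemma F0_subset_G: "B \<in> sets (F 0) \<Longrightarrow> 0 \<le> v \<Longrightarrow> B \<in> sets (G v)"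
proof -
  assume B: "B \<in> sets (F 0)" and v: "0 \<le> v"
  have "A 0 \<omega> = 0" if "\<omega> \<in> space P" for \<omega> using clock.zero[OF A_clock[OF that]] .
  then have "B \<inter> {\<omega>\<in>space P. A 0 \<omega> \<le> 0} = B" using sets.sets_into_space[OF B] by auto
  then show "B \<in> sets (G v)" using revealed_G[of 0 B 0 v] B v by simp
qed

lemma space_changed_filtration [simp]: "space (F' u) = space P"
  unfolding changed_filtration_def
  by (rule space_measure_of) (use sets.sets_into_space[of _ "G (u + 1)"] in force)

lemma sets_changed_filtration: "sets (F' u) = (\<Inter>v\<in>{u<..}. sets (G v))"
proof -
  have sub: "(\<Inter>v\<in>{u<..}. sets (G v)) \<subseteq> Pow (space P)"
    using sets.sets_into_space[of _ "G (u + 1)"] by force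
  have "sigma_sets (space P) (\<Inter>v\<in>{u<..}. sets (G v)) \<subseteq> sets (G v)" if "u < v" for v
    using sets.sigma_sets_subset[of "\<Inter>v\<in>{u<..}. sets (G v)" "G v"] that by auto
  then show ?thesis unfolding changed_filtration_def sets_measure_of[OF sub]
    by (intro equalityI) (auto intro: sigma_sets.Basic)
qed

lemma filtered_changed: "filtered_prob_space P F'"
  unfolding filtered_prob_space_def
proof (intro conjI allI impI prob_space_axioms)
  show "filtration (space P) F'"
    by unfold_locales (auto simp: sets_changed_filtration)
  show "subalgebra P (F' t)" for t
    using G_subset[of "t + 1"] by (auto simp: subalgebra_def sets_changed_filtration)
qed

lemma usual_changed: "usual_conditions P F'"
  unfolding usual_conditions_def
proof (intro conjI allI impI)
  show "complete_measure P" using usual by (simp add: usual_conditions_def)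
  show "null_sets P \<subseteq> sets (F' 0)"
    using usual F0_subset_G by (auto simp: usual_conditions_def sets_changed_filtration)
  fix t :: real
  show "sets (F' t) = (\<Inter>u\<in>{t<..}. sets (F' u))"
    unfolding sets_changed_filtration
  proof (intro equalityI subsetI)
    fix B assume B: "B \<in> (\<Inter>u\<in>{t<..}. \<Inter>v\<in>{u<..}. sets (G v))"
    have "B \<in> sets (G v)" if "t < v" for v
    proof -
      obtain u where "t < u" "u < v" using dense[OF \<open>t < v\<close>] by blast
      then show ?thesis using B by blast
    qed
    then show "B \<in> (\<Inter>v\<in>{t<..}. sets (G v))" by simp
  qed (auto intro: less_trans)
qed

sublocale changed: filtered P F'
  by unfold_locales (rule filtered_changed)

lemma measurable_changed_limit:
  fixes f :: "'a \<Rightarrow> real"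
  assumes fk: "\<And>k. fk k \<in> borel_measurable (G (u + 1 / real (Suc k)))"
    and lim: "\<And>\<omega>. \<omega> \<in> space P \<Longrightarrow> (\<lambda>k. fk k \<omega>) \<longlonglongrightarrow> f \<omega>"
  shows "f \<in> borel_measurable (F' u)"
proof -
  have "f \<in> borel_measurable (G v)" if v: "u < v" for v
  proof -
    have "0 < v - u" using v by simp
    then obtain k0 :: nat where k0: "1 / real (Suc k0) < v - u" by (rule nat_approx_posE)
    have "fk (k + k0) \<in> borel_measurable (G v)" for k
    proof -
      have "1 / real (Suc (k + k0)) \<le> 1 / real (Suc k0)" by (intro divide_left_mono) auto
      then have "u + 1 / real (Suc (k + k0)) \<le> v" using k0 by linarith
      then have "sets (G (u + 1 / real (Suc (k + k0)))) \<subseteq> sets (G v)" by (rule G_mono)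
      then show ?thesis using fk[of "k + k0"] by (auto simp: measurable_def)
    qed
    then show ?thesis
      by (rule borel_measurable_LIMSEQ_real[rotated]) (use lim in \<open>auto intro: LIMSEQ_ignore_initial_segment\<close>)
  qed
  then show ?thesis unfolding measurable_def sets_changed_filtration by auto
qed

lemma changed_adapted:
  assumes Y: "adapted F Y" and rc: "\<And>\<omega>. \<omega> \<in> space P \<Longrightarrow> right_cont_path (\<lambda>t. Y t \<omega>)"
  shows "adapted F' (changed Y)"
  unfolding adapted_def
proof (intro allI impI)
  fix u :: real assume u: "0 \<le> u"
  define g where "g v \<omega> = clock.grid_limsup (\<lambda>t. A t \<omega>) (\<lambda>t. Y t \<omega>) v" for v \<omega>
  have single: "(\<lambda>\<omega>. if A r \<omega> \<le> v \<and> v < A s \<omega> then ereal (Y r \<omega>) else - \<infinity>) \<in> borel_measurable (G v)"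
    if r: "0 \<le> r" "0 \<le> s" for r s v
  proof (rule borel_measurable_ereal_iff_Ioi[THEN iffD2], rule allI)
    fix c :: ereal
    have Yr: "Y r \<in> borel_measurable (F r)" using Y r by (simp add: adapted_def)
    then have "{\<omega>\<in>space (F r). c < ereal (Y r \<omega>)} \<in> sets (F r)" by measurable
    then have "{\<omega>\<in>space P. c < ereal (Y r \<omega>)} \<inter> {\<omega>\<in>space P. A r \<omega> \<le> v} \<in> sets (G v)"
      using revealed_G[OF r(1), of _ v v] by simp
    moreover have "space P \<inter> {\<omega>\<in>space P. A s \<omega> \<le> v} \<in> sets (G v)"
      using revealed_G[OF r(2), of "space P" v v] sets.top[of "F s"] by simp
    ultimately have "({\<omega>\<in>space P. c < ereal (Y r \<omega>)} \<inter> {\<omega>\<in>space P. A r \<omega> \<le> v})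
      - (space P \<inter> {\<omega>\<in>space P. A s \<omega> \<le> v}) \<in> sets (G v)" by (rule sets.Diff)
    also have "({\<omega>\<in>space P. c < ereal (Y r \<omega>)} \<inter> {\<omega>\<in>space P. A r \<omega> \<le> v})
      - (space P \<inter> {\<omega>\<in>space P. A s \<omega> \<le> v})
      = (\<lambda>\<omega>. if A r \<omega> \<le> v \<and> v < A s \<omega> then ereal (Y r \<omega>) else - \<infinity>) -` {c<..} \<inter> space (G v)"
      by (auto split: if_splits)
    finally show "(\<lambda>\<omega>. if A r \<omega> \<le> v \<and> v < A s \<omega> then ereal (Y r \<omega>) else - \<infinity>) -` {c<..} \<inter> space (G v)
      \<in> sets (G v)" .
  qed
  have g_meas: "g v \<in> borel_measurable (G v)" for v
  proof -
    have eq: "g v \<omega> = (INF k::nat. SUP r\<in>\<rat> \<inter> {0..}.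
      if A r \<omega> \<le> v \<and> v < A (r + 1 / real (Suc k)) \<omega> then ereal (Y r \<omega>) else - \<infinity>)"
      if "\<omega> \<in> space (G v)" for \<omega>
      using clock.grid_limsup_def[OF A_clock, of \<omega>] that by (simp add: g_def)
    have "(\<lambda>\<omega>. INF k::nat. SUP r\<in>\<rat> \<inter> {0..}.
      if A r \<omega> \<le> v \<and> v < A (r + 1 / real (Suc k)) \<omega> then ereal (Y r \<omega>) else - \<infinity>) \<in> borel_measurable (G v)"
      by (intro borel_measurable_INF borel_measurable_SUP single) (auto simp: countable_rat)
    then show ?thesis by (subst measurable_cong[OF eq])
  qed
  have Y0: "Y 0 \<in> borel_measurable (G v)" if "0 \<le> v" for v
  proof -
    have "Y 0 \<in> borel_measurable (F 0)" using Y by (simp add: adapted_def)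
    then show ?thesis by (auto simp: measurable_def intro: F0_subset_G[OF _ that])
  qed
  show "changed Y u \<in> borel_measurable (F' u)"
  proof (rule measurable_changed_limit[where fk = "\<lambda>k \<omega>. let x = g (u + 1 / real (Suc k)) \<omega> in
        if \<bar>x\<bar> = \<infinity> then Y 0 \<omega> else real_of_ereal x"])
    show "(\<lambda>\<omega>. let x = g (u + 1 / real (Suc k)) \<omega> in if \<bar>x\<bar> = \<infinity> then Y 0 \<omega> else real_of_ereal x)
      \<in> borel_measurable (G (u + 1 / real (Suc k)))" for k
    proof -
      have "0 \<le> u + 1 / real (Suc k)" using u by simp
      note [measurable] = Y0[OF this] g_meas[of "u + 1 / real (Suc k)"]
      show ?thesis unfolding Let_def by measurable
    qed
    show "(\<lambda>k. let x = g (u + 1 / real (Suc k)) \<omega> in if \<bar>x\<bar> = \<infinity> then Y 0 \<omega> else real_of_ereal x)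
      \<longlonglongrightarrow> changed Y u \<omega>" if "\<omega> \<in> space P" for \<omega>
      using clock.grid_limsup_tendsto[OF A_clock rc u, OF that that] by (simp add: g_def changed_def)
  qed
qed

text \<open>By right-continuity, \<open>A\<^sub>T \<le> u\<close> iff for every \<open>\<delta> > 0\<close> there is a rational \<open>r \<ge> T\<close> with \<open>A\<^sub>r \<le> u + \<delta>\<close>; the event
  \<open>{T \<le> r}\<close> is revealed at the new time \<open>A\<^sub>r\<close>. With constant \<open>T\<close> it follows that \<open>A\<^sub>s\<close> is a stopping time, and
  with the members of a localizing sequence one obtains a localizing sequence on the new scale.\<close>
lemma stopped_clock_sets:
  assumes T: "\<And>s. 0 \<le> s \<Longrightarrow> {\<omega>\<in>space P. T \<omega> \<le> s} \<in> sets (F s)"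
    and nonneg: "\<And>\<omega>. \<omega> \<in> space P \<Longrightarrow> 0 \<le> T \<omega>"
  shows "{\<omega>\<in>space P. A (T \<omega>) \<omega> \<le> u} \<in> sets (F' u)"
proof -
  have "{\<omega>\<in>space P. A (T \<omega>) \<omega> \<le> u} \<in> sets (G v)" if v: "u < v" for v
  proof -
    define d where "d k = (v - u) / real (Suc k)" for k :: nat
    have d: "0 < d k" "u + d k \<le> v" for k
    proof -
      show "0 < d k" using v by (simp add: d_def)
      have "(v - u) / real (Suc k) \<le> (v - u) / 1" using v by (intro divide_left_mono) auto
      then show "u + d k \<le> v" by (simp add: d_def)
    qed
    have d_lim: "d \<longlonglongrightarrow> 0"
      unfolding d_def using LIMSEQ_Suc[OF lim_const_over_n[of "v - u"]] by simp
    have "{\<omega>\<in>space P. A (T \<omega>) \<omega> \<le> u} = (\<Inter>k. \<Union>r\<in>\<rat> \<inter> {0..}.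
      {\<omega>\<in>space P. T \<omega> \<le> r} \<inter> {\<omega>\<in>space P. A r \<omega> \<le> u + d k})" (is "_ = ?R")
    proof (intro equalityI subsetI)
      fix \<omega> assume "\<omega> \<in> {\<omega>\<in>space P. A (T \<omega>) \<omega> \<le> u}"
      then have w: "\<omega> \<in> space P" and le: "A (T \<omega>) \<omega> \<le> u" by auto
      interpret clock "\<lambda>t. A t \<omega>" by (rule A_clock[OF w])
      show "\<omega> \<in> ?R"
      proof (rule INT_I)
        fix k
        obtain b where b: "T \<omega> < b"
          "\<And>t. T \<omega> < t \<Longrightarrow> t < b \<Longrightarrow> A (T \<omega>) \<omega> - d k \<le> A t \<omega> \<and> A t \<omega> \<le> A (T \<omega>) \<omega> + d k"
          by (rule right_cont_near[OF right_cont nonneg[OF w] d(1)[of k]], rule that)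
        obtain r where r: "r \<in> \<rat>" "T \<omega> < r" "r < b" using Rats_dense_in_real[OF b(1)] by blast
        have "A r \<omega> \<le> u + d k" using b(2)[OF r(2,3)] le by linarith
        then have "r \<in> \<rat> \<inter> {0..}" "\<omega> \<in> {\<omega>\<in>space P. T \<omega> \<le> r} \<inter> {\<omega>\<in>space P. A r \<omega> \<le> u + d k}"
          using w nonneg[OF w] r by simp_all
        then show "\<omega> \<in> (\<Union>r\<in>\<rat> \<inter> {0..}. {\<omega>\<in>space P. T \<omega> \<le> r} \<inter> {\<omega>\<in>space P. A r \<omega> \<le> u + d k})" by blast
      qed
    next
      fix \<omega> assume R: "\<omega> \<in> ?R"
      then have w: "\<omega> \<in> space P" by blast
      interpret clock "\<lambda>t. A t \<omega>" by (rule A_clock[OF w])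
      have "A (T \<omega>) \<omega> \<le> u + d k" for k
      proof -
        obtain r where r: "0 \<le> r" "T \<omega> \<le> r" "A r \<omega> \<le> u + d k" using R by fastforce
        then show ?thesis using le_iff[OF nonneg[OF w] r(1)] by simp
      qed
      moreover have "(\<lambda>k. u + d k) \<longlonglongrightarrow> u" using tendsto_add[OF tendsto_const d_lim] by simp
      ultimately have "A (T \<omega>) \<omega> \<le> u" by (intro LIMSEQ_le_const) auto
      then show "\<omega> \<in> {\<omega>\<in>space P. A (T \<omega>) \<omega> \<le> u}" using w by simp
    qed
    also have "\<dots> \<in> sets (G v)"
    proof -
      have "(\<Union>r\<in>\<rat> \<inter> {0..}. {\<omega>\<in>space P. T \<omega> \<le> r} \<inter> {\<omega>\<in>space P. A r \<omega> \<le> u + d k}) \<in> sets (G v)" for k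
        using revealed_G[OF _ T] d(2) countable_rat by (intro sets.countable_UN') auto
      then show ?thesis by (intro sets.countable_INT') auto
    qed
    finally show ?thesis .
  qed
  then show ?thesis by (simp add: sets_changed_filtration)
qed

lemma inv_A_sets: "0 \<le> s \<Longrightarrow> {\<omega>\<in>space P. inv_A v \<omega> \<le> s} \<in> sets (F s)"
proof -
  assume s: "0 \<le> s"
  have "{\<omega>\<in>space P. inv_A v \<omega> \<le> s} = {\<omega>\<in>space P. v \<le> A s \<omega>}"
    using clock.C_le_iff[OF A_clock s] by auto
  then show ?thesis using A_sets(2)[OF s] by simp
qed

lemma inv_A_nonneg: "\<omega> \<in> space P \<Longrightarrow> 0 \<le> inv_A v \<omega>"
  using clock.C_nonneg[OF A_clock] .

lemma inv_A_measurable: "inv_A v \<in> borel_measurable P"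
proof (rule borel_measurable_iff_le[THEN iffD2], rule allI)
  fix s :: real
  show "{\<omega>\<in>space P. inv_A v \<omega> \<le> s} \<in> sets P"
  proof (cases "0 \<le> s")
    case False
    then have "{\<omega>\<in>space P. inv_A v \<omega> \<le> s} = {}" using inv_A_nonneg[of _ v] by force
    then show ?thesis by (simp only: sets.empty_sets)
  qed (rule sets_F_subset[OF inv_A_sets])
qed

lemma after_clock_predictable:
  assumes "0 \<le> s" "B \<in> sets (F s)"
  shows "{(u, \<omega>). 0 \<le> u \<and> \<omega> \<in> B \<and> A s \<omega> < u} \<in> sets (predictable_sigma F')"
proof -
  have sub: "B \<subseteq> space P" using sets.sets_into_space[OF assms(2)] by simp
  have "{(u, \<omega>). 0 \<le> u \<and> \<omega> \<in> B \<and> A s \<omega> < u} =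
    (\<Union>q\<in>\<rat> \<inter> {0..}. {q<..} \<times> (B \<inter> {\<omega>\<in>space P. A s \<omega> \<le> q}))" (is "?L = ?R")
  proof (intro equalityI subsetI)
    fix x assume "x \<in> ?L"
    then obtain u \<omega> where x: "x = (u, \<omega>)" "\<omega> \<in> B" "A s \<omega> < u" by auto
    have "0 \<le> A s \<omega>" using clock.clock_nonneg[OF A_clock assms(1)] x sub by auto
    moreover obtain q where "q \<in> \<rat>" "A s \<omega> < q" "q < u" using Rats_dense_in_real[OF x(3)] by blast
    ultimately show "x \<in> ?R" using x sub by (auto intro!: bexI[of _ q])
  qed auto
  moreover have "B \<inter> {\<omega>\<in>space P. A s \<omega> \<le> q} \<in> sets (F' q)" for q
    using revealed_G[OF assms, of q] by (simp add: sets_changed_filtration)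
  ultimately show ?thesis
    using changed.predictable_Ioi countable_rat by (simp only:) (intro sets.countable_UN', auto)
qed

text \<open>The preimage of \<open>(s, t] \<times> B\<close> is \<open>{A\<^sub>s < u \<le> A\<^sub>t} \<inter> B\<close>, a difference of two stochastic intervals starting
  after the stopping times \<open>A\<^sub>s\<close> and \<open>A\<^sub>t\<close>. So predictability is transported along \<open>C\<close>.\<close>
lemma inverse_clock_measurable:
  "(\<lambda>(u, \<omega>). (inv_A u \<omega>, \<omega>)) \<in> measurable (predictable_sigma F') (predictable_sigma F)"
proof (rule measurable_predictable)
  fix B assume B: "B \<in> sets (F 0)"
  have "inv_A u \<omega> = 0 \<longleftrightarrow> u = 0" if "\<omega> \<in> space P" "0 \<le> u" for u \<omega>
    using clock.C_pos[OF A_clock[OF that(1)], of u] clock.C_zero[OF A_clock[OF that(1)]] that(2)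
    by (cases "u = 0") auto
  then have "(\<lambda>(u, \<omega>). (inv_A u \<omega>, \<omega>)) -` ({0} \<times> B) \<inter> space (predictable_sigma F') = {0} \<times> B"
    using sets.sets_into_space[OF B] by auto
  moreover have "B \<in> sets (F' 0)" using F0_subset_G[OF B] by (simp add: sets_changed_filtration)
  ultimately show "(\<lambda>(u, \<omega>). (inv_A u \<omega>, \<omega>)) -` ({0} \<times> B) \<inter> space (predictable_sigma F')
      \<in> sets (predictable_sigma F')" using changed.predictable_zero by simp
next
  fix s t B assume st: "0 \<le> s" "s \<le> t" and B: "B \<in> sets (F s)"
  have "(\<lambda>(u, \<omega>). (inv_A u \<omega>, \<omega>)) -` ({s<..t} \<times> B) \<inter> space (predictable_sigma F') =
      {(u, \<omega>). 0 \<le> u \<and> \<omega> \<in> B \<and> A s \<omega> < u} - {(u, \<omega>). 0 \<le> u \<and> \<omega> \<in> B \<and> A t \<omega> < u}"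
    using st sets.sets_into_space[OF B] clock.less_C_iff[OF A_clock st(1)] clock.C_le_iff[OF A_clock, of _ t]
    by (auto simp: not_less)
  then show "(\<lambda>(u, \<omega>). (inv_A u \<omega>, \<omega>)) -` ({s<..t} \<times> B) \<inter> space (predictable_sigma F')
      \<in> sets (predictable_sigma F')"
    using after_clock_predictable[OF st(1) B] after_clock_predictable[of t B] F_mono[OF st(2) B] st
    by (simp only:) (intro sets.Diff, auto)
qed (use inv_A_nonneg in auto)

text \<open>All ingredients of the time change are predictable on the new scale: \<open>H\<close>, its left limits and \<open>A\<close>, each
  evaluated at \<open>C\<close>, as well as the time \<open>u\<close> with which \<open>A (C u)\<close> is compared.\<close>
lemma changed_predictable:
  assumes H: "predictable F H" and mono: "\<And>\<omega>. \<omega> \<in> space P \<Longrightarrow> mono_on {0..} (\<lambda>t. H t \<omega>)"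
  shows "predictable F' (changed H)"
proof -
  let ?C = "\<lambda>(u, \<omega>). (inv_A u \<omega>, \<omega>)"
  let ?pre = "\<lambda>(t, \<omega>). if t = 0 then 0 else pre_value (\<lambda>t. H t \<omega>) t"
  have meas: "(\<lambda>x. (case ?C x of (t, \<omega>) \<Rightarrow> Y t \<omega>)) \<in> borel_measurable (predictable_sigma F')"
    if "predictable F Y" for Y
    using measurable_compose[OF inverse_clock_measurable] that unfolding predictable_def by blast
  note [measurable] = meas[OF A_predictable] meas[OF H] changed.predictable_time
    measurable_compose[OF inverse_clock_measurable
      predictable_pre_value[OF predictable_imp_adapted[OF H] mono]]
  have meas: "(\<lambda>x. if (case ?C x of (t, \<omega>) \<Rightarrow> A t \<omega>) = (case x of (u, \<omega>) \<Rightarrow> u)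
      then (case ?C x of (t, \<omega>) \<Rightarrow> H t \<omega>) else ?pre (?C x)) \<in> borel_measurable (predictable_sigma F')"
    by measurable
  have eq: "(case x of (u, \<omega>) \<Rightarrow> changed H u \<omega>) =
      (if (case ?C x of (t, \<omega>) \<Rightarrow> A t \<omega>) = (case x of (u, \<omega>) \<Rightarrow> u)
      then (case ?C x of (t, \<omega>) \<Rightarrow> H t \<omega>) else ?pre (?C x))"
    if x_in: "x \<in> space (predictable_sigma F')" for x
  proof -
    obtain u \<omega> where x: "x = (u, \<omega>)" "0 \<le> u" "\<omega> \<in> space P"
      using x_in by (cases x) auto
    show ?thesis using clock.pos_of_gap[OF A_clock[OF x(3)] x(2)] x(1)
      by (auto simp: changed_def time_change_def)
  qed
  show ?thesis unfolding predictable_def by (subst measurable_cong[OF eq]) (assumption, rule meas)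
qed

text \<open>The graph of \<open>C\<^sub>v\<close> on the event that \<open>v\<close> lies in a gap; it is predictable because \<open>A\<close> is. The
  comparison at rational times says that \<open>A\<^sub>t\<^sub>- \<le> v\<close>.\<close>
definition gap_graph :: "real \<Rightarrow> (real \<times> 'a) set" where
  "gap_graph v = {(t, \<omega>). 0 < t \<and> \<omega> \<in> space P \<and> v < A t \<omega> \<and> (\<forall>r\<in>\<rat> \<inter> {0..}. r < t \<longrightarrow> A r \<omega> \<le> v)}"

lemma gap_graph_predictable: "gap_graph v \<in> sets (predictable_sigma F)"
proof -
  have "(\<lambda>(t, \<omega>). A t \<omega>) \<in> borel_measurable (predictable_sigma F)"
    using A_predictable by (simp add: predictable_def)
  then have *: "{x \<in> space (predictable_sigma F). v < (case x of (t, \<omega>) \<Rightarrow> A t \<omega>)} \<in> sets (predictable_sigma F)"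
    by measurable
  have "space P - {\<omega>\<in>space P. A r \<omega> \<le> v} \<in> sets (F r)" if "0 \<le> r" for r
    using sets.compl_sets[OF A_sets(1)[OF that, of v]] by simp
  then have U: "(\<Union>r\<in>\<rat> \<inter> {0..}. {r<..} \<times> (space P - {\<omega>\<in>space P. A r \<omega> \<le> v})) \<in> sets (predictable_sigma F)"
    using predictable_Ioi countable_rat by (intro sets.countable_UN') auto
  have pos: "{0<..} \<times> space P \<in> sets (predictable_sigma F)"
    using predictable_Ioi[of 0 "space P"] sets.top[of "F 0"] by simp
  have "gap_graph v = ({0<..} \<times> space P) \<inter>
      {x \<in> space (predictable_sigma F). v < (case x of (t, \<omega>) \<Rightarrow> A t \<omega>)}
    - (\<Union>r\<in>\<rat> \<inter> {0..}. {r<..} \<times> (space P - {\<omega>\<in>space P. A r \<omega> \<le> v}))"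
    unfolding gap_graph_def by auto
  then show ?thesis using * U pos by auto
qed

lemma gap_graph_is_graph:
  assumes "(t, \<omega>) \<in> gap_graph v" "\<omega> \<in> space P"
  shows "t = inv_A v \<omega> \<and> 0 < t"
proof -
  interpret clock "\<lambda>t. A t \<omega>" by (rule A_clock[OF assms(2)])
  have t: "0 < t" "v < A t \<omega>" "\<And>r. r \<in> \<rat> \<Longrightarrow> 0 \<le> r \<Longrightarrow> r < t \<Longrightarrow> A r \<omega> \<le> v"
    using assms(1) by (auto simp: gap_graph_def)
  have "C v \<le> t" using C_le_iff[of t v] t by simp
  moreover have "\<not> C v < t"
  proof
    assume "C v < t"
    then obtain r where r: "r \<in> \<rat>" "C v < r" "r < t" using Rats_dense_in_real by blast
    then have "A (C v) \<omega> < A r \<omega>" using less_iff[OF C_nonneg[of v], of r] C_nonneg[of v] by simp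
    then show False using t(3)[OF r(1) _ r(3)] le_clock_C[of v] C_nonneg[of v] r(2) by simp
  qed
  ultimately show ?thesis using t(1) by simp
qed

lemma gap_graph_iff:
  assumes "0 \<le> v" "\<omega> \<in> space P"
  shows "(inv_A v \<omega>, \<omega>) \<in> gap_graph v \<longleftrightarrow> v < A (inv_A v \<omega>) \<omega>"
proof -
  interpret clock "\<lambda>t. A t \<omega>" by (rule A_clock[OF assms(2)])
  show ?thesis
    using pos_of_gap[OF assms(1)] less_C_iff[of _ v] assms(2)
    by (auto simp: gap_graph_def intro: less_imp_le)
qed

end

section \<open>The martingale property on the new time scale\<close>

locale clocked_martingale = clocked + closed_martingale +
  assumes n_nonneg: "0 \<le> n"
begin

lemma changed_eq_value_before:
  assumes v: "0 \<le> v" and w: "\<omega> \<in> space P"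
  shows "changed N v \<omega> = value_before (inv_A v) {\<omega>\<in>space P. (inv_A v \<omega>, \<omega>) \<in> gap_graph v} \<omega>"
proof -
  interpret clock "\<lambda>t. A t \<omega>" by (rule A_clock[OF w])
  have ll: "left_limits_path (\<lambda>s. N s \<omega>)" using cadlag[OF w] by (simp add: cadlag_path_def)
  show ?thesis
  proof (cases "A (C v) \<omega> = v")
    case True
    then show ?thesis using gap_graph_iff[OF v w] w
      by (simp add: changed_def value_before_def time_change_def)
  next
    case False
    then have "0 < C v" "v < A (C v) \<omega>" using pos_of_gap[OF v] le_clock_C[of v] by auto
    moreover have "pre_value (\<lambda>s. N s \<omega>) (C v) = left_lim (\<lambda>s. N s \<omega>) (C v)"
      using left_limits_tendsto[OF ll] \<open>0 < C v\<close> tendsto_left_imp_pre_value by blast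
    ultimately show ?thesis using gap_graph_iff[OF v w] w False
      by (simp add: changed_def value_before_def time_change_def)
  qed
qed

lemma changed_N_measurable: "0 \<le> v \<Longrightarrow> changed N v \<in> borel_measurable (F' v)"
  using changed_adapted[OF adapted] cadlag by (auto simp: adapted_def cadlag_path_def)

lemma changed_value_before_measurable:
  assumes "0 \<le> v"
  shows "value_before (inv_A v) {\<omega>\<in>space P. (inv_A v \<omega>, \<omega>) \<in> gap_graph v} \<in> borel_measurable P"
  using changed.measurable_F_P[OF changed_N_measurable[OF assms]]
  by (subst measurable_cong[OF changed_eq_value_before[OF assms, symmetric]])

lemma changed_tails_dominated:
  assumes v: "0 \<le> v"
  shows "tails_dominated P \<xi> (changed N v)"
proof -
  let ?V = "value_before (inv_A v) {\<omega>\<in>space P. (inv_A v \<omega>, \<omega>) \<in> gap_graph v}"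
  have "tails_dominated P \<xi> ?V"
    by (rule value_before_predictable(1)[OF inv_A_sets inv_A_nonneg inv_A_measurable
          gap_graph_predictable gap_graph_is_graph n_nonneg changed_value_before_measurable[OF v]])
  then show ?thesis
    by (rule tails_dominated_limit[where Yk = "\<lambda>_. ?V", OF integrable_final _
          changed.measurable_F_P[OF changed_N_measurable[OF v]]])
       (simp add: changed_eq_value_before[OF v])
qed

text \<open>On \<open>B \<inter> {A\<^sub>r \<le> w}\<close> with \<open>w \<le> v\<close> one has \<open>r \<le> C\<^sub>v\<close>, with strict inequality if \<open>v\<close> lies in a gap: this is exactly
  the condition on events in \<open>value_before_predictable\<close>.\<close>
lemma changed_integral_revealed:
  assumes v: "0 \<le> v" and E: "E \<in> revealed v"
  shows "(LINT \<omega>:E|P. changed N v \<omega>) = (LINT \<omega>:E|P. \<xi> \<omega>)"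
proof -
  obtain B r w where E': "E = B \<inter> {\<omega>\<in>space P. A r \<omega> \<le> w}" "0 \<le> r" "B \<in> sets (F r)" "w \<le> v"
    using E by (auto simp: revealed_def)
  let ?D = "{\<omega>\<in>space P. (inv_A v \<omega>, \<omega>) \<in> gap_graph v}"
  have "(LINT \<omega>:E|P. value_before (inv_A v) ?D \<omega>) = (LINT \<omega>:E|P. \<xi> \<omega>)"
  proof (rule value_before_predictable(2)[OF inv_A_sets inv_A_nonneg inv_A_measurable
          gap_graph_predictable gap_graph_is_graph n_nonneg changed_value_before_measurable[OF v] E'(2)])
    show "E \<in> sets (F r)" unfolding E'(1) by (intro sets.Int E' A_sets)
    fix \<omega> assume "\<omega> \<in> E"
    then have w: "\<omega> \<in> space P" "A r \<omega> \<le> v" using E' by auto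
    interpret clock "\<lambda>t. A t \<omega>" by (rule A_clock[OF w(1)])
    show "r \<le> inv_A v \<omega>"
      using less_iff[OF C_nonneg[of v] E'(2)] le_clock_C[of v] w(2) by (simp add: not_less[symmetric])
    show "r < inv_A v \<omega>" if "\<omega> \<in> ?D"
      using less_iff[OF E'(2) C_nonneg[of v]] gap_graph_iff[OF v w(1)] that w(2) by simp
  qed auto
  moreover have "(LINT \<omega>:E|P. value_before (inv_A v) ?D \<omega>) = (LINT \<omega>:E|P. changed N v \<omega>)"
    unfolding set_lebesgue_integral_def
    by (rule Bochner_Integration.integral_cong) (simp_all add: changed_eq_value_before[OF v])
  ultimately show ?thesis by simp
qed

text \<open>Of two events, the one revealed at the smaller old time \<open>r\<close> belongs to \<open>F\<close> at the larger old time \<open>r'\<close> and can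
  be absorbed into the other.\<close>
lemma revealed_Int_stable: "Int_stable (revealed v)"
proof (rule Int_stableI)
  have aux: "E \<inter> E' \<in> revealed v"
    if E: "E = B \<inter> {\<omega>\<in>space P. A r \<omega> \<le> w}" "B \<in> sets (F r)"
      and E': "E' = B' \<inter> {\<omega>\<in>space P. A r' \<omega> \<le> w'}" "B' \<in> sets (F r')" "w' \<le> v" and r: "0 \<le> r" "r \<le> r'"
    for E E' B B' r r' w w'
  proof -
    have "B \<inter> {\<omega>\<in>space P. A r \<omega> \<le> w} \<in> sets (F r')"
      by (rule F_mono[OF r(2)]) (intro sets.Int E A_sets r)
    then have "(B \<inter> {\<omega>\<in>space P. A r \<omega> \<le> w}) \<inter> B' \<in> sets (F r')" using E' by blast
    moreover have "E \<inter> E' = ((B \<inter> {\<omega>\<in>space P. A r \<omega> \<le> w}) \<inter> B') \<inter> {\<omega>\<in>space P. A r' \<omega> \<le> w'}"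
      using E E' by auto
    ultimately show ?thesis using E' r unfolding revealed_def by (intro CollectI exI conjI) auto
  qed
  fix E E' assume "E \<in> revealed v" "E' \<in> revealed v"
  then obtain B r w B' r' w' where
    *: "E = B \<inter> {\<omega>\<in>space P. A r \<omega> \<le> w}" "B \<in> sets (F r)" "w \<le> v" "0 \<le> r"
      "E' = B' \<inter> {\<omega>\<in>space P. A r' \<omega> \<le> w'}" "B' \<in> sets (F r')" "w' \<le> v" "0 \<le> r'"
    unfolding revealed_def by blast
  show "E \<inter> E' \<in> revealed v"
  proof (cases "r \<le> r'")
    case True
    show ?thesis by (rule aux[OF *(1,2,5,6,7,4) True])
  next
    case False
    then have "E' \<inter> E \<in> revealed v" by (intro aux[OF *(5,6,1,2,3,8)]) simp
    then show ?thesis by (simp add: Int_commute)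
  qed
qed

lemma changed_integral_G:
  assumes v: "0 \<le> v" and E: "E \<in> sets (G v)"
  shows "(LINT \<omega>:E|P. changed N v \<omega>) = (LINT \<omega>:E|P. \<xi> \<omega>)"
proof -
  have int: "integrable P (changed N v)" using changed_tails_dominated[OF v] by (simp add: tails_dominated_def)
  note set_int = integrable_imp_set_integrable[OF int] integrable_imp_set_integrable[OF integrable_final]
  have inP: "E \<in> sigma_sets (space P) (revealed v) \<Longrightarrow> E \<in> sets P" for E
    using G_subset[of v] by (auto simp: sets_G)
  show ?thesis
    using revealed_Int_stable revealed_subset E[unfolded sets_G]
  proof (induction rule: sigma_sets_induct_disjoint)
    case (basic E)
    then show ?case by (rule changed_integral_revealed[OF v])
  next
    case empty
    then show ?case by (simp add: set_lebesgue_integral_def)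
  next
    case (compl E)
    have EP: "E \<in> sets P" "space P - E \<in> sets P" using inP[OF compl.hyps] by auto
    have top: "space P \<in> revealed v"
    proof -
      have "space P = space P \<inter> {\<omega>\<in>space P. A 0 \<omega> \<le> 0}" using clock.zero[OF A_clock] by auto
      then show ?thesis using v sets.top[of "F 0"] unfolding revealed_def
        by (intro CollectI exI[of _ "space P"] exI[of _ 0] exI[of _ "0::real"]) auto
    qed
    have split: "(LINT \<omega>:space P|P. Z \<omega>) = (LINT \<omega>:E|P. Z \<omega>) + (LINT \<omega>:space P - E|P. Z \<omega>)"
      if "set_integrable P E Z" "set_integrable P (space P - E) Z" for Z :: "'a \<Rightarrow> real"
      using set_integral_Un[OF _ that] sets.sets_into_space[OF EP(1)] by (simp add: Un_absorb1)
    show ?case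
      using split[OF set_int(1) set_int(1)] split[OF set_int(2) set_int(2)] EP compl.IH
        changed_integral_revealed[OF v top] by simp
  next
    case (union E)
    have EP: "E i \<in> sets P" for i using union.hyps inP by auto
    have sum: "(LINT \<omega>:(\<Union>i. E i)|P. Z \<omega>) = (\<Sum>i. LINT \<omega>:E i|P. Z \<omega>)"
      if "integrable P Z" for Z :: "'a \<Rightarrow> real"
    proof (rule lebesgue_integral_countable_add[OF EP])
      show "E i \<inter> E j = {}" if "i \<noteq> j" for i j using union.hyps that by (auto simp: disjoint_family_on_def)
      show "set_integrable P (\<Union>i. E i) Z" using EP by (intro integrable_imp_set_integrable that) auto
    qed
    show ?case using sum[OF int] sum[OF integrable_final] union.IH by simp
  qed
qed

text \<open>Members of \<open>F'\<^sub>u\<close> belong to \<open>G\<^sub>v\<close> for all \<open>v > u\<close>; let \<open>v \<downarrow> u\<close>.\<close>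
lemma changed_integral:
  assumes u: "0 \<le> u" and E: "E \<in> sets (F' u)"
  shows "(LINT \<omega>:E|P. changed N u \<omega>) = (LINT \<omega>:E|P. \<xi> \<omega>)"
proof -
  define v where "v k = u + 1 / real (Suc k)" for k
  have v: "u < v k" "0 \<le> v k" for k using u by (auto simp: v_def add_nonneg_nonneg)
  have v_lim: "v \<longlonglongrightarrow> u"
    unfolding v_def using tendsto_add[OF tendsto_const LIMSEQ_inverse_real_of_nat]
    by (simp add: inverse_eq_divide)
  have eq: "(LINT \<omega>:E|P. changed N (v k) \<omega>) = (LINT \<omega>:E|P. \<xi> \<omega>)" for k
    using changed_integral_G[OF v(2)[of k], of E] E v(1)[of k] by (simp add: sets_changed_filtration)
  have "(\<lambda>k. LINT \<omega>:E|P. changed N (v k) \<omega>) \<longlonglongrightarrow> (LINT \<omega>:E|P. changed N u \<omega>)"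
  proof (rule tails_dominated_set_integral_limit[OF integrable_final changed_tails_dominated[OF v(2)]
        changed.measurable_F_P[OF changed_N_measurable[OF u]] _ changed.sets_F_subset[OF E]])
    show "AE \<omega> in P. (\<lambda>k. changed N (v k) \<omega>) \<longlonglongrightarrow> changed N u \<omega>"
    proof (rule AE_I2)
      fix \<omega> assume w: "\<omega> \<in> space P"
      have "right_cont_path (\<lambda>u. changed N u \<omega>)"
        unfolding changed_def
        by (rule clock.right_cont_time_change[OF A_clock[OF w]]) (use cadlag[OF w] in \<open>simp add: cadlag_path_def\<close>)
      then show "(\<lambda>k. changed N (v k) \<omega>) \<longlonglongrightarrow> changed N u \<omega>"
        by (rule tendsto_right_seq[OF _ u v_lim]) (simp add: v(1))
    qed
  qed
  then show ?thesis unfolding eq by (rule LIMSEQ_unique[OF _ tendsto_const])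
qed

lemma changed_martingale: "martingale P F' (changed N)"
  unfolding martingale_def
proof (intro conjI allI impI)
  show "adapted F' (changed N)"
    by (rule changed_adapted[OF adapted]) (use cadlag in \<open>auto simp: cadlag_path_def\<close>)
  show int: "integrable P (changed N t)" if "0 \<le> t" for t
    using changed_tails_dominated[OF that] by (simp add: tails_dominated_def)
  fix s t :: real assume st: "0 \<le> s \<and> s \<le> t"
  interpret finite_measure_subalgebra P "F' s"
    by unfold_locales (rule changed.subalgebra_F)
  show "AE \<omega> in P. real_cond_exp P (F' s) (changed N t) \<omega> = changed N s \<omega>"
  proof (rule real_cond_exp_charact)
    fix E assume E: "E \<in> sets (F' s)"
    then have "E \<in> sets (F' t)" using changed.F_mono st by blast
    then show "(LINT \<omega>:E|P. changed N t \<omega>) = (LINT \<omega>:E|P. changed N s \<omega>)"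
      using changed_integral[of t E] changed_integral[of s E] E st by simp
  qed (use int changed_N_measurable st in auto)
qed

end

section \<open>The two integral inequalities on the new time scale\<close>

text \<open>Locally the path is bounded on both sides of each point, and bisection makes this global.\<close>
lemma cadlag_bounded_above:
  assumes f: "cadlag_path f"
  shows "bdd_above (f ` {0..b})"
proof (cases "0 \<le> b")
  case True
  define Q where "Q x y \<longleftrightarrow> bdd_above (f ` ({x..y} \<inter> {0..}))" for x y
  have "Q 0 b" using True
  proof (induction rule: Bolzano)
    case (trans x y z)
    then have "{x..z} \<inter> {0..} = ({x..y} \<inter> {0..}) \<union> ({y..z} \<inter> {0..})" by auto
    then show ?case using trans by (simp add: Q_def image_Un)
  next
    case (local x)
    have rc: "right_cont_path f" using f by (simp add: cadlag_path_def)
    obtain y where y: "x < y" "\<And>s. x < s \<Longrightarrow> s < y \<Longrightarrow> f x - 1 \<le> f s \<and> f s \<le> f x + 1"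
      by (rule right_cont_near[OF rc local(1) zero_less_one], rule that)
    obtain z l where z: "z < x" "\<And>s. z < s \<Longrightarrow> s < x \<Longrightarrow> 0 \<le> s \<Longrightarrow> f s \<le> l"
    proof (cases "x = 0")
      case True
      then show ?thesis using that[of "-1" 0] by simp
    next
      case False
      then have "0 < x" using local(1) by simp
      then obtain l where "(f \<longlongrightarrow> l) (at_left x)"
        using f unfolding cadlag_path_def left_limits_path_def by blast
      from tendsto_left_near[OF this zero_less_one]
      obtain z where "z < x" "\<And>s. z < s \<Longrightarrow> s < x \<Longrightarrow> l - 1 \<le> f s \<and> f s \<le> l + 1" by metis
      then show ?thesis using that[of z "l + 1"] by blast
    qed
    show ?case
    proof (intro exI[of _ "min (y - x) (x - z)"] conjI allI impI)
      fix a b assume ab: "a \<le> x \<and> x \<le> b \<and> b - a < min (y - x) (x - z)"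
      show "Q a b" unfolding Q_def
      proof (rule bdd_aboveI)
        fix w assume "w \<in> f ` ({a..b} \<inter> {0..})"
        then obtain s where s: "w = f s" "a \<le> s" "s \<le> b" "0 \<le> s" by auto
        consider "s < x" | "s = x" | "x < s" by linarith
        then show "w \<le> max l (f x + 1)"
        proof cases
          case 1
          then have "f s \<le> l" using z(2)[of s] ab s by auto
          then show ?thesis using s by simp
        next
          case 3
          then show ?thesis using y(2)[of s] ab s by auto
        qed (use s in simp)
      qed
    qed (use y z in auto)
  qed
  moreover have "{0..b} \<inter> {0..} = {0..b}" by auto
  ultimately show ?thesis by (simp add: Q_def)
qed simp

text \<open>The left limit at \<open>s\<close> is the limit of the values at the last grid points strictly before \<open>s\<close>.\<close>
lemma left_lim_measurable:
  fixes \<eta> :: "real \<Rightarrow> real"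
  assumes f: "left_limits_path f" and c: "\<And>t. 0 \<le> t \<Longrightarrow> c \<le> f t" and \<eta>: "continuous_on {c..} \<eta>"
  shows "(\<lambda>s. indicator {0<..} s * \<eta> (left_lim f s)) \<in> borel_measurable borel"
proof (rule borel_measurable_LIMSEQ_real)
  define g where "g m s = (of_int \<lceil>real (Suc m) * s\<rceil> - 1) / real (Suc m)" for m and s :: real
  have g_le: "g m s < s" "s - 1 / real (Suc m) \<le> g m s" for m s
  proof -
    let ?d = "real (Suc m)"
    have d: "0 < ?d" by simp
    have "of_int \<lceil>?d * s\<rceil> - 1 < ?d * s" "?d * s \<le> of_int \<lceil>?d * s\<rceil>" by linarith+
    then show "g m s < s" "s - 1 / ?d \<le> g m s"
      using d unfolding g_def by (simp_all add: field_simps del: of_nat_Suc)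
  qed
  have g_nonneg: "0 \<le> g m s" if "0 < s" for m s
  proof -
    have "0 < real (Suc m) * s" using that by simp
    then have "1 \<le> \<lceil>real (Suc m) * s\<rceil>" by linarith
    then show ?thesis by (simp add: g_def)
  qed
  show "(\<lambda>s. indicator {0<..} s * \<eta> (f (g m s))) \<in> borel_measurable borel" for m
  proof -
    have "(\<lambda>s. (\<lambda>k::int. \<eta> (f ((of_int k - 1) / real (Suc m)))) \<lceil>real (Suc m) * s\<rceil>) \<in> borel_measurable borel"
      by (rule measurable_compose[where N = "count_space UNIV"]) simp_all
    then show ?thesis unfolding g_def by (intro borel_measurable_times) simp_all
  qed
  show "(\<lambda>m. indicator {0<..} s * \<eta> (f (g m s))) \<longlonglongrightarrow> indicator {0<..} s * \<eta> (left_lim f s)" for s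
  proof (cases "0 < s")
    case True
    have "(\<lambda>m. s - 1 / real (Suc m)) \<longlonglongrightarrow> s - 0"
      by (intro tendsto_diff tendsto_const LIMSEQ_inverse_real_of_nat[unfolded inverse_eq_divide])
    then have below: "(\<lambda>m. s - 1 / real (Suc m)) \<longlonglongrightarrow> s" by simp
    have "(\<lambda>m. g m s) \<longlonglongrightarrow> s"
      by (rule tendsto_sandwich[OF _ _ below tendsto_const])
         (intro always_eventually allI g_le(2) less_imp_le[OF g_le(1)])+
    then have lim: "(\<lambda>m. f (g m s)) \<longlonglongrightarrow> left_lim f s"
      by (rule tendsto_left_seq[OF f True]) (simp add: g_le)
    have ge: "c \<le> f (g m s)" for m using c g_nonneg[OF True] by simp
    then have "c \<le> left_lim f s" by (intro LIMSEQ_le_const[OF lim]) auto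
    then have "(\<lambda>m. \<eta> (f (g m s))) \<longlonglongrightarrow> \<eta> (left_lim f s)"
      by (intro continuous_on_tendsto_compose[OF \<eta> lim]) (use ge in auto)
    then show ?thesis using True by simp
  qed simp
qed

context clock
begin

lemma time_change_le_running_sup:
  assumes bdd: "bdd_above (f ` {0..<C v})" and c: "\<And>s. 0 \<le> s \<Longrightarrow> c \<le> f s" and w: "0 \<le> w" "w < v"
  shows "time_change a f w \<le> (SUP s\<in>{0..<C v}. f s)"
proof -
  have upper: "f s \<le> (SUP s\<in>{0..<C v}. f s)" if "0 \<le> s" "s < C v" for s
    by (rule cSUP_upper[OF _ bdd]) (use that in simp)
  show ?thesis
  proof (cases "a (C w) = w")
    case True
    then have "C w < C v" using less_C_iff[OF C_nonneg, of w v] w by simp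
    then show ?thesis using True upper[OF C_nonneg] by (simp add: time_change_def)
  next
    case False
    have "pre_value f (C w) \<le> (SUP s\<in>{0..<C v}. f s)"
    proof (rule pre_value_bounds(2)[of 0 _ c])
      show "0 < C w" using pos_of_gap[OF w(1) False] by simp
      fix s assume "0 < s" "s < C w"
      moreover have "C w \<le> C v" using C_mono w by simp
      ultimately show "c \<le> f s \<and> f s \<le> (SUP s\<in>{0..<C v}. f s)" using upper[of s] c by simp
    qed
    then show ?thesis using False by (simp add: time_change_def)
  qed
qed

text \<open>The new path takes the old values at the times \<open>a s\<close>, and in gaps it takes limits superior of old values,
  which do not raise the supremum.\<close>
lemma running_sup_left_time_change:
  assumes bdd: "bdd_above (f ` {0..<C v})" and c: "\<And>s. 0 \<le> s \<Longrightarrow> c \<le> f s" and v: "0 < v"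
  shows "running_sup_left (time_change a f) v = running_sup_left f (C v)"
proof -
  have pos: "0 < C v" by (rule C_pos[OF v])
  have "(SUP w\<in>{0..<v}. time_change a f w) = (SUP s\<in>{0..<C v}. f s)"
  proof (rule antisym)
    show "(SUP w\<in>{0..<v}. time_change a f w) \<le> (SUP s\<in>{0..<C v}. f s)"
      by (rule cSUP_least) (use v time_change_le_running_sup[OF bdd c] in auto)
    have bdd': "bdd_above (time_change a f ` {0..<v})"
      by (rule bdd_aboveI2[of _ _ "SUP s\<in>{0..<C v}. f s"]) (use time_change_le_running_sup[OF bdd c] in auto)
    show "(SUP s\<in>{0..<C v}. f s) \<le> (SUP w\<in>{0..<v}. time_change a f w)"
    proof (rule cSUP_least)
      fix s assume s: "s \<in> {0..<C v}"
      then have "a s \<in> {0..<v}" using less_C_iff[of s v] clock_nonneg[of s] by simp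
      from cSUP_upper[OF this bdd'] s show "f s \<le> (SUP w\<in>{0..<v}. time_change a f w)" by simp
    qed (use pos in simp)
  qed
  then show ?thesis using pos v by (simp add: running_sup_left_def)
qed

lemma nosup_inequality_time_change:
  assumes f: "cadlag_path f" "\<And>s. 0 \<le> s \<Longrightarrow> c \<le> f s"
    and m: "cadlag_path m" and h: "cadlag_path h"
    and \<eta>: "continuous_on {c..} \<eta>" "mono_on {c..} \<eta>" "\<And>x. c \<le> x \<Longrightarrow> 0 \<le> \<eta> x"
    and ineq: "\<And>q. q \<in> \<rat> \<Longrightarrow> 0 \<le> q \<Longrightarrow>
      f q \<le> (LINT s:{0<..q}|stieltjes a. \<eta> (left_lim f s)) + m q + h q"
    and u: "0 \<le> u"
  shows "time_change a f u \<le>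
    (LINT v:{0<..u}|uniform_clock. \<eta> (left_lim (time_change a f) v)) + time_change a m u + time_change a h u"
proof -
  have ll: "left_limits_path f" using f(1) by (simp add: cadlag_path_def)
  have left_between: "c \<le> left_lim f s \<and> left_lim f s \<le> B"
    if s: "0 < s" and B: "\<And>r. 0 \<le> r \<Longrightarrow> r \<le> s \<Longrightarrow> f r \<le> B" for s B
  proof
    note lim = left_limits_tendsto(1)[OF ll s]
    show "c \<le> left_lim f s"
      by (rule tendsto_lowerbound[OF lim]) (use s f(2) in \<open>auto simp: eventually_at_left[OF s] intro!: exI[of _ 0]\<close>)
    show "left_lim f s \<le> B"
      by (rule tendsto_upperbound[OF lim]) (use s B in \<open>auto simp: eventually_at_left[OF s] intro!: exI[of _ 0]\<close>)
  qed
  have bound: "\<exists>B. \<forall>r. 0 \<le> r \<and> r \<le> T \<longrightarrow> f r \<le> B" for T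
    using cadlag_bounded_above[OF f(1), of T] unfolding bdd_above_def by fastforce
  have "time_change a f u \<le>
    (LINT v:{0<..u}|uniform_clock. \<eta> (left_lim f (C v))) + time_change a m u + time_change a h u"
  proof (rule time_change_inequality[OF _ f(2) m h left_lim_measurable[OF ll f(2) \<eta>(1)] _ _ ineq u])
    show "right_cont_path f" using f(1) by (simp add: cadlag_path_def)
    show "0 \<le> \<eta> (left_lim f s)" if "0 < s" for s
      using bound[of s] left_between[OF that] \<eta>(3) by blast
    show "\<exists>K. \<forall>s. 0 < s \<and> s \<le> T \<longrightarrow> \<eta> (left_lim f s) \<le> K" for T
    proof -
      obtain B where B: "\<And>r. 0 \<le> r \<Longrightarrow> r \<le> T \<Longrightarrow> f r \<le> B" using bound by blast
      have "\<eta> (left_lim f s) \<le> \<eta> B" if "0 < s" "s \<le> T" for s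
        using left_between[OF that(1), of B] B that by (intro mono_onD[OF \<eta>(2)]) auto
      then show ?thesis by blast
    qed
  qed
  also have "(LINT v:{0<..u}|uniform_clock. \<eta> (left_lim f (C v))) =
      (LINT v:{0<..u}|uniform_clock. \<eta> (left_lim (time_change a f) v))"
    by (rule set_lebesgue_integral_cong) (simp_all add: left_lim_time_change[OF ll])
  finally show ?thesis .
qed

lemma sup_inequality_time_change:
  assumes f: "right_cont_path f" "\<And>s. 0 \<le> s \<Longrightarrow> c \<le> f s" and bdd: "\<And>t. bdd_above (f ` {0..<t})"
    and m: "cadlag_path m" and h: "cadlag_path h"
    and \<eta>: "mono_on {c..} \<eta>" "\<And>x. c \<le> x \<Longrightarrow> 0 \<le> \<eta> x"
    and ineq: "\<And>q. q \<in> \<rat> \<Longrightarrow> 0 \<le> q \<Longrightarrow>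
      f q \<le> (LINT s:{0<..q}|stieltjes a. \<eta> (running_sup_left f s)) + m q + h q"
    and u: "0 \<le> u"
  shows "time_change a f u \<le>
    (LINT v:{0<..u}|uniform_clock. \<eta> (running_sup_left (time_change a f) v))
      + time_change a m u + time_change a h u"
proof -
  have ge: "c \<le> running_sup_left f s" if s: "0 < s" for s
    using cSUP_upper2[OF bdd, of 0 s c] s f(2)[of 0] by (simp add: running_sup_left_def)
  have mono: "\<eta> (running_sup_left f s) \<le> \<eta> (running_sup_left f t)" if st: "0 < s" "s \<le> t" for s t
  proof (rule mono_onD[OF \<eta>(1)])
    show "running_sup_left f s \<le> running_sup_left f t"
      using st cSUP_subset_mono[of "{0..<s}" f "{0..<t}" f, OF _ bdd] by (auto simp: running_sup_left_def)
  qed (use ge st in auto)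
  have "time_change a f u \<le>
    (LINT v:{0<..u}|uniform_clock. \<eta> (running_sup_left f (C v))) + time_change a m u + time_change a h u"
  proof (rule time_change_inequality[OF f m h _ _ _ ineq u])
    show "(\<lambda>s. indicator {0<..} s * \<eta> (running_sup_left f s)) \<in> borel_measurable borel"
      by (rule borel_measurable_mono, rule monoI) (use mono \<eta>(2)[OF ge] in \<open>auto simp: indicator_def\<close>)
    show "0 \<le> \<eta> (running_sup_left f s)" if "0 < s" for s using \<eta>(2)[OF ge[OF that]] .
    show "\<exists>K. \<forall>s. 0 < s \<and> s \<le> T \<longrightarrow> \<eta> (running_sup_left f s) \<le> K" for T
      using mono by blast
  qed
  also have "(LINT v:{0<..u}|uniform_clock. \<eta> (running_sup_left f (C v))) =
      (LINT v:{0<..u}|uniform_clock. \<eta> (running_sup_left (time_change a f) v))"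
    by (rule set_lebesgue_integral_cong) (simp_all add: running_sup_left_time_change[OF bdd f(2)])
  finally show ?thesis .
qed

end

section \<open>Stopped paths and local martingales\<close>

lemma cadlag_stop:
  assumes f: "cadlag_path f"
  shows "cadlag_path (\<lambda>t. f (min t \<sigma>))"
  unfolding cadlag_path_def right_cont_path_def left_limits_path_def
proof (intro conjI allI impI)
  fix t :: real assume t: "0 \<le> t"
  show "continuous (at_right t) (\<lambda>t. f (min t \<sigma>))"
  proof (cases "t < \<sigma>")
    case True
    have "eventually (\<lambda>s. f s = f (min s \<sigma>)) (at_right t)"
      unfolding eventually_at_right[OF True] using True by (intro exI[of _ \<sigma>]) auto
    moreover have "(f \<longlongrightarrow> f t) (at_right t)"
      using f t by (auto simp: cadlag_path_def right_cont_path_def continuous_within)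
    ultimately have "((\<lambda>s. f (min s \<sigma>)) \<longlongrightarrow> f t) (at_right t)" by (rule Lim_transform_eventually[rotated])
    then show ?thesis using True by (simp add: continuous_within)
  next
    case False
    have "eventually (\<lambda>s. f (min s \<sigma>) = f (min t \<sigma>)) (at_right t)"
      unfolding eventually_at_right[of t "t + 1", simplified] using False
      by (intro exI[of _ "t + 1"]) (auto simp: min_def)
    then show ?thesis unfolding continuous_within by (rule tendsto_eventually)
  qed
next
  fix t :: real assume t: "0 < t"
  show "\<exists>l. ((\<lambda>t. f (min t \<sigma>)) \<longlongrightarrow> l) (at_left t)"
  proof (cases "\<sigma> < t")
    case True
    have "eventually (\<lambda>s. f (min s \<sigma>) = f \<sigma>) (at_left t)"
      unfolding eventually_at_left[OF True] using True by (intro exI[of _ \<sigma>]) auto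
    then show ?thesis by (blast intro: tendsto_eventually)
  next
    case False
    have "eventually (\<lambda>s. f s = f (min s \<sigma>)) (at_left t)"
      unfolding eventually_at_left[OF t] using False t by (intro exI[of _ 0]) (auto simp: min_def)
    moreover obtain l where "(f \<longlongrightarrow> l) (at_left t)"
      using f t by (auto simp: cadlag_path_def left_limits_path_def)
    ultimately show ?thesis by (blast intro: Lim_transform_eventually)
  qed
qed

lemma pre_value_cong_left:
  assumes "d < t" "\<And>s. d < s \<Longrightarrow> s < t \<Longrightarrow> f s = g s" "f 0 = g 0"
  shows "pre_value f t = pre_value g t"
proof -
  have "left_limsup f t = left_limsup g t"
    unfolding left_limsup_def
    by (rule Limsup_eq[OF eventually_rational_left[OF assms(1)]]) (simp add: assms(2))
  then show ?thesis using assms(3) by (simp add: pre_value_def)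
qed

text \<open>Stopping at \<open>\<sigma>\<close> on the old scale is stopping at \<open>a \<sigma>\<close> on the new one.\<close>
lemma (in clock) time_change_stop:
  assumes u: "0 \<le> u" and \<sigma>: "0 \<le> \<sigma>"
  shows "time_change a f (min u (a \<sigma>)) = time_change a (\<lambda>t. f (min t \<sigma>)) u"
proof (cases "a \<sigma> \<le> u")
  case True
  have ge: "\<sigma> \<le> C u" using C_mono[OF True] \<sigma> by simp
  have "time_change a (\<lambda>t. f (min t \<sigma>)) u = f \<sigma>"
  proof (cases "a (C u) = u")
    case False
    then have "a \<sigma> < a (C u)" using True le_clock_C[of u] by simp
    then have "\<sigma> < C u" using less_iff[OF \<sigma> C_nonneg] by simp
    have "((\<lambda>t. f (min t \<sigma>)) \<longlongrightarrow> f \<sigma>) (at_left (C u))"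
      by (rule tendsto_eventually, unfold eventually_at_left[OF \<open>\<sigma> < C u\<close>])
         (use \<open>\<sigma> < C u\<close> in \<open>auto intro!: exI[of _ \<sigma>]\<close>)
    then show ?thesis using False by (simp add: time_change_def tendsto_left_imp_pre_value)
  qed (use ge in \<open>simp add: time_change_def min_def\<close>)
  then show ?thesis using True \<sigma> by (simp add: min_absorb2)
next
  case False
  then have le: "C u \<le> \<sigma>" using C_le_iff[OF \<sigma>, of u] by simp
  have "pre_value f (C u) = pre_value (\<lambda>t. f (min t \<sigma>)) (C u)" if "0 < C u"
    by (rule pre_value_cong_left[OF that]) (use le \<sigma> in \<open>auto simp: min_def\<close>)
  then show ?thesis
    using False le pos_of_gap[OF u] by (auto simp: time_change_def min_absorb1)
qed

lemma (in filtered) martingale_cong: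
  assumes eq: "\<And>t \<omega>. 0 \<le> t \<Longrightarrow> \<omega> \<in> space P \<Longrightarrow> X t \<omega> = Y t \<omega>" and Y: "martingale P F Y"
  shows "martingale P F X"
  unfolding martingale_def adapted_def
proof (intro conjI allI impI)
  fix t :: real assume t: "0 \<le> t"
  show "X t \<in> borel_measurable (F t)"
    using Y t eq[OF t] by (subst measurable_cong[of _ _ "Y t"]) (auto simp: martingale_def adapted_def)
  show "integrable P (X t)"
    using Y t eq[OF t] by (subst Bochner_Integration.integrable_cong[of _ _ _ "Y t"]) (auto simp: martingale_def)
next
  fix s t :: real assume st: "0 \<le> s \<and> s \<le> t"
  interpret finite_measure_subalgebra P "F s" by unfold_locales (rule subalgebra_F)
  have Yt: "Y t \<in> borel_measurable P" using Y st by (simp add: martingale_def borel_measurable_integrable)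
  moreover have "X t \<in> borel_measurable P"
    using Yt st eq by (subst measurable_cong[of _ _ "Y t"]) auto
  ultimately have "AE \<omega> in P. real_cond_exp P (F s) (X t) \<omega> = real_cond_exp P (F s) (Y t) \<omega>"
    using st eq by (intro real_cond_exp_cong) auto
  moreover have "AE \<omega> in P. real_cond_exp P (F s) (Y t) \<omega> = Y s \<omega>"
    using Y st by (simp add: martingale_def)
  ultimately show "AE \<omega> in P. real_cond_exp P (F s) (X t) \<omega> = X s \<omega>"
    using AE_space by eventually_elim (use st eq in simp)
qed

context clocked
begin

text \<open>If \<open>\<tau>\<^sub>n\<close> localizes \<open>M\<close>, then \<open>A(\<tau>\<^sub>n \<and> n)\<close> localizes \<open>M'\<close>. The additional truncation at \<open>n\<close> makes the stopped
  martingale closed by its value at time \<open>n\<close>, so that the bounded-horizon result applies although \<open>C\<close> is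
  unbounded.\<close>
lemma changed_local_martingale:
  assumes M: "local_martingale P F M" and cadlag: "\<And>\<omega>. \<omega> \<in> space P \<Longrightarrow> cadlag_path (\<lambda>t. M t \<omega>)"
  shows "local_martingale P F' (changed M)"
proof -
  obtain \<tau> :: "nat \<Rightarrow> 'a \<Rightarrow> ennreal" where \<tau>: "\<And>n. ext_stopping_time F (\<tau> n)"
    "AE \<omega> in P. incseq (\<lambda>n. \<tau> n \<omega>) \<and> (\<lambda>n. \<tau> n \<omega>) \<longlonglongrightarrow> \<infinity>"
    "\<And>n. martingale P F (stopped M (\<tau> n))"
    using M by (auto simp: local_martingale_def)
  have adapted: "adapted F M" using M by (simp add: local_martingale_def)
  define S where "S n \<omega> = enn2real (min (ennreal (real n)) (\<tau> n \<omega>))" for n \<omega>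
  have S: "0 \<le> S n \<omega>" "S n \<omega> \<le> real n" for n \<omega>
    unfolding S_def by (auto intro: enn2real_leI)
  have S_min: "ennreal (S n \<omega>) = min (ennreal (real n)) (\<tau> n \<omega>)" for n \<omega>
    unfolding S_def by (rule ennreal_enn2real) (simp add: min_less_iff_disj)
  have S_sets: "{\<omega>\<in>space P. S n \<omega> \<le> s} \<in> sets (F s)" if s: "0 \<le> s" for n s
  proof -
    have "S n \<omega> \<le> s \<longleftrightarrow> real n \<le> s \<or> \<tau> n \<omega> \<le> ennreal s" for \<omega>
    proof -
      have "S n \<omega> \<le> s \<longleftrightarrow> ennreal (S n \<omega>) \<le> ennreal s" using s by simp
      also have "\<dots> \<longleftrightarrow> real n \<le> s \<or> \<tau> n \<omega> \<le> ennreal s"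
        unfolding S_min min_le_iff_disj using s by simp
      finally show ?thesis .
    qed
    moreover have "{\<omega>\<in>space P. real n \<le> s \<or> \<tau> n \<omega> \<le> ennreal s} \<in> sets (F s)"
    proof (cases "real n \<le> s")
      case True
      then show ?thesis using sets.top[of "F s"] by simp
    next
      case False
      have "{\<omega>\<in>space (F s). \<tau> n \<omega> \<le> ennreal s} \<in> sets (F s)"
        using \<tau>(1)[of n] s unfolding ext_stopping_time_def pred_def by blast
      then show ?thesis using False by simp
    qed
    ultimately show ?thesis by (simp only:)
  qed
  define N where "N n t \<omega> = M (min t (S n \<omega>)) \<omega>" for n t \<omega>
  have N_stopped: "N n t = stopped M (\<tau> n) (min t (real n))" if "0 \<le> t" for n t
  proof
    fix \<omega>
    have "min (ennreal (min t (real n))) (\<tau> n \<omega>) = min (ennreal t) (ennreal (S n \<omega>))"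
      unfolding S_min using that by (simp add: min_ennreal[symmetric] min.assoc)
    also have "\<dots> = ennreal (min t (S n \<omega>))" using that S by (simp add: min_ennreal)
    finally show "N n t \<omega> = stopped M (\<tau> n) (min t (real n)) \<omega>"
      using that S[of n \<omega>] by (simp add: N_def stopped_def)
  qed
  have closed: "closed_martingale P F (N n) (N n (real n)) (real n)" for n
  proof
    have mart: "adapted F (stopped M (\<tau> n))" "\<And>t. 0 \<le> t \<Longrightarrow> integrable P (stopped M (\<tau> n) t)"
      "\<And>s t. 0 \<le> s \<Longrightarrow> s \<le> t \<Longrightarrow>
        AE \<omega> in P. real_cond_exp P (F s) (stopped M (\<tau> n) t) \<omega> = stopped M (\<tau> n) s \<omega>"
      using \<tau>(3)[of n] by (auto simp: martingale_def)
    show "adapted F (N n)" unfolding adapted_def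
    proof (intro allI impI)
      fix t :: real assume t: "0 \<le> t"
      have "stopped M (\<tau> n) (min t (real n)) \<in> borel_measurable (F (min t (real n)))"
        using mart(1) t by (simp add: adapted_def)
      then show "N n t \<in> borel_measurable (F t)"
        unfolding N_stopped[OF t] by (rule measurable_F_mono[rotated]) simp
    qed
    show "integrable P (N n s)" if "0 \<le> s" for s
      unfolding N_stopped[OF that] using mart(2) that by simp
    then show "integrable P (N n (real n))" by simp
    show "N n s \<omega> = N n (real n) \<omega>" if "real n \<le> s" for s \<omega>
      using order_trans[OF S(2)[of n \<omega>] that] S(2)[of n \<omega>] by (simp add: N_def min_absorb2)
    show "cadlag_path (\<lambda>s. N n s \<omega>)" if "\<omega> \<in> space P" for \<omega>
      unfolding N_def by (rule cadlag_stop[OF cadlag[OF that]])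
    show "(LINT \<omega>:B|P. N n s \<omega>) = (LINT \<omega>:B|P. N n (real n) \<omega>)" if s: "0 \<le> s" and B: "B \<in> sets (F s)" for s B
    proof (cases "s \<le> real n")
      case True
      interpret finite_measure_subalgebra P "F s" by unfold_locales (rule subalgebra_F)
      have "(LINT \<omega>:B|P. N n (real n) \<omega>) = (LINT \<omega>:B|P. real_cond_exp P (F s) (N n (real n)) \<omega>)"
        using mart(2) B by (intro real_cond_exp_intA) (auto simp: N_stopped)
      also have "\<dots> = (LINT \<omega>:B|P. N n s \<omega>)"
      proof -
        have "AE \<omega> in P. real_cond_exp P (F s) (N n (real n)) \<omega> = N n s \<omega>"
          using mart(3)[OF s True] s True by (simp add: N_stopped min_absorb1)
        moreover have "N n s \<in> borel_measurable P"
          using mart(2)[of "min s (real n)"] s by (simp add: N_stopped borel_measurable_integrable)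
        ultimately show ?thesis
          using sets_F_subset[OF B]
          by (intro set_lebesgue_integral_cong_AE) (auto intro: borel_measurable_cond_exp2 elim: eventually_mono)
      qed
      finally show ?thesis by simp
    next
      case False
      then have "N n s = N n (real n)" using S(2)[of n] by (simp add: N_def fun_eq_iff min_absorb2 order_trans[OF S(2)])
      then show ?thesis by simp
    qed
  qed
  define \<tau>' where "\<tau>' n \<omega> = ennreal (A (S n \<omega>) \<omega>)" for n \<omega>
  show ?thesis
    unfolding local_martingale_def
  proof (intro conjI exI[of _ \<tau>'] allI)
    show "adapted F' (changed M)"
      by (rule changed_adapted[OF adapted]) (use cadlag in \<open>auto simp: cadlag_path_def\<close>)
    show "ext_stopping_time F' (\<tau>' n)" for n
      unfolding ext_stopping_time_def pred_def \<tau>'_def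
      using stopped_clock_sets[of "S n", OF S_sets S(1)] by simp
    show "AE \<omega> in P. incseq (\<lambda>n. \<tau>' n \<omega>) \<and> (\<lambda>n. \<tau>' n \<omega>) \<longlonglongrightarrow> \<infinity>"
      using \<tau>(2) AE_space
    proof eventually_elim
      case (elim \<omega>)
      interpret clock "\<lambda>t. A t \<omega>" by (rule A_clock) (use elim in simp)
      have S_mono: "S m \<omega> \<le> S n \<omega>" if "m \<le> n" for m n
      proof -
        have "min (ennreal (real m)) (\<tau> m \<omega>) \<le> min (ennreal (real n)) (\<tau> n \<omega>)"
          using elim incseqD[of "\<lambda>n. \<tau> n \<omega>" m n] that by (intro min.mono) (auto intro: ennreal_leI)
        then show ?thesis using S(1) by (simp flip: S_min)
      qed
      have "incseq (\<lambda>n. \<tau>' n \<omega>)"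
        unfolding \<tau>'_def using S_mono S(1) by (intro incseq_SucI ennreal_leI) (simp add: le_iff)
      moreover have "filterlim (\<lambda>n. A (S n \<omega>) \<omega>) at_top sequentially"
        unfolding filterlim_at_top
      proof
        fix x
        obtain t where t: "0 \<le> t" "x \<le> A t \<omega>" using unbounded by blast
        have "eventually (\<lambda>n. ennreal t < \<tau> n \<omega>) sequentially"
          using elim by (intro order_tendstoD(1)[of _ \<infinity>]) auto
        moreover have "eventually (\<lambda>n. t \<le> real n) sequentially"
          using filterlim_real_sequentially by (simp add: filterlim_at_top)
        ultimately show "eventually (\<lambda>n. x \<le> A (S n \<omega>) \<omega>) sequentially"
        proof eventually_elim
          case (elim n)
          then have "ennreal t \<le> ennreal (S n \<omega>)" unfolding S_min by (auto intro: ennreal_leI)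
          then have "t \<le> S n \<omega>" using S(1) by simp
          then show ?case using t le_iff[OF t(1) S(1)] by (auto intro: order_trans)
        qed
      qed
      ultimately show ?case unfolding \<tau>'_def by (simp add: ennreal_tendsto_top_eq_at_top)
    qed
    show "martingale P F' (stopped (changed M) (\<tau>' n))" for n
    proof (rule changed.martingale_cong)
      interpret closed_martingale P F "N n" "N n (real n)" "real n" by (rule closed)
      interpret clocked_martingale P F A "N n" "N n (real n)" "real n" by unfold_locales simp
      show "martingale P F' (changed (N n))" by (rule changed_martingale)
      fix t :: real and \<omega> assume t: "0 \<le> t" and w: "\<omega> \<in> space P"
      interpret clock "\<lambda>t. A t \<omega>" by (rule A_clock[OF w])
      have "enn2real (min (ennreal t) (\<tau>' n \<omega>)) = min t (A (S n \<omega>) \<omega>)"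
        using t clock_nonneg[OF S(1)] by (simp add: \<tau>'_def min_ennreal)
      then show "stopped (changed M) (\<tau>' n) t \<omega> = changed (N n) t \<omega>"
        using time_change_stop[OF t S(1)[of n \<omega>], of "\<lambda>t. M t \<omega>"]
        by (simp add: stopped_def changed_def N_def)
    qed
  qed
qed

end

section \<open>Transfer of the assumptions\<close>

lemma clocked_of_assumption:
  assumes "usual_conditions P F" "assumption_common P F c0 \<eta> X A H M"
    and "\<And>\<omega>. \<omega> \<in> space P \<Longrightarrow> strict_mono_on {0..} (continuous_part (\<lambda>t. A t \<omega>))"
    and "\<And>\<omega>. \<omega> \<in> space P \<Longrightarrow> filterlim (continuous_part (\<lambda>t. A t \<omega>)) at_top at_top"
  shows "clocked P F A"
proof -
  have "clock (\<lambda>t. A t \<omega>)" if "\<omega> \<in> space P" for \<omega>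
    by (rule clock_of_strict_continuous_part) (use assms that in \<open>auto simp: assumption_common_def\<close>)
  moreover have "filtered_prob_space P F" "predictable F A"
    using assms(2) by (auto simp: assumption_common_def)
  ultimately show ?thesis
    using assms(1) by (simp add: clocked_def clocked_axioms_def filtered_def)
qed

context clocked
begin

lemma changed_assumption_common:
  assumes asm: "assumption_common P F c0 \<eta> X A H M"
  shows "assumption_common P F' c0 \<eta> (changed X) (\<lambda>t \<omega>. t) (changed H) (changed M)"
proof -
  have X: "adapted F X" "\<And>\<omega>. \<omega> \<in> space P \<Longrightarrow> right_cont_path (\<lambda>t. X t \<omega>)"
      "\<And>\<omega> t. \<omega> \<in> space P \<Longrightarrow> 0 \<le> t \<Longrightarrow> c0 \<le> X t \<omega>"
    and H: "adapted F H" "\<And>\<omega>. \<omega> \<in> space P \<Longrightarrow> cadlag_path (\<lambda>t. H t \<omega>)"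
      "\<And>\<omega>. \<omega> \<in> space P \<Longrightarrow> mono_on {0..} (\<lambda>t. H t \<omega>)"
      "\<And>\<omega> t. \<omega> \<in> space P \<Longrightarrow> 0 \<le> t \<Longrightarrow> 0 \<le> H t \<omega>"
    and M: "local_martingale P F M" "\<And>\<omega>. \<omega> \<in> space P \<Longrightarrow> cadlag_path (\<lambda>t. M t \<omega>)"
      "\<And>\<omega>. \<omega> \<in> space P \<Longrightarrow> M 0 \<omega> = 0"
    using asm by (auto simp: assumption_common_def)
  have "adapted F' (changed X)" by (rule changed_adapted[OF X(1,2)])
  moreover have "adapted F' (changed H)"
    by (rule changed_adapted[OF H(1)]) (use H(2) in \<open>simp add: cadlag_path_def\<close>)
  moreover have "local_martingale P F' (changed M)" by (rule changed_local_martingale[OF M(1,2)])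
  moreover have "predictable F' (\<lambda>t \<omega>. t)"
    unfolding predictable_def by (rule changed.predictable_time)
  moreover have "right_cont_path (\<lambda>t. changed X t \<omega>) \<and> (\<forall>t\<ge>0. c0 \<le> changed X t \<omega>)" if w: "\<omega> \<in> space P" for \<omega>
    unfolding changed_def
    using clock.right_cont_time_change[OF A_clock[OF w] X(2)[OF w]]
      clock.time_change_ge[OF A_clock[OF w], of _ c0 "\<lambda>t. X t \<omega>"] X(3)[OF w] by simp
  moreover have "cadlag_path (\<lambda>t. changed H t \<omega>) \<and> mono_on {0..} (\<lambda>t. changed H t \<omega>) \<and>
      (\<forall>t\<ge>0. 0 \<le> changed H t \<omega>)" if w: "\<omega> \<in> space P" for \<omega>
    unfolding changed_def
    using clock.cadlag_time_change[OF A_clock[OF w] H(2)[OF w]]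
      clock.mono_time_change[OF A_clock[OF w] H(3)[OF w]]
      clock.time_change_ge[OF A_clock[OF w], of _ 0 "\<lambda>t. H t \<omega>"] H(4)[OF w] by simp
  moreover have "cadlag_path (\<lambda>t. changed M t \<omega>) \<and> changed M 0 \<omega> = 0" if w: "\<omega> \<in> space P" for \<omega>
    unfolding changed_def
    using clock.cadlag_time_change[OF A_clock[OF w] M(2)[OF w]]
      clock.time_change_zero[OF A_clock[OF w]] M(3)[OF w] by simp
  moreover have "cadlag_path (\<lambda>t. t)" "mono_on {0..} (\<lambda>t::real. t)"
    by (auto simp: cadlag_path_def right_cont_path_def left_limits_path_def mono_on_def intro: tendsto_ident_at)
  ultimately show ?thesis
    using asm filtered_changed unfolding assumption_common_def by simp
qed

lemma changed_assumption_nosup: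
  assumes asm: "assumption_nosup P F c0 \<eta> X A H M"
  shows "assumption_nosup P F' c0 \<eta> (changed X) (\<lambda>t \<omega>. t) (changed H) (changed M)"
  unfolding assumption_nosup_def
proof (intro conjI ballI allI impI)
  have common: "assumption_common P F c0 \<eta> X A H M"
    and ll: "\<And>\<omega>. \<omega> \<in> space P \<Longrightarrow> left_limits_path (\<lambda>t. X t \<omega>)"
    using asm by (auto simp: assumption_nosup_def)
  show "assumption_common P F' c0 \<eta> (changed X) (\<lambda>t \<omega>. t) (changed H) (changed M)"
    by (rule changed_assumption_common[OF common])
  show "left_limits_path (\<lambda>t. changed X t \<omega>)" if w: "\<omega> \<in> space P" for \<omega>
    unfolding changed_def by (rule clock.left_limits_time_change[OF A_clock[OF w] ll[OF w]])
  fix u :: real assume u: "0 \<le> u"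
  have "AE \<omega> in P. \<forall>q\<in>\<rat> \<inter> {0..}. X q \<omega> \<le>
      (LINT s:{0<..q}|stieltjes (\<lambda>s. A s \<omega>). \<eta> (left_lim (\<lambda>u. X u \<omega>) s)) + M q \<omega> + H q \<omega>"
    by (rule AE_ball_countable') (use asm countable_rat in \<open>auto simp: assumption_nosup_def\<close>)
  then show "AE \<omega> in P. changed X u \<omega> \<le>
      (LINT s:{0<..u}|uniform_clock. \<eta> (left_lim (\<lambda>u. changed X u \<omega>) s)) + changed M u \<omega> + changed H u \<omega>"
    using AE_space
  proof eventually_elim
    case (elim \<omega>)
    interpret clock "\<lambda>t. A t \<omega>" by (rule A_clock) (use elim in simp)
    have paths: "right_cont_path (\<lambda>t. X t \<omega>)" "\<And>t. 0 \<le> t \<Longrightarrow> c0 \<le> X t \<omega>"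
        "cadlag_path (\<lambda>t. M t \<omega>)" "cadlag_path (\<lambda>t. H t \<omega>)"
      and \<eta>: "continuous_on {c0..} \<eta>" "mono_on {c0..} \<eta>" "\<And>x. c0 \<le> x \<Longrightarrow> 0 \<le> \<eta> x"
      using common elim(2) by (simp_all add: assumption_common_def)
    have ineq: "\<And>q. q \<in> \<rat> \<Longrightarrow> 0 \<le> q \<Longrightarrow> X q \<omega> \<le>
      (LINT s:{0<..q}|stieltjes (\<lambda>s. A s \<omega>). \<eta> (left_lim (\<lambda>u. X u \<omega>) s)) + M q \<omega> + H q \<omega>"
      using elim(1) by simp
    have "cadlag_path (\<lambda>t. X t \<omega>)" using paths(1) ll[OF elim(2)] by (simp add: cadlag_path_def)
    then show ?case unfolding changed_def
      by (rule nosup_inequality_time_change[where c = c0, OF _ paths(2-4) \<eta> ineq u])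
  qed
qed

lemma changed_assumption_sup:
  assumes asm: "assumption_sup P F c0 \<eta> X A H M"
  shows "assumption_sup P F' c0 \<eta> (changed X) (\<lambda>t \<omega>. t) (changed H) (changed M)"
  unfolding assumption_sup_def
proof (intro conjI ballI allI impI)
  have common: "assumption_common P F c0 \<eta> X A H M"
    using asm by (auto simp: assumption_sup_def)
  show "assumption_common P F' c0 \<eta> (changed X) (\<lambda>t \<omega>. t) (changed H) (changed M)"
    by (rule changed_assumption_common[OF common])
  have "AE \<omega> in P. \<forall>n::nat. bdd_above ((\<lambda>s. X s \<omega>) ` {0..<real n})"
    using asm by (auto simp: assumption_sup_def AE_all_countable)
  then have bdd: "AE \<omega> in P. \<forall>t. bdd_above ((\<lambda>s. X s \<omega>) ` {0..<t})"
  proof eventually_elim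
    case (elim \<omega>)
    show ?case
    proof
      fix t :: real
      obtain n where "t < real n" using reals_Archimedean2 by blast
      then show "bdd_above ((\<lambda>s. X s \<omega>) ` {0..<t})"
        by (intro bdd_above_mono[OF elim[rule_format, of n]]) auto
    qed
  qed
  fix u :: real assume u: "0 \<le> u"
  show "AE \<omega> in P. bdd_above ((\<lambda>s. changed X s \<omega>) ` {0..<u})"
    using bdd AE_space
  proof eventually_elim
    case (elim \<omega>)
    interpret clock "\<lambda>t. A t \<omega>" by (rule A_clock) (use elim in simp)
    show ?case unfolding changed_def
      by (rule bdd_aboveI2, rule time_change_le_running_sup[where c = c0 and v = u])
         (use common elim in \<open>auto simp: assumption_common_def\<close>)
  qed
  have "AE \<omega> in P. \<forall>q\<in>\<rat> \<inter> {0..}. X q \<omega> \<le>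
      (LINT s:{0<..q}|stieltjes (\<lambda>s. A s \<omega>). \<eta> (running_sup_left (\<lambda>u. X u \<omega>) s)) + M q \<omega> + H q \<omega>"
    by (rule AE_ball_countable') (use asm countable_rat in \<open>auto simp: assumption_sup_def\<close>)
  then show "AE \<omega> in P. changed X u \<omega> \<le>
      (LINT s:{0<..u}|uniform_clock. \<eta> (running_sup_left (\<lambda>u. changed X u \<omega>) s)) + changed M u \<omega> + changed H u \<omega>"
    using AE_space bdd
  proof eventually_elim
    case (elim \<omega>)
    interpret clock "\<lambda>t. A t \<omega>" by (rule A_clock) (use elim in simp)
    have paths: "right_cont_path (\<lambda>t. X t \<omega>)" "\<And>t. 0 \<le> t \<Longrightarrow> c0 \<le> X t \<omega>"
        "cadlag_path (\<lambda>t. M t \<omega>)" "cadlag_path (\<lambda>t. H t \<omega>)"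
      and \<eta>: "mono_on {c0..} \<eta>" "\<And>x. c0 \<le> x \<Longrightarrow> 0 \<le> \<eta> x"
      using common elim(2) by (simp_all add: assumption_common_def)
    have ineq: "\<And>q. q \<in> \<rat> \<Longrightarrow> 0 \<le> q \<Longrightarrow> X q \<omega> \<le>
      (LINT s:{0<..q}|stieltjes (\<lambda>s. A s \<omega>). \<eta> (running_sup_left (\<lambda>u. X u \<omega>) s)) + M q \<omega> + H q \<omega>"
      using elim(1) by simp
    show ?case unfolding changed_def
      by (rule sup_inequality_time_change[where c = c0, OF paths(1,2) elim(3)[rule_format] paths(3,4) \<eta> ineq u])
  qed
qed

end

theorem lemma4p8:
  fixes P :: "'a measure" and F :: "real \<Rightarrow> 'a measure"
    and c0 :: real and \<eta> :: "real \<Rightarrow> real"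
    and X A H M :: "real \<Rightarrow> 'a \<Rightarrow> real"
    and Asm :: "'a measure \<Rightarrow> (real \<Rightarrow> 'a measure) \<Rightarrow> real \<Rightarrow> (real \<Rightarrow> real) \<Rightarrow> (real \<Rightarrow> 'a \<Rightarrow> real) \<Rightarrow>
      (real \<Rightarrow> 'a \<Rightarrow> real) \<Rightarrow> (real \<Rightarrow> 'a \<Rightarrow> real) \<Rightarrow> (real \<Rightarrow> 'a \<Rightarrow> real) \<Rightarrow> bool"
  assumes Asm_cases: "Asm = assumption_nosup \<or> Asm = assumption_sup"
    and usual: "usual_conditions P F"
    and asm: "Asm P F c0 \<eta> X A H M"
    and Ac_strict: "\<And>\<omega>. \<omega> \<in> space P \<Longrightarrow> strict_mono_on {0..} (continuous_part (\<lambda>t. A t \<omega>))"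
    and Ac_infinity: "\<And>\<omega>. \<omega> \<in> space P \<Longrightarrow> filterlim (continuous_part (\<lambda>t. A t \<omega>)) at_top at_top"
  shows "\<exists>(F' :: real \<Rightarrow> 'a measure) (X' :: real \<Rightarrow> 'a \<Rightarrow> real) (A' :: real \<Rightarrow> 'a \<Rightarrow> real)
           (H' :: real \<Rightarrow> 'a \<Rightarrow> real) (M' :: real \<Rightarrow> 'a \<Rightarrow> real).
      Asm P F' c0 \<eta> X' A' H' M' \<and>
      (\<forall>t\<ge>0. \<forall>\<omega>\<in>space P. A' t \<omega> = t) \<and>
      (\<forall>t\<ge>0. \<forall>\<omega>\<in>space P.
         X' (A t \<omega>) \<omega> = X t \<omega> \<and> M' (A t \<omega>) \<omega> = M t \<omega> \<and> H' (A t \<omega>) \<omega> = H t \<omega>) \<and>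
      (\<forall>s\<ge>0. stopping_time F' (A s)) \<and>
      (predictable F H \<longrightarrow> predictable F' H') \<and>
      ((\<forall>\<omega>\<in>space P. no_negative_jumps (\<lambda>t. M t \<omega>)) \<longrightarrow>
        (\<forall>\<omega>\<in>space P. no_negative_jumps (\<lambda>t. M' t \<omega>))) \<and>
      usual_conditions P F'"
proof -
  have common: "assumption_common P F c0 \<eta> X A H M"
    using Asm_cases asm by (auto simp: assumption_nosup_def assumption_sup_def)
  interpret clocked P F A
    by (rule clocked_of_assumption[OF usual common Ac_strict Ac_infinity])
  have "Asm P F' c0 \<eta> (changed X) (\<lambda>t \<omega>. t) (changed H) (changed M)"
    using Asm_cases asm changed_assumption_nosup changed_assumption_sup by blast
  moreover have "changed Y (A t \<omega>) \<omega> = Y t \<omega>" if "0 \<le> t" "\<omega> \<in> space P" for Y t \<omega>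
    unfolding changed_def by (rule clock.time_change_clock[OF A_clock[OF that(2)] that(1)])
  moreover have "stopping_time F' (A s)" if "0 \<le> s" for s
  proof -
    have "{\<omega>\<in>space P. A s \<omega> \<le> u} \<in> sets (F' u)" for u
      by (rule stopped_clock_sets[of "\<lambda>_. s"]) (use that sets.top[of "F _"] in auto)
    then show ?thesis by (simp add: stopping_time_def pred_def)
  qed
  moreover have "predictable F' (changed H)" if "predictable F H"
    by (rule changed_predictable[OF that]) (use common in \<open>auto simp: assumption_common_def\<close>)
  moreover have "no_negative_jumps (\<lambda>t. changed M t \<omega>)"
    if "no_negative_jumps (\<lambda>t. M t \<omega>)" "\<omega> \<in> space P" for \<omega>
    unfolding changed_def
    by (rule clock.no_negative_jumps_time_change[OF A_clock[OF that(2)] _ that(1)])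
       (use common that in \<open>auto simp: assumption_common_def\<close>)
  ultimately show ?thesis
    using usual_changed
    by - (rule exI[of _ F'], rule exI[of _ "changed X"], rule exI[of _ "\<lambda>t \<omega>. t"],
        rule exI[of _ "changed H"], rule exI[of _ "changed M"], blast)
qed

end
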